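(* Let $\phi:\mathbb{P}^1\to\mathbb{P}^1$ be a rational map defined over a global function field $K$ of characteristic $p$ with exactly one prime of bad reduction, and let $\mathcal{A}\subseteq\mathbb{P}^1(K)$ be a finite orbit of $\phi$. Then: (i) $\#\mathcal{A}\leqslant3\cdot\#k(\mathfrak p)+6$ for every prime $\mathfrak p$ of good reduction for $\phi$; (ii) if $K$ is an extension of $\mathbb{F}_p(t)$ of degree $D=[K:\mathbb{F}_p(t)]$, then $\#\mathcal{A}\leqslant3p^D+6$.
   Context: A global function field is a finite extension of $\mathbb{F}_p(t)$; its primes are its places, each with valuation ring $R_{\mathfrak p}$, maximal ideal $\mathfrak p$ and residue field $k(\mathfrak p)$. Write $\phi=[F:G]$ with $F,G$ coprime homogeneous over $K$; for a prime $\mathfrak p$ scale so all coefficients lie in $R_{\mathfrak p}$ and not all in $\mathfrak p$; $\phi$ has good reduction at $\mathfrak p$ if the homogeneous resultant $\mathrm{Res}(F,G)$ is a unit of $R_{\mathfrak p}$, bad reduction otherwise. A finite orbit is a forward orbit $\{\phi^i(P):i\geqslant0\}$ that is a finite set. *)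

theory Defs
  imports "HOL-Computational_Algebra.Polynomial" "Jordan_Normal_Form.Determinant"
begin

definition Fpt :: "'k::field \<Rightarrow> 'k set" where
  "Fpt t = {poly (map_poly of_int f) t / poly (map_poly of_int g) t | f g.
              poly (map_poly of_int g) t \<noteq> 0}"

definition transc_prime :: "'k::field \<Rightarrow> bool" where
  "transc_prime t \<longleftrightarrow> (\<forall>f::int poly. poly (map_poly of_int f) t = 0 \<longrightarrow> map_poly (of_int :: int \<Rightarrow> 'k) f = 0)"

definition ext_degree :: "'k::field set \<Rightarrow> nat \<Rightarrow> bool" where
  "ext_degree L D \<longleftrightarrow> (\<exists>b :: nat \<Rightarrow> 'k. \<forall>x.
      \<exists>!c. (\<forall>i. (i < D \<longrightarrow> c i \<in> L) \<and> (D \<le> i \<longrightarrow> c i = 0)) \<and> x = (\<Sum>i<D. c i * b i))"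

definition global_function_field :: "'k::field itself \<Rightarrow> bool" where
  "global_function_field _ \<longleftrightarrow> prime CHAR('k) \<and>
     (\<exists>(t::'k) D. transc_prime t \<and> ext_degree (Fpt t) D)"

text \<open>A prime of K is given by its normalized discrete valuation v : K* \<rightarrow> Z (onto);
  we fix the convention v 0 = 0 so that primes correspond bijectively to such functions.\<close>
definition prime_val :: "('k::field \<Rightarrow> int) \<Rightarrow> bool" where
  "prime_val v \<longleftrightarrow> v 0 = 0 \<and>
     (\<forall>x y. x \<noteq> 0 \<longrightarrow> y \<noteq> 0 \<longrightarrow> v (x * y) = v x + v y) \<and>
     (\<forall>x y. x \<noteq> 0 \<longrightarrow> y \<noteq> 0 \<longrightarrow> x + y \<noteq> 0 \<longrightarrow> min (v x) (v y) \<le> v (x + y)) \<and>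
     (\<exists>x. x \<noteq> 0 \<and> v x = 1)"

definition val_ring :: "('k::field \<Rightarrow> int) \<Rightarrow> 'k set" where
  "val_ring v = {x. x = 0 \<or> 0 \<le> v x}"

definition max_ideal :: "('k::field \<Rightarrow> int) \<Rightarrow> 'k set" where
  "max_ideal v = {x. x = 0 \<or> 1 \<le> v x}"

definition residue_card :: "('k::field \<Rightarrow> int) \<Rightarrow> nat" where
  "residue_card v = card (val_ring v //
      {(x, y). x \<in> val_ring v \<and> y \<in> val_ring v \<and> x - y \<in> max_ideal v})"

definition is_unit_at :: "('k::field \<Rightarrow> int) \<Rightarrow> 'k \<Rightarrow> bool" where
  "is_unit_at v x \<longleftrightarrow> x \<noteq> 0 \<and> v x = 0"

text \<open>A rational map of degree d is [F:G] with F(X,Y) = sum_i coeff f i X^i Y^(d-i),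
  G(X,Y) = sum_i coeff g i X^i Y^(d-i), where f, g are polynomials of degree at most d
  (the dehomogenisations F(x,1), G(x,1)).\<close>

definition hom_coprime :: "'k::field poly \<Rightarrow> 'k poly \<Rightarrow> nat \<Rightarrow> bool" where
  "hom_coprime f g d \<longleftrightarrow> degree f \<le> d \<and> degree g \<le> d \<and>
     (coeff f d \<noteq> 0 \<or> coeff g d \<noteq> 0) \<and> coprime f g"

definition hom_sylvester :: "'k::field poly \<Rightarrow> 'k poly \<Rightarrow> nat \<Rightarrow> 'k mat" where
  "hom_sylvester f g d = mat (2*d) (2*d) (\<lambda>(i, j).
      if i < d then (if i \<le> j \<and> j - i \<le> d then coeff f (d - (j - i)) else 0)
      else (if i - d \<le> j \<and> j - (i - d) \<le> d then coeff g (d - (j - (i - d))) else 0))"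

definition hom_res :: "'k::field poly \<Rightarrow> 'k poly \<Rightarrow> nat \<Rightarrow> 'k" where
  "hom_res f g d = det (hom_sylvester f g d)"

definition good_reduction :: "('k::field \<Rightarrow> int) \<Rightarrow> 'k poly \<Rightarrow> 'k poly \<Rightarrow> nat \<Rightarrow> bool" where
  "good_reduction v f g d \<longleftrightarrow> (\<exists>c. c \<noteq> 0 \<and>
     (\<forall>i\<le>d. c * coeff f i \<in> val_ring v \<and> c * coeff g i \<in> val_ring v) \<and>
     (\<exists>i\<le>d. c * coeff f i \<notin> max_ideal v \<or> c * coeff g i \<notin> max_ideal v) \<and>
     is_unit_at v (hom_res (smult c f) (smult c g) d))"

text \<open>Points of P^1(K): None is \<infinity> = [1:0], Some x is [x:1].\<close>
definition rat_map :: "'k::field poly \<Rightarrow> 'k poly \<Rightarrow> nat \<Rightarrow> 'k option \<Rightarrow> 'k option" where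
  "rat_map f g d P = (case P of
      None \<Rightarrow> (if coeff g d = 0 then None else Some (coeff f d / coeff g d))
    | Some x \<Rightarrow> (if poly g x = 0 then None else Some (poly f x / poly g x)))"

definition orbit :: "('a \<Rightarrow> 'a) \<Rightarrow> 'a \<Rightarrow> 'a set" where
  "orbit h P = {(h ^^ i) P | i. True}"

end

theory Submission
  imports Defs "HOL-Library.Extended_Nat" "HOL-Library.FuncSet" "HOL-Computational_Algebra.Primes"
begin

text \<open>At a place of good reduction the \<open>v\<close>-adic distance \<open>\<delta>\<^sub>v(P,Q)\<close> (the order of vanishing of the
  determinant of normalised coordinates) does not decrease under \<open>\<phi>\<close>, and even
  \<open>\<delta>\<^sub>v(\<phi> T, \<phi> Q) \<ge> \<delta>\<^sub>v(T,Q) + \<delta>\<^sub>v(T,Q')\<close> if \<open>\<phi> Q = \<phi> Q'\<close> with \<open>Q \<noteq> Q'\<close>. As only one place is bad, a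
  cross ratio \<open>u\<close> which is a unit at all good places is algebraic over the prime field, so
  \<open>1 - u\<close> is a unit at all good places as well.

  For a cycle of length \<open>n\<close>, the distance of \<open>\<phi>\<^sup>i P\<close> and \<open>\<phi>\<^sup>j P\<close> depends only on \<open>gcd(i - j, n)\<close>, and
  suitable cross ratios show that all distances at a given place are equal. Equidistant points inject
  into the projective line over the residue field, so \<open>n \<le> q + 1\<close> where \<open>q = #k(v)\<close>.

  Let \<open>m\<close> be the length of the tail. If \<open>m > 2 n\<close>, then \<open>\<phi>\<^sup>n\<close> has a fixed point \<open>A\<close> and tail points
  \<open>T\<^sub>3, T\<^sub>2, T\<^sub>1\<close> moving to \<open>A\<close>, where \<open>T\<^sub>1\<close> is the last tail point; a cross ratio gives
  \<open>\<delta>\<^sub>v(T\<^sub>1,A) = \<delta>\<^sub>v(T\<^sub>2,A)\<close>, while \<open>\<delta>\<^sub>v(T\<^sub>1,A) \<ge> 2 \<delta>\<^sub>v(T\<^sub>2,A)\<close>, so both vanish. It follows that the tail points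
  and a periodic point have distinct reductions and \<open>m \<le> q\<close>. In either case \<open>m + n \<le> 3 q + 3\<close>.

  For (ii), there are places with \<open>v(t) > 0\<close> and with \<open>v(t) < 0\<close>; one of them is good, and both have
  residue fields with at most \<open>p\<^sup>D\<close> elements.\<close>

section \<open>Discrete valuations\<close>

text \<open>Since \<open>v 0 = 0\<close> is a junk value, lower bounds on valuations are stated with \<open>vge\<close>.\<close>
definition vge :: "('k::field \<Rightarrow> int) \<Rightarrow> int \<Rightarrow> 'k \<Rightarrow> bool" where
  "vge v k x \<longleftrightarrow> x = 0 \<or> k \<le> v x"

lemma val_ring_iff: "x \<in> val_ring v \<longleftrightarrow> vge v 0 x"
  by (simp add: val_ring_def vge_def)

lemma max_ideal_iff: "x \<in> max_ideal v \<longleftrightarrow> vge v 1 x"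
  by (simp add: max_ideal_def vge_def)

locale discrete_valuation =
  fixes v :: "'k::field \<Rightarrow> int"
  assumes prime_val: "prime_val v"
begin

lemma v_mult: "x \<noteq> 0 \<Longrightarrow> y \<noteq> 0 \<Longrightarrow> v (x * y) = v x + v y"
  using prime_val unfolding prime_val_def by blast

lemma v_zero [simp]: "v 0 = 0"
  using prime_val unfolding prime_val_def by blast

lemma v_one [simp]: "v 1 = 0"
  using v_mult[of 1 1] by simp

lemma v_uminus [simp]: "v (- x) = v x"
proof (cases "x = 0")
  case False
  have "2 * v (- 1) = 0"
    using v_mult[of "- 1" "- 1"] by simp
  with False show ?thesis
    using v_mult[of "- 1" x] by simp
qed simp

lemma v_inverse [simp]: "v (inverse x) = - v x"
proof (cases "x = 0")
  case False
  then show ?thesis using v_mult[of x "inverse x"] by simp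
qed simp

lemma v_divide: "x \<noteq> 0 \<Longrightarrow> y \<noteq> 0 \<Longrightarrow> v (x / y) = v x - v y"
  by (simp add: divide_inverse v_mult)

lemma v_power: "v (x ^ n) = int n * v x"
proof (cases "x = 0")
  case True then show ?thesis by (cases n) auto
next
  case False then show ?thesis by (induction n) (auto simp: v_mult algebra_simps)
qed

lemma vge_0 [simp]: "vge v k 0"
  by (simp add: vge_def)

lemma vge_1 [simp]: "vge v k 1 \<longleftrightarrow> k \<le> 0"
  by (simp add: vge_def)

lemma vge_mono: "vge v k x \<Longrightarrow> l \<le> k \<Longrightarrow> vge v l x"
  by (auto simp: vge_def)

lemma vge_uminus [simp]: "vge v k (- x) \<longleftrightarrow> vge v k x"
  by (simp add: vge_def)

lemma vge_add: "vge v k x \<Longrightarrow> vge v k y \<Longrightarrow> vge v k (x + y)"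
proof -
  have "x \<noteq> 0 \<Longrightarrow> y \<noteq> 0 \<Longrightarrow> x + y \<noteq> 0 \<Longrightarrow> min (v x) (v y) \<le> v (x + y)"
    using prime_val unfolding prime_val_def by blast
  then show "vge v k x \<Longrightarrow> vge v k y \<Longrightarrow> vge v k (x + y)"
    by (fastforce simp: vge_def)
qed

lemma vge_diff: "vge v k x \<Longrightarrow> vge v k y \<Longrightarrow> vge v k (x - y)"
  using vge_add[of k x "- y"] by simp

lemma vge_mult: "vge v k x \<Longrightarrow> vge v l y \<Longrightarrow> vge v (k + l) (x * y)"
  by (cases "x = 0"; cases "y = 0") (auto simp: vge_def v_mult)

lemma vge_mult_left: "vge v 0 x \<Longrightarrow> vge v k y \<Longrightarrow> vge v k (x * y)"
  using vge_mult[of 0 x k y] by simp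

lemma vge_mult_right: "vge v k x \<Longrightarrow> vge v 0 y \<Longrightarrow> vge v k (x * y)"
  using vge_mult[of k x 0 y] by simp

lemma vge_sum: "(\<And>i. i \<in> A \<Longrightarrow> vge v k (h i)) \<Longrightarrow> vge v k (sum h A)"
  by (induction A rule: infinite_finite_induct) (auto intro: vge_add)

lemma vge_prod: "(\<And>i. i \<in> A \<Longrightarrow> vge v 0 (h i)) \<Longrightarrow> vge v 0 (prod h A)"
  by (induction A rule: infinite_finite_induct) (auto intro: vge_mult_left)

lemma vge_power: "vge v 0 x \<Longrightarrow> vge v 0 (x ^ n)"
  by (induction n) (auto intro: vge_mult_left)

lemma vge_of_nat: "vge v 0 (of_nat n)"
  by (induction n) (auto intro: vge_add)

lemma vge_of_int: "vge v 0 (of_int c)"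
  by (cases c rule: int_cases2) (auto intro: vge_of_nat)

lemma vge_mult_unit: "u \<noteq> 0 \<Longrightarrow> v u = 0 \<Longrightarrow> vge v k (u * x) \<longleftrightarrow> vge v k x"
  by (cases "x = 0") (auto simp: vge_def v_mult)

lemma unitI: "vge v 0 x \<Longrightarrow> \<not> vge v 1 x \<Longrightarrow> x \<noteq> 0 \<and> v x = 0"
  by (auto simp: vge_def)

section \<open>Determinants and adjugates of integral matrices\<close>

lemma vge_det:
  assumes "A \<in> carrier_mat n n" "\<And>i j. i < n \<Longrightarrow> j < n \<Longrightarrow> vge v 0 (A $$ (i, j))"
  shows "vge v 0 (det A)"
proof -
  have *: "vge v 0 (signof p)" for p
    by (simp add: sign_def)
  show ?thesis
    unfolding det_def'[OF assms(1)]
    by (rule vge_sum) (use assms(2) in \<open>auto intro!: vge_mult_left[OF * vge_prod] dest: permutes_in_image\<close>)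
qed

lemma vge_adj_mat:
  assumes A: "A \<in> carrier_mat n n" "\<And>i j. i < n \<Longrightarrow> j < n \<Longrightarrow> vge v 0 (A $$ (i, j))"
    and ij: "i < n" "j < n"
  shows "vge v 0 (adj_mat A $$ (i, j))"
proof -
  have B: "mat_delete A j i \<in> carrier_mat (n - 1) (n - 1)"
    using mat_delete_carrier[OF A(1)] .
  have "vge v 0 (det (mat_delete A j i))"
  proof (rule vge_det[OF B])
    fix a b assume ab: "a < n - 1" "b < n - 1"
    then show "vge v 0 (mat_delete A j i $$ (a, b))"
      using A ij unfolding mat_delete_def by (auto intro!: A(2))
  qed
  moreover have "vge v 0 ((- 1) ^ (j + i))"
    by (intro vge_power) simp
  ultimately show ?thesis
    using A(1) ij unfolding adj_mat_def cofactor_def by (auto intro: vge_mult_left)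
qed

end

section \<open>The v-adic distance on the projective line\<close>

text \<open>The coefficients are a plain function, read only up to \<open>d\<close>: the form keeps
  its degree when the leading coefficient vanishes, and exchanging the variables just reverses the
  indices.\<close>

definition hform :: "(nat \<Rightarrow> 'k::field) \<Rightarrow> nat \<Rightarrow> 'k \<Rightarrow> 'k \<Rightarrow> 'k" where
  "hform h d x y = (\<Sum>i\<le>d. h i * x ^ i * y ^ (d - i))"

lemma hform_scale: "hform h d (s * x) (s * y) = s ^ d * hform h d x y"
proof -
  have "s ^ d = s ^ i * s ^ (d - i)" if "i \<le> d" for i
    using that by (simp flip: power_add)
  then show ?thesis
    unfolding hform_def sum_distrib_left
    by (intro sum.cong refl) (auto simp: power_mult_distrib)
qed

lemma hform_swap: "hform (\<lambda>i. h (d - i)) d y x = hform h d x y"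
  unfolding hform_def
  by (rule sum.reindex_bij_witness[of _ "\<lambda>i. d - i" "\<lambda>i. d - i"]) (auto simp: mult_ac)

lemma hform_diff: "hform (\<lambda>i. a i * s - b i * t) d x y = hform a d x y * s - hform b d x y * t"
  unfolding hform_def sum_distrib_right sum_subtractf[symmetric]
  by (intro sum.cong refl) (simp add: algebra_simps)

text \<open>Isolates the top power of \<open>x\<close>; this drives the induction for division by a
  linear form.\<close>

lemma hform_Suc: "hform h (Suc d) x y = y * hform h d x y + h (Suc d) * x ^ Suc d"
proof -
  have "(\<Sum>i\<le>d. h i * x ^ i * y ^ (Suc d - i)) = y * hform h d x y"
    unfolding hform_def sum_distrib_left
    by (intro sum.cong refl) (auto simp: Suc_diff_le)
  then show ?thesis by (simp add: hform_def)
qed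

lemma hform_one: "degree f \<le> d \<Longrightarrow> hform (\<lambda>i. c * coeff f i) d x 1 = c * poly f x"
proof -
  assume "degree f \<le> d"
  then have "poly f x = (\<Sum>i\<le>d. coeff f i * x ^ i)"
    unfolding poly_altdef by (intro sum.mono_neutral_left) (auto simp: coeff_eq_0)
  then show ?thesis by (simp add: hform_def sum_distrib_left mult.assoc)
qed

lemma hform_infinity: "hform h d 1 0 = h d"
proof -
  have "hform h d 1 0 = (\<Sum>i\<le>d. if i = d then h d else 0)"
    unfolding hform_def by (intro sum.cong refl) (auto simp: power_0_left)
  then show ?thesis by simp
qed

text \<open>The point \<open>[x:y]\<close>. The pair \<open>(0, 0)\<close> also goes to infinity,
  like the corresponding branches of \<open>rat_map\<close>, so the two agree at a common zero as
  well.\<close>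

definition mkpt :: "'k::field \<Rightarrow> 'k \<Rightarrow> 'k option" where
  "mkpt x y = (if y = 0 then None else Some (x / y))"

lemma mkpt_scale: "s \<noteq> 0 \<Longrightarrow> mkpt (s * x) (s * y) = mkpt x y"
  by (simp add: mkpt_def)

text \<open>The scalars \<open>s\<close> and \<open>c\<close> leave room for two normalisations:
  coordinates of \<open>P\<close> normalised at a place, and coefficients scaled as in
  \<open>good_reduction\<close>.\<close>

lemma rat_map_eq_mkpt:
  assumes "degree f \<le> d" "degree g \<le> d" "c \<noteq> 0" "s \<noteq> 0"
    and P: "P = Some z \<and> x = s * z \<and> y = s \<or> P = None \<and> x = s \<and> y = 0"
  shows "rat_map f g d P = mkpt (hform (\<lambda>i. c * coeff f i) d x y) (hform (\<lambda>i. c * coeff g i) d x y)"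
  using P
proof
  assume *: "P = Some z \<and> x = s * z \<and> y = s"
  have "hform (\<lambda>i. c * coeff h i) d x y = s ^ d * (c * poly h z)" if "degree h \<le> d" for h
    using hform_scale[of "\<lambda>i. c * coeff h i" d s z 1] hform_one[OF that] * by simp
  then show ?thesis
    using * assms by (simp add: mkpt_scale rat_map_def) (simp add: mkpt_def)
next
  assume *: "P = None \<and> x = s \<and> y = 0"
  have "hform (\<lambda>i. c * coeff h i) d x y = s ^ d * (c * coeff h d)" for h
    using hform_scale[of "\<lambda>i. c * coeff h i" d s 1 0] hform_infinity[of "\<lambda>i. c * coeff h i" d] * by simp
  then show ?thesis
    using * assms by (simp add: mkpt_scale rat_map_def) (simp add: mkpt_def)
qed

text \<open>Homogeneous coordinates normalised at \<open>v\<close>: both are integral and one of them is \<open>1\<close>.\<close>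
definition coord_x :: "('k::field \<Rightarrow> int) \<Rightarrow> 'k option \<Rightarrow> 'k" where
  "coord_x v P = (case P of None \<Rightarrow> 1 | Some x \<Rightarrow> if x \<in> val_ring v then x else 1)"

definition coord_y :: "('k::field \<Rightarrow> int) \<Rightarrow> 'k option \<Rightarrow> 'k" where
  "coord_y v P = (case P of None \<Rightarrow> 0 | Some x \<Rightarrow> if x \<in> val_ring v then 1 else inverse x)"

lemma coord_scaled:
  obtains s z where "s \<noteq> 0"
    "P = Some z \<and> coord_x v P = s * z \<and> coord_y v P = s \<or> P = None \<and> coord_x v P = s \<and> coord_y v P = 0"
proof (cases P)
  case None
  then show ?thesis using that[of 1] by (simp add: coord_x_def coord_y_def)
next
  case (Some z)
  show ?thesis
  proof (cases "z \<in> val_ring v")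
    case True
    then show ?thesis using that[of 1 z] Some by (simp add: coord_x_def coord_y_def)
  next
    case False
    then have "z \<noteq> 0" by (auto simp: val_ring_def)
    then show ?thesis using that[of "inverse z" z] Some False by (simp add: coord_x_def coord_y_def)
  qed
qed

definition bracket :: "('k::field \<Rightarrow> int) \<Rightarrow> 'k option \<Rightarrow> 'k option \<Rightarrow> 'k" where
  "bracket v P Q = coord_x v P * coord_y v Q - coord_x v Q * coord_y v P"

lemma bracket_eq_0_iff: "bracket v P Q = 0 \<longleftrightarrow> P = Q"
proof -
  obtain s z where s: "s \<noteq> 0"
    "P = Some z \<and> coord_x v P = s * z \<and> coord_y v P = s \<or> P = None \<and> coord_x v P = s \<and> coord_y v P = 0"
    by (rule coord_scaled)
  obtain t w where t: "t \<noteq> 0"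
    "Q = Some w \<and> coord_x v Q = t * w \<and> coord_y v Q = t \<or> Q = None \<and> coord_x v Q = t \<and> coord_y v Q = 0"
    by (rule coord_scaled)
  show ?thesis
    using s(2) t(2) s(1) t(1) unfolding bracket_def by (elim disjE conjE) simp_all
qed

lemma bracket_swap: "bracket v Q P = - bracket v P Q"
  by (simp add: bracket_def)

text \<open>Pluecker relation. Divided by the middle product, it expresses one minus a cross ratio
  as another cross ratio.\<close>

lemma bracket_pluecker:
  "bracket v a b * bracket v c e - bracket v a c * bracket v b e + bracket v a e * bracket v b c = 0"
  unfolding bracket_def by (simp add: algebra_simps)

text \<open>The normalised coordinates at two places differ by scalars, which cancel in a cross ratio.\<close>
lemma cross_ratio_indep:
  fixes v w :: "'k::field \<Rightarrow> int"
  shows "bracket v a b * bracket v c e / (bracket v a c * bracket v b e)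
    = bracket w a b * bracket w c e / (bracket w a c * bracket w b e)"
proof -
  have *: "\<exists>u. u \<noteq> 0 \<and> coord_x v P = u * coord_x w P \<and> coord_y v P = u * coord_y w P" for P
  proof -
    obtain s z where s: "s \<noteq> 0"
      "P = Some z \<and> coord_x v P = s * z \<and> coord_y v P = s \<or> P = None \<and> coord_x v P = s \<and> coord_y v P = 0"
      by (rule coord_scaled)
    obtain t z' where t: "t \<noteq> 0"
      "P = Some z' \<and> coord_x w P = t * z' \<and> coord_y w P = t \<or> P = None \<and> coord_x w P = t \<and> coord_y w P = 0"
      by (rule coord_scaled)
    show ?thesis
      using s t by (intro exI[of _ "s / t"]) auto
  qed
  define u where "u P = (SOME u. u \<noteq> 0 \<and> coord_x v P = u * coord_x w P \<and> coord_y v P = u * coord_y w P)" for P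
  have u: "u P \<noteq> 0" "coord_x v P = u P * coord_x w P" "coord_y v P = u P * coord_y w P" for P
    using someI_ex[OF *[of P]] unfolding u_def by blast+
  have br: "bracket v P Q = u P * u Q * bracket w P Q" for P Q
    unfolding bracket_def u(2,3) by (simp add: algebra_simps)
  show ?thesis
    unfolding br using u(1)[of a] u(1)[of b] u(1)[of c] u(1)[of e] by (simp add: field_simps)
qed

text \<open>The infinite value on the diagonal lets the ultrametric inequality and monotonicity
  under the map hold for all points; \<open>nat\<close> loses nothing because brackets are
  integral.\<close>

definition ldist :: "('k::field \<Rightarrow> int) \<Rightarrow> 'k option \<Rightarrow> 'k option \<Rightarrow> enat" where
  "ldist v P Q = (if P = Q then \<infinity> else enat (nat (v (bracket v P Q))))"

text \<open>Turns an inequality of distances into divisibility by each finite power of the prime,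
  which treats infinite distances uniformly.\<close>

lemma enat_le_by_nats: "(\<And>k. enat k \<le> a \<Longrightarrow> enat k \<le> b) \<Longrightarrow> a \<le> b"
proof (rule ccontr)
  assume *: "\<And>k. enat k \<le> a \<Longrightarrow> enat k \<le> b" and "\<not> a \<le> b"
  then obtain n where "b = enat n" "enat (Suc n) \<le> a"
    by (cases b) (auto simp: Suc_ile_eq)
  with *[of "Suc n"] show False by simp
qed

lemma ldist_infinity_iff [simp]: "ldist v P Q = \<infinity> \<longleftrightarrow> P = Q"
  by (simp add: ldist_def)

section \<open>The ultrametric distance, and division of forms over the valuation ring\<close>

context discrete_valuation
begin

lemma coord_integral: "vge v 0 (coord_x v P)" "vge v 0 (coord_y v P)"
  by (auto simp: coord_x_def coord_y_def val_ring_iff vge_def split: option.splits)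

lemma coord_one: "coord_x v P = 1 \<or> coord_y v P = 1"
  by (auto simp: coord_x_def coord_y_def split: option.splits)

lemma bracket_integral: "vge v 0 (bracket v P Q)"
  unfolding bracket_def by (intro vge_diff vge_mult_left coord_integral)

lemma ldist_ge_iff: "enat k \<le> ldist v P Q \<longleftrightarrow> vge v (int k) (bracket v P Q)"
  using bracket_integral[of P Q] bracket_eq_0_iff[of v P Q]
  by (auto simp: ldist_def vge_def)

lemma ldist_commute: "ldist v P Q = ldist v Q P"
  by (simp add: ldist_def bracket_swap[of v Q P])

lemma ldist_ultra: "min (ldist v P Q) (ldist v Q R) \<le> ldist v P R"
proof (rule enat_le_by_nats)
  fix k assume "enat k \<le> min (ldist v P Q) (ldist v Q R)"
  then have k: "vge v (int k) (bracket v P Q)" "vge v (int k) (bracket v Q R)"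
    by (auto simp: ldist_ge_iff)
  \<comment> \<open>Two identities are needed because either coordinate of \<open>Q\<close> may be
    the one that equals \<open>1\<close>.\<close>
  have "bracket v P R * coord_x v Q = bracket v Q R * coord_x v P + bracket v P Q * coord_x v R"
    "bracket v P R * coord_y v Q = bracket v Q R * coord_y v P + bracket v P Q * coord_y v R"
    unfolding bracket_def by (simp_all add: algebra_simps)
  then have "vge v (int k) (bracket v P R * coord_x v Q)" "vge v (int k) (bracket v P R * coord_y v Q)"
    using k by (auto intro!: vge_add vge_mult_right coord_integral)
  then show "enat k \<le> ldist v P R"
    using coord_one[of Q] by (auto simp: ldist_ge_iff)
qed

lemma ldist_unequal:
  assumes "P \<noteq> Q"
  shows "bracket v P Q \<noteq> 0" "ldist v P Q = enat (nat (v (bracket v P Q)))" "0 \<le> v (bracket v P Q)"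
  using assms bracket_integral[of P Q] bracket_eq_0_iff[of v P Q] by (auto simp: ldist_def vge_def)

lemma hform_integral:
  "(\<And>i. i \<le> d \<Longrightarrow> vge v 0 (h i)) \<Longrightarrow> vge v 0 x \<Longrightarrow> vge v 0 y \<Longrightarrow> vge v 0 (hform h d x y)"
  unfolding hform_def by (intro vge_sum vge_mult_left vge_power) auto

text \<open>Dividing by the monic form \<open>X - a Y\<close> introduces no denominators; the
  remainder is the value at \<open>(a, 1)\<close> times a power of \<open>Y\<close>.\<close>

lemma hform_linear_division:
  assumes "vge v 0 a" "\<And>i. i \<le> Suc d \<Longrightarrow> vge v 0 (h i)"
  shows "\<exists>h'. (\<forall>i. vge v 0 (h' i)) \<and>
    (\<forall>x y. hform h (Suc d) x y = (x - a * y) * hform h' d x y + hform h (Suc d) a 1 * y ^ Suc d)"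
  using assms(2)
proof (induction d)
  case 0
  show ?case
    by (rule exI[of _ "\<lambda>_. h 1"]) (use 0 in \<open>auto simp: hform_def algebra_simps\<close>)
next
  case (Suc d)
  have "\<exists>h'. (\<forall>i. vge v 0 (h' i)) \<and>
    (\<forall>x y. hform h (Suc d) x y = (x - a * y) * hform h' d x y + hform h (Suc d) a 1 * y ^ Suc d)"
    by (rule Suc.IH) (use Suc.prems in simp)
  then obtain h' where h': "\<And>i. vge v 0 (h' i)"
    "\<And>x y. hform h (Suc d) x y = (x - a * y) * hform h' d x y + hform h (Suc d) a 1 * y ^ Suc d"
    by blast
  \<comment> \<open>The new quotient is \<open>Y\<close> times the old one plus the geometric sum
    coming from the top power of \<open>X\<close>.\<close>
  define e where "e i = (if i \<le> d then h' i else 0) + h (Suc (Suc d)) * a ^ (Suc d - i)" for i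
  have e: "hform e (Suc d) x y = y * hform h' d x y + h (Suc (Suc d)) * (\<Sum>k\<le>Suc d. x ^ k * (a * y) ^ (Suc d - k))" for x y
  proof -
    have "hform e (Suc d) x y = hform (\<lambda>i. if i \<le> d then h' i else 0) (Suc d) x y
        + h (Suc (Suc d)) * (\<Sum>k\<le>Suc d. x ^ k * (a * y) ^ (Suc d - k))"
      unfolding e_def hform_def sum_distrib_left
      by (simp add: sum.distrib algebra_simps power_mult_distrib del: sum.atMost_Suc)
    also have "hform (\<lambda>i. if i \<le> d then h' i else 0) (Suc d) x y = y * hform h' d x y"
      unfolding hform_Suc by (auto simp: hform_def intro!: sum.cong)
    finally show ?thesis .
  qed
  have geo: "x ^ Suc (Suc d) - z ^ Suc (Suc d) = (x - z) * (\<Sum>k\<le>Suc d. x ^ k * z ^ (Suc d - k))" for x z :: 'k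
    using diff_power_eq_sum[of x "Suc d" z] unfolding lessThan_Suc_atMost by simp
  have "hform h (Suc (Suc d)) x y = (x - a * y) * hform e (Suc d) x y + hform h (Suc (Suc d)) a 1 * y ^ Suc (Suc d)" for x y
  proof -
    define S where "S = (\<Sum>k\<le>Suc d. x ^ k * (a * y) ^ (Suc d - k))"
    have x: "x ^ Suc (Suc d) = (x - a * y) * S + a ^ Suc (Suc d) * y ^ Suc (Suc d)"
      using geo[of x "a * y"] unfolding S_def power_mult_distrib by (metis diff_add_cancel)
    have "hform h (Suc (Suc d)) x y
        = y * ((x - a * y) * hform h' d x y + hform h (Suc d) a 1 * y ^ Suc d)
          + h (Suc (Suc d)) * ((x - a * y) * S + a ^ Suc (Suc d) * y ^ Suc (Suc d))"
      unfolding hform_Suc[of h "Suc d" x y] x by (simp only: h'(2)[of x y])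
    also have "\<dots> = (x - a * y) * (y * hform h' d x y + h (Suc (Suc d)) * S)
        + (1 * hform h (Suc d) a 1 + h (Suc (Suc d)) * a ^ Suc (Suc d)) * (y * y ^ Suc d)"
      unfolding power_Suc[of y "Suc d"] by (simp only: distrib_left distrib_right mult_ac mult_1_left add_ac)
    finally show ?thesis
      unfolding e hform_Suc[of h "Suc d" a 1] S_def power_Suc[of y "Suc d"] .
  qed
  moreover have "vge v 0 (e i)" for i
    unfolding e_def using h'(1) Suc.prems assms(1) by (auto intro!: vge_add vge_mult_left vge_power)
  ultimately show ?case by blast
qed

text \<open>One normalised coordinate of \<open>P\<close> is \<open>1\<close>, so up to exchanging
  the variables the linear form vanishing at \<open>P\<close> is monic, and the division leaves no
  remainder.\<close>

lemma hform_factor: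
  assumes h: "\<And>i. i \<le> d \<Longrightarrow> vge v 0 (h i)"
    and zero: "hform h d (coord_x v P) (coord_y v P) = 0"
  obtains h' d' where "\<And>i. vge v 0 (h' i)"
    "\<And>x y. hform h d x y = (x * coord_y v P - coord_x v P * y) * hform h' d' x y"
proof (cases d)
  case 0
  then have "hform h d x y = 0" for x y
    using zero by (simp add: hform_def)
  then show ?thesis using that[of "\<lambda>_. 0" 0] by (simp add: hform_def)
next
  case (Suc e)
  from coord_one[of P] show ?thesis
  proof
    assume y: "coord_y v P = 1"
    have "\<exists>h'. (\<forall>i. vge v 0 (h' i)) \<and>
      (\<forall>x y. hform h d x y = (x - coord_x v P * y) * hform h' e x y + hform h d (coord_x v P) 1 * y ^ d)"
      unfolding Suc by (rule hform_linear_division) (use h Suc coord_integral in auto)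
    then obtain h' where h': "\<forall>i. vge v 0 (h' i)"
      "\<forall>x y. hform h d x y = (x - coord_x v P * y) * hform h' e x y + hform h d (coord_x v P) 1 * y ^ d"
      by blast
    show ?thesis
    proof (rule that[of h' e])
      show "hform h d x z = (x * coord_y v P - coord_x v P * z) * hform h' e x z" for x z
        using h'(2)[rule_format, of x z] zero unfolding y by (simp only: mult_1_right mult_zero_left add_0_right)
    qed (use h'(1) in blast)
  next
    assume x: "coord_x v P = 1"
    define k where "k i = h (d - i)" for i
    have k: "hform k d y x = hform h d x y" for x y
      unfolding k_def[abs_def] hform_swap ..
    have "vge v 0 (k i)" for i
      unfolding k_def using h by simp
    then have "\<exists>h'. (\<forall>i. vge v 0 (h' i)) \<and>
      (\<forall>y x. hform k d y x = (y - coord_y v P * x) * hform h' e y x + hform k d (coord_y v P) 1 * x ^ d)"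
      unfolding Suc by (intro hform_linear_division coord_integral)
    then obtain h' where h': "\<forall>i. vge v 0 (h' i)"
      "\<forall>y x. hform k d y x = (y - coord_y v P * x) * hform h' e y x + hform k d (coord_y v P) 1 * x ^ d"
      by blast
    \<comment> \<open>Undoes the exchange of variables; the sign appears because the linear form
      changes sign under it.\<close>
    define h'' where "h'' i = - h' (e - i)" for i
    have h'': "hform h'' e x y = - hform h' e y x" for x y
      using hform_swap[of h' e x y] unfolding h''_def hform_def by (simp add: sum_negf)
    have "hform h d x y = (x * coord_y v P - coord_x v P * y) * hform h'' e x y" for x y
      using h'(2)[rule_format, of y x] zero unfolding h'' k x
      by (simp only: mult_1_right mult_zero_left add_0_right mult_minus_right mult_1_left)
        (simp add: algebra_simps)
    then show ?thesis
      using h'(1) by (intro that[of h'' e]) (auto simp: h''_def)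
  qed
qed

text \<open>Primitive integral coordinates differ from the normalised ones by a unit:
  \<open>y\<close> if \<open>x / y\<close> is integral, and otherwise \<open>x\<close>, which then
  has the smaller value.\<close>

lemma mkpt_unit:
  assumes "vge v 0 x" "vge v 0 y" "\<not> (vge v 1 x \<and> vge v 1 y)"
  obtains u where "u \<noteq> 0" "v u = 0" "x = u * coord_x v (mkpt x y)" "y = u * coord_y v (mkpt x y)"
proof (cases "y = 0")
  case True
  then show ?thesis
    using assms that[of x] unitI[of x] by (auto simp: mkpt_def coord_x_def coord_y_def)
next
  case y: False
  show ?thesis
  proof (cases "x / y \<in> val_ring v")
    case True
    have "v y = 0"
    proof (rule ccontr)
      assume "v y \<noteq> 0"
      then have 1: "vge v 1 y" using assms(2) y by (auto simp: vge_def)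
      then have "vge v 1 (x / y * y)"
        using True by (intro vge_mult_left) (auto simp: val_ring_iff)
      with 1 assms(3) y show False by simp
    qed
    then show ?thesis
      using y True by (intro that[of y]) (auto simp: mkpt_def coord_x_def coord_y_def)
  next
    case False
    then have x: "x \<noteq> 0" "v x < v y"
      using y by (auto simp: val_ring_def v_divide)
    moreover have "v x = 0"
      using x y assms by (auto simp: vge_def)
    ultimately show ?thesis
      using y False by (intro that[of x]) (auto simp: mkpt_def coord_x_def coord_y_def)
  qed
qed

end

text \<open>The rows of the Sylvester matrix are the multiples of the two forms by monomials of
  degree \<open>d - 1\<close>; pairing them with the monomials of degree \<open>2 * d - 1\<close>
  evaluates these multiples.\<close>

lemma hom_sylvester_mult_vec:
  assumes i: "i < 2 * d"
  shows "(hom_sylvester f g d *\<^sub>v vec (2 * d) (\<lambda>j. x ^ (2 * d - 1 - j) * y ^ j)) $ i =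
    (if i < d then x ^ (d - 1 - i) * y ^ i * hform (coeff f) d x y
     else x ^ (2 * d - 1 - i) * y ^ (i - d) * hform (coeff g) d x y)"
proof -
  have key: "(\<Sum>j<2 * d. (if l \<le> j \<and> j - l \<le> d then h (d - (j - l)) else 0) * (x ^ (2 * d - 1 - j) * y ^ j))
      = x ^ (d - 1 - l) * y ^ l * hform h d x y" if l: "l < d" for l and h :: "nat \<Rightarrow> 'a"
  proof -
    have "(\<Sum>j<2 * d. (if l \<le> j \<and> j - l \<le> d then h (d - (j - l)) else 0) * (x ^ (2 * d - 1 - j) * y ^ j))
      = (\<Sum>j\<in>{l..l + d}. h (d - (j - l)) * (x ^ (2 * d - 1 - j) * y ^ j))"
      by (rule sum.mono_neutral_cong_right) (use l in \<open>auto simp: mult_2\<close>)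
    also have "\<dots> = (\<Sum>k\<le>d. h k * (x ^ (d - 1 - l + k) * y ^ (l + (d - k))))"
      by (rule sum.reindex_bij_witness[of _ "\<lambda>k. l + (d - k)" "\<lambda>j. d - (j - l)"])
        (use l in \<open>auto intro!: arg_cong2[of _ _ _ _ "\<lambda>m n. x ^ m * y ^ n"] simp: mult_2\<close>)
    also have "\<dots> = x ^ (d - 1 - l) * y ^ l * hform h d x y"
      unfolding hform_def sum_distrib_left by (intro sum.cong refl) (simp only: power_add mult_ac)
    finally show ?thesis .
  qed
  show ?thesis
  proof (cases "i < d")
    case True
    then show ?thesis
      using key[of i "coeff f"] i
      by (simp add: hom_sylvester_def scalar_prod_def lessThan_atLeast0)
  next
    case False
    then have "d - 1 - (i - d) = 2 * d - 1 - i" "i - d < d" using i by auto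
    then show ?thesis
      using False key[of "i - d" "coeff g"] i
      by (simp add: hom_sylvester_def scalar_prod_def lessThan_atLeast0)
  qed
qed

section \<open>Good reduction: primitive values, contraction of distances, equidistant
  points\<close>

context discrete_valuation
begin

text \<open>If both values were in the maximal ideal, the adjugate of the Sylvester matrix would put
  the resultant times every monomial of degree \<open>2 * d - 1\<close> there. The resultant is a
  unit and one of the pure powers is \<open>1\<close>.\<close>

lemma good_reduction_primitive:
  assumes fg: "\<And>i. i \<le> d \<Longrightarrow> vge v 0 (coeff f i)" "\<And>i. i \<le> d \<Longrightarrow> vge v 0 (coeff g i)"
    and nz: "\<exists>i\<le>d. \<not> vge v 1 (coeff f i) \<or> \<not> vge v 1 (coeff g i)"
    and res: "hom_res f g d \<noteq> 0" "v (hom_res f g d) = 0"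
    and xy: "vge v 0 x" "vge v 0 y" "x = 1 \<or> y = 1"
  shows "\<not> (vge v 1 (hform (coeff f) d x y) \<and> vge v 1 (hform (coeff g) d x y))"
proof (cases "d = 0")
  \<comment> \<open>In degree \<open>0\<close> the Sylvester matrix is empty and says nothing; here
    primitivity of the coefficients is the claim.\<close>
  case True
  then show ?thesis using nz by (simp add: hform_def)
next
  case d: False
  show ?thesis
  proof
    assume small: "vge v 1 (hform (coeff f) d x y) \<and> vge v 1 (hform (coeff g) d x y)"
    define S where "S = hom_sylvester f g d"
    define m where "m = vec (2 * d) (\<lambda>j. x ^ (2 * d - 1 - j) * y ^ j)"
    have S: "S \<in> carrier_mat (2 * d) (2 * d)" and m: "m \<in> carrier_vec (2 * d)"
      by (simp_all add: S_def hom_sylvester_def m_def)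
    have S_int: "vge v 0 (S $$ (i, j))" if "i < 2 * d" "j < 2 * d" for i j
      using that fg by (auto simp: S_def hom_sylvester_def)
    have Sm: "vge v 1 ((S *\<^sub>v m) $ i)" if "i < 2 * d" for i
      unfolding S_def m_def hom_sylvester_mult_vec[OF that]
      using small xy by (auto intro!: vge_mult_left vge_power)
    have "vge v 1 (det S * m $ j)" if j: "j < 2 * d" for j
    proof -
      \<comment> \<open>Cramer's rule, in the form that the adjugate times \<open>S\<close> is the
        determinant times the identity.\<close>
      have "(adj_mat S * S) *\<^sub>v m = det S \<cdot>\<^sub>v m"
      proof (rule eq_vecI)
        fix i assume i: "i < dim_vec (det S \<cdot>\<^sub>v m)"
        have "row (det S \<cdot>\<^sub>m 1\<^sub>m (2 * d)) i = det S \<cdot>\<^sub>v unit_vec (2 * d) i"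
          using i m by (intro eq_vecI) auto
        then show "(adj_mat S * S *\<^sub>v m) $ i = (det S \<cdot>\<^sub>v m) $ i"
          unfolding adj_mat(3)[OF S] using i m by simp
      qed (use adj_mat(3)[OF S] m in simp)
      then have "det S * m $ j = (adj_mat S *\<^sub>v (S *\<^sub>v m)) $ j"
        using j m assoc_mult_mat_vec[OF adj_mat(1)[OF S] S m] by simp
      also have "\<dots> = (\<Sum>i<2 * d. adj_mat S $$ (j, i) * (S *\<^sub>v m) $ i)"
        using j adj_mat(1)[OF S] S by (simp add: scalar_prod_def lessThan_atLeast0 row_def)
      also have "vge v 1 \<dots>"
        using j S S_int Sm by (intro vge_sum vge_mult_left vge_adj_mat[of S "2 * d"]) auto
      finally show ?thesis .
    qed
    then have m1: "vge v 1 (m $ j)" if "j < 2 * d" for j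
      using that res vge_mult_unit[of "det S" 1] by (simp add: S_def hom_res_def)
    have "vge v 1 (x ^ (2 * d - 1))" "vge v 1 (y ^ (2 * d - 1))"
      using m1[of 0] m1[of "2 * d - 1"] d by (simp_all add: m_def)
    then show False using xy(3) by auto
  qed
qed

text \<open>\<open>u P\<close> compares the values of the forms at \<open>P\<close> with the
  normalised coordinates of the image; it is a unit because these values are primitive.\<close>

lemma good_reduction_forms:
  assumes "good_reduction v f g d" "hom_coprime f g d"
  obtains a b u where
    "\<And>i. i \<le> d \<Longrightarrow> vge v 0 (a i)" "\<And>i. i \<le> d \<Longrightarrow> vge v 0 (b i)"
    "\<And>P. u P \<noteq> 0 \<and> v (u P) = 0"
    "\<And>P. hform a d (coord_x v P) (coord_y v P) = u P * coord_x v (rat_map f g d P)"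
    "\<And>P. hform b d (coord_x v P) (coord_y v P) = u P * coord_y v (rat_map f g d P)"
proof -
  from assms(1) obtain c where c: "c \<noteq> 0"
    "\<And>i. i \<le> d \<Longrightarrow> vge v 0 (c * coeff f i)" "\<And>i. i \<le> d \<Longrightarrow> vge v 0 (c * coeff g i)"
    "\<exists>i\<le>d. \<not> vge v 1 (c * coeff f i) \<or> \<not> vge v 1 (c * coeff g i)"
    "is_unit_at v (hom_res (smult c f) (smult c g) d)"
    unfolding good_reduction_def val_ring_iff max_ideal_iff by blast
  define a where "a i = c * coeff f i" for i
  define b where "b i = c * coeff g i" for i
  have ab: "coeff (smult c f) = a" "coeff (smult c g) = b"
    by (auto simp: a_def b_def)
  have "\<exists>u. u \<noteq> 0 \<and> v u = 0 \<and> hform a d (coord_x v P) (coord_y v P) = u * coord_x v (rat_map f g d P)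
    \<and> hform b d (coord_x v P) (coord_y v P) = u * coord_y v (rat_map f g d P)" for P
  proof -
    obtain s z where s: "s \<noteq> 0"
      "P = Some z \<and> coord_x v P = s * z \<and> coord_y v P = s \<or> P = None \<and> coord_x v P = s \<and> coord_y v P = 0"
      by (rule coord_scaled)
    have map: "rat_map f g d P = mkpt (hform a d (coord_x v P) (coord_y v P)) (hform b d (coord_x v P) (coord_y v P))"
      using rat_map_eq_mkpt[OF _ _ c(1) s] assms(2) unfolding hom_coprime_def a_def b_def by blast
    have "\<not> (vge v 1 (hform a d (coord_x v P) (coord_y v P)) \<and> vge v 1 (hform b d (coord_x v P) (coord_y v P)))"
      using good_reduction_primitive[of d "smult c f" "smult c g" "coord_x v P" "coord_y v P"]
        c coord_integral[of P] coord_one[of P]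
      unfolding ab by (auto simp: a_def b_def is_unit_at_def)
    moreover have "vge v 0 (hform a d (coord_x v P) (coord_y v P))" "vge v 0 (hform b d (coord_x v P) (coord_y v P))"
      using c by (auto intro!: hform_integral coord_integral simp: a_def b_def)
    ultimately show ?thesis
      unfolding map by (metis mkpt_unit)
  qed
  then obtain u where u: "\<And>P. u P \<noteq> 0 \<and> v (u P) = 0 \<and> hform a d (coord_x v P) (coord_y v P) = u P * coord_x v (rat_map f g d P)
    \<and> hform b d (coord_x v P) (coord_y v P) = u P * coord_y v (rat_map f g d P)"
    by metis
  show ?thesis
    by (rule that[of a b u]) (use c u in \<open>auto simp: a_def b_def\<close>)
qed

text \<open>The form \<open>F(X,Y) G(Q) - F(Q) G(X,Y)\<close> vanishes at every preimage of \<open>\<phi>(Q)\<close>, so it is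
  divisible over the valuation ring by the corresponding linear forms.\<close>
lemma good_reduction_bracket:
  assumes "good_reduction v f g d" "hom_coprime f g d"
  obtains h where "\<And>i. i \<le> d \<Longrightarrow> vge v 0 (h i)"
    "\<And>T. \<exists>w. w \<noteq> 0 \<and> v w = 0 \<and>
      hform h d (coord_x v T) (coord_y v T) = w * bracket v (rat_map f g d T) (rat_map f g d Q)"
proof -
  obtain a b u where ab: "\<And>i. i \<le> d \<Longrightarrow> vge v 0 (a i)" "\<And>i. i \<le> d \<Longrightarrow> vge v 0 (b i)"
    and u: "\<And>P. u P \<noteq> 0 \<and> v (u P) = 0"
    "\<And>P. hform a d (coord_x v P) (coord_y v P) = u P * coord_x v (rat_map f g d P)"
    "\<And>P. hform b d (coord_x v P) (coord_y v P) = u P * coord_y v (rat_map f g d P)"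
    using good_reduction_forms[OF assms] by metis
  define A where "A = hform a d (coord_x v Q) (coord_y v Q)"
  define B where "B = hform b d (coord_x v Q) (coord_y v Q)"
  have AB: "vge v 0 A" "vge v 0 B"
    using ab by (auto simp: A_def B_def intro!: hform_integral coord_integral)
  show ?thesis
  proof (rule that[of "\<lambda>i. a i * B - b i * A"])
    show "vge v 0 (a i * B - b i * A)" if "i \<le> d" for i
      using ab that AB by (intro vge_diff vge_mult_left) auto
    fix T
    have "hform (\<lambda>i. a i * B - b i * A) d (coord_x v T) (coord_y v T)
        = (u T * u Q) * bracket v (rat_map f g d T) (rat_map f g d Q)"
      unfolding hform_diff A_def B_def u(2,3) bracket_def by (simp add: algebra_simps)
    moreover have "u T * u Q \<noteq> 0 \<and> v (u T * u Q) = 0"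
      using u(1)[of T] u(1)[of Q] by (simp add: v_mult)
    ultimately show "\<exists>w. w \<noteq> 0 \<and> v w = 0 \<and>
      hform (\<lambda>i. a i * B - b i * A) d (coord_x v T) (coord_y v T)
        = w * bracket v (rat_map f g d T) (rat_map f g d Q)" by blast
  qed
qed

text \<open>The form from \<open>good_reduction_bracket\<close> vanishes at \<open>Q\<close>, so its
  value at \<open>P\<close> is an integral multiple of \<open>bracket v P Q\<close>.\<close>

lemma ldist_rat_map_mono:
  assumes gr: "good_reduction v f g d" "hom_coprime f g d"
  shows "ldist v P Q \<le> ldist v (rat_map f g d P) (rat_map f g d Q)"
proof (rule enat_le_by_nats)
  fix k assume "enat k \<le> ldist v P Q"
  then have k: "vge v (int k) (bracket v P Q)" by (simp add: ldist_ge_iff)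
  obtain h where h: "\<And>i. i \<le> d \<Longrightarrow> vge v 0 (h i)"
    "\<And>T. \<exists>w. w \<noteq> 0 \<and> v w = 0 \<and>
      hform h d (coord_x v T) (coord_y v T) = w * bracket v (rat_map f g d T) (rat_map f g d Q)"
    using good_reduction_bracket[OF gr, of Q] by blast
  have "hform h d (coord_x v Q) (coord_y v Q) = 0"
    using h(2)[of Q] by (auto simp: bracket_eq_0_iff)
  then obtain h' d' where h': "\<And>i. vge v 0 (h' i)"
    "\<And>x y. hform h d x y = (x * coord_y v Q - coord_x v Q * y) * hform h' d' x y"
    using hform_factor[of d h Q] h(1) by metis
  have "vge v (int k) (hform h d (coord_x v P) (coord_y v P))"
    unfolding h'(2) using k h'(1)
    by (intro vge_mult_right hform_integral coord_integral) (auto simp: bracket_def)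
  then show "enat k \<le> ldist v (rat_map f g d P) (rat_map f g d Q)"
    using h(2)[of P] vge_mult_unit by (auto simp: ldist_ge_iff)
qed

lemma ldist_rat_map_double:
  assumes gr: "good_reduction v f g d" "hom_coprime f g d"
    and Q: "Q \<noteq> Q'" "rat_map f g d Q = rat_map f g d Q'"
  shows "ldist v T Q + ldist v T Q' \<le> ldist v (rat_map f g d T) (rat_map f g d Q)"
proof (cases "T = Q \<or> T = Q'")
  case True
  then show ?thesis using Q(2) by (auto simp: ldist_def)
next
  case False
  obtain h where h: "\<And>i. i \<le> d \<Longrightarrow> vge v 0 (h i)"
    "\<And>T. \<exists>w. w \<noteq> 0 \<and> v w = 0 \<and>
      hform h d (coord_x v T) (coord_y v T) = w * bracket v (rat_map f g d T) (rat_map f g d Q)"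
    using good_reduction_bracket[OF gr, of Q] by blast
  have zero: "hform h d (coord_x v Q) (coord_y v Q) = 0" "hform h d (coord_x v Q') (coord_y v Q') = 0"
    using h(2)[of Q] h(2)[of Q'] Q(2) by (auto simp: bracket_eq_0_iff)
  obtain h' d' where h': "\<And>i. vge v 0 (h' i)"
    "\<And>x y. hform h d x y = (x * coord_y v Q - coord_x v Q * y) * hform h' d' x y"
    using hform_factor[of d h Q] h(1) zero(1) by metis
  \<comment> \<open>The first linear factor is nonzero at \<open>Q'\<close>, so the cofactor
    vanishes there and a second linear factor splits off.\<close>
  have "bracket v Q' Q \<noteq> 0"
    using Q(1) by (simp add: bracket_eq_0_iff)
  then have "hform h' d' (coord_x v Q') (coord_y v Q') = 0"
    using zero(2) unfolding h'(2) by (simp add: bracket_def)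
  then obtain h'' d'' where h'': "\<And>i. vge v 0 (h'' i)"
    "\<And>x y. hform h' d' x y = (x * coord_y v Q' - coord_x v Q' * y) * hform h'' d'' x y"
    using hform_factor[of d' h' Q'] h'(1) by metis
  have fin: "ldist v T Q = enat (nat (v (bracket v T Q)))" "ldist v T Q' = enat (nat (v (bracket v T Q')))"
    "0 \<le> v (bracket v T Q)" "0 \<le> v (bracket v T Q')"
    using False ldist_unequal by auto
  have "hform h d (coord_x v T) (coord_y v T)
      = bracket v T Q * bracket v T Q' * hform h'' d'' (coord_x v T) (coord_y v T)"
    unfolding h'(2) h''(2) bracket_def by simp
  moreover have "vge v (v (bracket v T Q) + v (bracket v T Q') + 0)
      (bracket v T Q * bracket v T Q' * hform h'' d'' (coord_x v T) (coord_y v T))"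
    by (intro vge_mult hform_integral coord_integral h''(1)) (simp_all add: vge_def)
  ultimately have "vge v (v (bracket v T Q) + v (bracket v T Q')) (hform h d (coord_x v T) (coord_y v T))"
    by simp
  then have "enat (nat (v (bracket v T Q)) + nat (v (bracket v T Q'))) \<le> ldist v (rat_map f g d T) (rat_map f g d Q)"
    using h(2)[of T] vge_mult_unit fin(3,4) unfolding ldist_ge_iff by auto
  then show ?thesis unfolding fin by simp
qed

text \<open>A coordinate sending one point of \<open>X\<close> to infinity embeds the others into
  the residue field; the extra \<open>1\<close> is the point at infinity. Finiteness matters because
  \<open>card\<close> of an infinite quotient is \<open>0\<close>.\<close>

lemma card_equidistant_le:
  assumes fin: "finite (val_ring v // {(x, y). x \<in> val_ring v \<and> y \<in> val_ring v \<and> x - y \<in> max_ideal v})"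
    and X: "finite X" "\<And>P Q. P \<in> X \<Longrightarrow> Q \<in> X \<Longrightarrow> P \<noteq> Q \<Longrightarrow> ldist v P Q = e"
  shows "card X \<le> residue_card v + 1"
proof (cases "\<exists>P0 P1. P0 \<in> X \<and> P1 \<in> X \<and> P0 \<noteq> P1")
  case False
  then have "card X \<le> 1" by (metis One_nat_def card_le_Suc0_iff_eq X(1))
  then show ?thesis by simp
next
  case True
  then obtain P0 P1 where P: "P0 \<in> X" "P1 \<in> X" "P0 \<noteq> P1" by blast
  define r where "r = {(x, y). x \<in> val_ring v \<and> y \<in> val_ring v \<and> x - y \<in> max_ideal v}"
  \<comment> \<open>Projective coordinate with zero \<open>P0\<close> and pole
    \<open>P1\<close>.\<close>
  define \<chi> where "\<chi> Q = bracket v Q P0 / bracket v Q P1" for Q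
  have eq: "v (bracket v Q R) = v (bracket v P0 P1)" "bracket v Q R \<noteq> 0"
    if "Q \<in> X" "R \<in> X" "Q \<noteq> R" for Q R
    using X(2)[OF that] X(2)[OF P] ldist_unequal[OF that(3)] ldist_unequal[OF P(3)] by auto
  have chi: "\<chi> Q \<in> val_ring v" if "Q \<in> X - {P1}" for Q
    using that eq[of Q P0] eq[of Q P1] P
    by (cases "Q = P0") (auto simp: \<chi>_def val_ring_iff vge_def v_divide bracket_eq_0_iff)
  have "inj_on (\<lambda>Q. r `` {\<chi> Q}) (X - {P1})"
  proof (rule inj_onI, rule ccontr)
    fix Q R assume QR: "Q \<in> X - {P1}" "R \<in> X - {P1}" "r `` {\<chi> Q} = r `` {\<chi> R}" "Q \<noteq> R"
    have "\<chi> R \<in> r `` {\<chi> R}"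
      using chi[OF QR(2)] by (simp add: r_def max_ideal_iff)
    then have "vge v 1 (\<chi> Q - \<chi> R)"
      using QR(3) by (auto simp: r_def max_ideal_iff)
    \<comment> \<open>All four brackets on the right have the same value, so the difference is a
      unit and the residues differ.\<close>
    moreover have "\<chi> Q - \<chi> R = bracket v Q R * bracket v P0 P1 / (bracket v Q P1 * bracket v R P1)"
    proof -
      have "bracket v Q P0 * bracket v R P1 - bracket v R P0 * bracket v Q P1 = bracket v Q R * bracket v P0 P1"
        unfolding bracket_def by (simp add: algebra_simps)
      then show ?thesis
        unfolding \<chi>_def using eq(2)[of Q P1] eq(2)[of R P1] QR P(2) by (simp add: diff_frac_eq)
    qed
    moreover have "v (bracket v Q R * bracket v P0 P1 / (bracket v Q P1 * bracket v R P1)) = 0"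
      "bracket v Q R * bracket v P0 P1 / (bracket v Q P1 * bracket v R P1) \<noteq> 0"
      using eq[of Q R] eq[of P0 P1] eq[of Q P1] eq[of R P1] QR P by (auto simp: v_divide v_mult)
    ultimately show False by (simp add: vge_def)
  qed
  moreover have "(\<lambda>Q. r `` {\<chi> Q}) ` (X - {P1}) \<subseteq> val_ring v // r"
    using chi by (auto intro!: quotientI)
  ultimately have "card (X - {P1}) \<le> residue_card v"
    unfolding residue_card_def using fin by (auto simp: r_def intro!: card_inj_on_le)
  then show ?thesis using P(2) X(1) by simp
qed

end

section \<open>Dynamics of a family of contracted distances\<close>

text \<open>Keeps only what the dynamics uses of the good places. In \<open>cross\<close>, the
  hypothesis says that a cross ratio is a unit at every place of \<open>V\<close>, the conclusion
  that its complement to \<open>1\<close> is a unit at \<open>v\<close>.\<close>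

locale contracting_family =
  fixes V :: "'v set" and \<delta> :: "'v \<Rightarrow> 'p \<Rightarrow> 'p \<Rightarrow> enat" and \<phi> :: "'p \<Rightarrow> 'p"
  assumes commute: "v \<in> V \<Longrightarrow> \<delta> v P Q = \<delta> v Q P"
    and infinity_iff: "v \<in> V \<Longrightarrow> \<delta> v P Q = \<infinity> \<longleftrightarrow> P = Q"
    and ultra: "v \<in> V \<Longrightarrow> min (\<delta> v P Q) (\<delta> v Q R) \<le> \<delta> v P R"
    and mono: "v \<in> V \<Longrightarrow> \<delta> v P Q \<le> \<delta> v (\<phi> P) (\<phi> Q)"
    and double: "v \<in> V \<Longrightarrow> Q \<noteq> Q' \<Longrightarrow> \<phi> Q = \<phi> Q' \<Longrightarrow> \<delta> v T Q + \<delta> v T Q' \<le> \<delta> v (\<phi> T) (\<phi> Q)"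
    and cross: "distinct [a, b, c, e] \<Longrightarrow>
      (\<And>v. v \<in> V \<Longrightarrow> \<delta> v a b + \<delta> v c e = \<delta> v a c + \<delta> v b e) \<Longrightarrow>
      v \<in> V \<Longrightarrow> \<delta> v a e + \<delta> v b c = \<delta> v a c + \<delta> v b e"
begin

lemma mono_funpow: "v \<in> V \<Longrightarrow> \<delta> v P Q \<le> \<delta> v ((\<phi> ^^ k) P) ((\<phi> ^^ k) Q)"
  by (induction k) (auto intro: order_trans[OF _ mono])

end

section \<open>Cycles: all distances at one place coincide\<close>

locale contracting_cycle = contracting_family V \<delta> \<phi>
  for V :: "'v set" and \<delta> :: "'v \<Rightarrow> 'p \<Rightarrow> 'p \<Rightarrow> enat" and \<phi> :: "'p \<Rightarrow> 'p" +
  fixes p :: "int \<Rightarrow> 'p" and n :: int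
  assumes n_ge_2: "2 \<le> n"
    and step: "\<phi> (p i) = p (i + 1)"
    and p_eq_iff: "p i = p j \<longleftrightarrow> n dvd i - j"
begin

text \<open>By \<open>dist_eq_D\<close> this function of the index difference carries all distances.
  Periodic indexing by integers gives meaning to negative differences.\<close>

definition D :: "'v \<Rightarrow> int \<Rightarrow> enat" where
  "D v k = \<delta> v (p 0) (p k)"

lemma shift_le: "v \<in> V \<Longrightarrow> \<delta> v (p i) (p j) \<le> \<delta> v (p (i + int k)) (p (j + int k))"
proof (induction k)
  case (Suc k)
  then show ?case
    using order_trans[OF _ mono, of "\<delta> v (p i) (p j)" v "p (i + int k)" "p (j + int k)"]
    by (simp add: step algebra_simps)
qed simp

text \<open>Distances never decrease along the cycle, yet return to their initial value after full
  turns, so they are constant.\<close>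

lemma shift_eq:
  assumes v: "v \<in> V"
  shows "\<delta> v (p i) (p j) = \<delta> v (p (i + int k)) (p (j + int k))"
proof (rule antisym[OF shift_le[OF v]])
  \<comment> \<open>Further \<open>n - 1\<close> shifts by \<open>k\<close> complete a shift by a
    multiple of the period.\<close>
  have "i' + int k + int (k * nat (n - 1)) = i' + n * int k" for i'
    using n_ge_2 by (simp add: algebra_simps)
  moreover have "p (i' + n * int k) = p i'" for i'
    by (simp add: p_eq_iff)
  ultimately have "p (i' + int k + int (k * nat (n - 1))) = p i'" for i'
    by metis
  then show "\<delta> v (p (i + int k)) (p (j + int k)) \<le> \<delta> v (p i) (p j)"
    using shift_le[OF v, of "i + int k" "j + int k" "k * nat (n - 1)"] by metis
qed

lemma dist_eq_D: "v \<in> V \<Longrightarrow> \<delta> v (p i) (p j) = D v (j - i)"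
proof -
  assume v: "v \<in> V"
  show ?thesis
  proof (cases "0 \<le> i")
    case True
    then show ?thesis
      unfolding D_def shift_eq[OF v, of 0 "j - i" "nat i"] by simp
  next
    case False
    then show ?thesis
      unfolding D_def shift_eq[OF v, of i j "nat (- i)"] by simp
  qed
qed

lemma D_minus: "v \<in> V \<Longrightarrow> D v (- k) = D v k"
  using dist_eq_D[of v k 0] commute[of v "p k" "p 0"] by (simp add: D_def)

lemma D_add: "v \<in> V \<Longrightarrow> min (D v j) (D v k) \<le> D v (j + k)"
  using ultra[of v "p 0" "p j" "p (j + k)"] dist_eq_D[of v j "j + k"] by (simp add: D_def)

lemma D_infinity_iff: "v \<in> V \<Longrightarrow> D v k = \<infinity> \<longleftrightarrow> n dvd k"
  using infinity_iff[of v "p 0" "p k"] p_eq_iff[of 0 k] by (simp add: D_def)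

lemma D_mult:
  assumes v: "v \<in> V"
  shows "D v k \<le> D v (k * l)"
proof -
  have *: "D v k \<le> D v (k * int m)" for m
  proof (induction m)
    case 0
    then show ?case using D_infinity_iff[OF v, of 0] by simp
  next
    case (Suc m)
    then show ?case
      using D_add[OF v, of "k * int m" k] by (simp add: algebra_simps min_def split: if_splits)
  qed
  show ?thesis
    using *[of "nat l"] *[of "nat (- l)"] D_minus[OF v, of "k * l"] by (cases "0 \<le> l") simp_all
qed

lemma D_one_le: "v \<in> V \<Longrightarrow> D v 1 \<le> D v k"
  using D_mult[of v 1 k] by simp

text \<open>Bezout writes \<open>gcd k n\<close> as a combination of \<open>k\<close> and
  \<open>n\<close>, and multiples of \<open>n\<close> are at infinite distance value.\<close>

lemma D_gcd:
  assumes v: "v \<in> V"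
  shows "D v (gcd k n) = D v k"
proof (rule antisym)
  show "D v (gcd k n) \<le> D v k"
    using D_mult[OF v, of "gcd k n" "k div gcd k n"] by simp
  obtain x y where xy: "x * k + y * n = gcd k n"
    using bezout_int by blast
  have "D v n = \<infinity>" using D_infinity_iff[OF v] by simp
  then have "D v (n * y) = \<infinity>" using D_mult[OF v, of n y] by simp
  then have "D v (k * x) \<le> D v (gcd k n)"
    using D_add[OF v, of "k * x" "n * y"] xy by (simp add: mult.commute)
  then show "D v k \<le> D v (gcd k n)"
    using D_mult[OF v, of k x] by simp
qed

lemma D_gcd_cong: "v \<in> V \<Longrightarrow> gcd k n = gcd l n \<Longrightarrow> D v k = D v l"
  using D_gcd[of v k] D_gcd[of v l] by simp

text \<open>\<open>D v 1\<close> is the least value of \<open>D v\<close>, so the close indices form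
  an ideal of the integers that does not contain \<open>1\<close>.\<close>

definition close :: "'v \<Rightarrow> int \<Rightarrow> bool" where
  "close v k \<longleftrightarrow> D v 1 < D v k"

lemma not_close: "v \<in> V \<Longrightarrow> \<not> close v k \<Longrightarrow> D v k = D v 1"
  using D_one_le[of v k] by (simp add: close_def)

lemma close_diff:
  assumes "v \<in> V" "close v j" "close v k"
  shows "close v (j - k)"
  using D_add[OF assms(1), of j "- k"] D_minus[OF assms(1), of k] assms(2,3)
  unfolding close_def by (auto simp: min_def split: if_splits)

lemma close_mult: "v \<in> V \<Longrightarrow> close v k \<Longrightarrow> close v (k * l)"
  using D_mult[of v k l] by (auto simp: close_def)

lemma not_close_1: "\<not> close v 1"
  by (simp add: close_def)

text \<open>The cross ratio of \<open>p 0\<close>, \<open>p a\<close>, \<open>p 1\<close>, \<open>p (- 1)\<close> is a unit at every place, hence so is its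
  complement, although the latter is divisible by the place \<open>v\<close> at which \<open>p a\<close> is close to \<open>p 0\<close>.\<close>
lemma close_neighbours_differ:
  assumes v: "v \<in> V" and a: "close v a" "\<not> n dvd a" and n: "3 \<le> n"
  shows "\<exists>w\<in>V. D w (a + 1) \<noteq> D w (a - 1)"
proof (rule ccontr)
  assume "\<not> ?thesis"
  then have eq: "D w (a + 1) = D w (a - 1)" if "w \<in> V" for w using that by blast
  \<comment> \<open>Otherwise \<open>1\<close> would be a difference of two close indices.\<close>
  have a1: "\<not> close v (a + 1)" "\<not> close v (a - 1)"
    using close_diff[OF v, of "a + 1" a] close_diff[OF v, of a "a - 1"] a(1) not_close_1 by auto
  have nd: "\<not> n dvd 1" "\<not> n dvd 2"
    using n by (auto dest: zdvd_imp_le)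
  have nda: "\<not> n dvd a - 1" "\<not> n dvd a + 1"
    using not_close[OF v a1(1)] not_close[OF v a1(2)] nd(1)
    unfolding D_infinity_iff[OF v, symmetric] by auto
  have "n dvd 1 - a \<longleftrightarrow> n dvd a - 1" "n dvd - 1 - a \<longleftrightarrow> n dvd a + 1"
    using dvd_minus_iff[of n "a - 1"] dvd_minus_iff[of n "- 1 - a"] by (simp_all add: add.commute)
  then have dist: "distinct [p 0, p 1, p (- 1), p a]"
    using nd nda a(2) by (simp add: p_eq_iff)
  have "\<delta> w (p 0) (p 1) + \<delta> w (p (- 1)) (p a) = \<delta> w (p 0) (p (- 1)) + \<delta> w (p 1) (p a)" if w: "w \<in> V" for w
    using eq[OF w] D_minus[OF w, of 1] by (simp add: dist_eq_D[OF w])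
  from cross[OF dist this v]
  have "D v a + D v (- 2) = D v 1 + D v 1"
    using not_close[OF v a1(2)] D_minus[OF v, of 1] by (simp add: dist_eq_D[OF v])
  moreover have "D v 1 + D v 1 < D v a + D v (- 2)"
    using a(1) D_one_le[OF v, of "- 2"] D_infinity_iff[OF v, of 1] nd(1) unfolding close_def
    by (cases "D v 1"; cases "D v a"; cases "D v (- 2)") auto
  ultimately show False by simp
qed

lemma coprime_cong_D1: "v \<in> V \<Longrightarrow> coprime k n \<Longrightarrow> D v k = D v 1"
  using D_gcd_cong[of v k 1] by simp

text \<open>With \<open>m = n div q\<close>, every \<open>m * k\<close> is close. A suitable
  \<open>k\<close> prime to \<open>q\<close> makes \<open>m * k + 1\<close> and
  \<open>m * k - 1\<close> indistinguishable for \<open>D\<close>, against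
  \<open>close_neighbours_differ\<close>. Such a choice by coprimality is blocked only if
  \<open>q = 3\<close> and \<open>3\<close> does not divide \<open>m\<close>.\<close>

lemma close_index_prime:
  assumes v: "v \<in> V" and h: "close v h" "h * q dvd n" "1 < h" and l: "prime q"
  shows "q = 3 \<and> \<not> 9 dvd n"
proof (rule ccontr)
  assume contra: "\<not> ?thesis"
  define m where "m = n div q"
  have l2: "2 \<le> q" using l prime_ge_2_int by blast
  have nm: "n = m * q"
    using h(2) by (simp add: m_def dvd_mult_right)
  have hm: "h dvd m"
    using h(2) l2 nm by simp
  have m: "0 < m" using n_ge_2 l2 nm mult_nonpos_nonneg[of m q] by linarith
  then have mh: "2 \<le> m" using hm h(3) zdvd_imp_le by force
  then have n4: "4 \<le> n" using nm l2 mult_mono[of 2 m 2 q] by simp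
  have close: "close v (m * k)" for k
    using close_mult[OF v h(1)] hm by (metis dvd_def mult.assoc)
  have nd: "\<not> n dvd m * k" if "\<not> q dvd k" for k
    using that m nm by simp
  have "\<exists>k. \<not> q dvd k \<and> (\<forall>w\<in>V. D w (m * k + 1) = D w (m * k - 1))"
  proof (cases "q = 2")
    case True
    \<comment> \<open>For \<open>q = 2\<close> the two neighbours of \<open>m\<close> add up to
      \<open>n\<close>.\<close>
    have "gcd (m + 1) n = gcd (m - 1) n"
    proof -
      have "gcd (m + 1) n = gcd (n - (m + 1)) n"
        using gcd_diff2[of n "m + 1"] by (simp add: gcd.commute)
      also have "n - (m + 1) = m - 1" using nm True by simp
      finally show ?thesis .
    qed
    from D_gcd_cong[OF _ this] True show ?thesis
      by (intro exI[of _ 1] conjI ballI) simp_all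
  next
    case False
    \<comment> \<open>The neighbours of \<open>m * k\<close> are automatically prime to
      \<open>m\<close>, so only divisibility by \<open>q\<close> has to be avoided.\<close>
    have "\<exists>k. (k = 1 \<or> k = 2) \<and> \<not> q dvd m * k + 1 \<and> \<not> q dvd m * k - 1"
    proof (cases "q dvd m")
      case True
      then show ?thesis
        using not_prime_unit[of q] l dvd_add_right_iff[of q m 1] dvd_diff_right_iff[of q m 1]
        by (intro exI[of _ 1]) auto
    next
      case ndvd: False
      have "q \<noteq> 3"
      proof
        assume 3: "q = 3"
        then have "9 dvd n" using contra by simp
        then have "9 dvd m * 3" "\<not> 3 dvd m" using ndvd nm 3 by simp_all
        then show False by presburger
      qed
      have "\<not> q dvd 1"
        using zdvd_imp_le[of q 1] l2 by linarith
      moreover have "\<not> q dvd 3"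
        using zdvd_imp_le[of q 3] l2 False \<open>q \<noteq> 3\<close> by linarith
      ultimately have n13: "\<not> q dvd 1" "\<not> q dvd 3" .
      show ?thesis
      proof (cases "q dvd m + 1 \<or> q dvd m - 1")
        case True
        \<comment> \<open>If \<open>k = 1\<close> and \<open>k = 2\<close> both fail, eliminating
          \<open>m\<close> leaves a difference of absolute value \<open>1\<close> or
          \<open>3\<close> divisible by \<open>q\<close>.\<close>
        have "q dvd 1 \<or> q dvd 3" if "q dvd m * 2 + 1 \<or> q dvd m * 2 - 1"
        proof -
          have "q dvd m * 2 + e - (m + e') * 2" if "q dvd m * 2 + e" "q dvd m + e'" for e e'
            using that by (intro dvd_diff dvd_mult2)
          from this[of 1 1] this[of 1 "- 1"] this[of "- 1" 1] this[of "- 1" "- 1"]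
          show ?thesis using that True by auto
        qed
        with n13 show ?thesis by (intro exI[of _ 2]) auto
      qed (intro exI[of _ 1], simp)
    qed
    then obtain k where k: "k = 1 \<or> k = 2" "\<not> q dvd m * k + 1" "\<not> q dvd m * k - 1" by blast
    have cop: "coprime (m * k + e) n" if "e = 1 \<or> e = - 1" for e
    proof -
      have "coprime (m * k + e) m"
        using that gcd_add_mult[of m k e] by (auto simp: coprime_iff_gcd_eq_1 gcd.commute mult.commute)
      moreover have "coprime (m * k + e) q"
        using k(2,3) that prime_imp_coprime[OF l, of "m * k + e"] by (auto simp: coprime_commute)
      ultimately show ?thesis by (simp add: nm)
    qed
    from k(1) have "\<not> q dvd k"
      using False l2 zdvd_imp_le[of q 2] by (auto dest: zdvd_imp_le)
    moreover have "D w (m * k + 1) = D w (m * k - 1)" if w: "w \<in> V" for w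
      using coprime_cong_D1[OF w cop[of 1]] coprime_cong_D1[OF w cop[of "- 1"]] by simp
    ultimately show ?thesis by blast
  qed
  then show False
    using close_neighbours_differ[OF v close nd] n4 by force
qed

text \<open>A deviating index yields a close proper divisor \<open>h\<close> of \<open>n\<close>,
  and \<open>close_index_prime\<close> leaves only the case where \<open>3\<close> divides
  \<open>n\<close> exactly once. There \<open>m = n div 3\<close> is close, while its two neighbours
  still have the same \<open>D\<close>.\<close>

lemma D_constant:
  assumes v: "v \<in> V" and k: "\<not> n dvd k"
  shows "D v k = D v 1"
proof (rule ccontr)
  assume ne: "D v k \<noteq> D v 1"
  have factor: "\<exists>q. prime q \<and> h * q dvd n" if "h dvd n" "1 < h" "h < n" for h :: int
  proof -
    obtain r where r: "n = h * r" using \<open>h dvd n\<close> by (auto simp: dvd_def)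
    then have "\<bar>r\<bar> \<noteq> 1" using that n_ge_2 by (auto simp: abs_if split: if_splits)
    then obtain q where "prime q" "q dvd r" by (metis prime_factor_int)
    then show ?thesis using r by auto
  qed
  have close_gcd: "close w (gcd j n) \<and> 1 < gcd j n" if w: "w \<in> V" and j: "D w j \<noteq> D w 1" for w j
  proof -
    have "close w (gcd j n)" using not_close[OF w] D_gcd[OF w] j by (metis close_def)
    moreover from this have "gcd j n \<noteq> 1" using not_close_1 by metis
    ultimately show ?thesis
      using n_ge_2 gcd_pos_int[of j n] by linarith
  qed
  define h where "h = gcd k n"
  have h: "close v h" "1 < h" "h dvd n" using close_gcd[OF v ne] by (auto simp: h_def)
  have "h \<noteq> n" using k unfolding h_def by (metis gcd_dvd1)
  then have "h < n" using h(3) n_ge_2 zdvd_imp_le[of h n] by simp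
  obtain q where l: "prime q" "h * q dvd n"
    using factor[OF h(3,2) \<open>h < n\<close>] by blast
  have "q = 3" and n9: "\<not> 9 dvd n" using close_index_prime[OF v h(1) l(2) h(2) l(1)] by auto
  then have h3: "h * 3 dvd n" using l by simp
  define m where "m = n div 3"
  have nm: "n = m * 3" using h3 by (simp add: m_def dvd_mult_right)
  have m3: "\<not> 3 dvd m" using n9 nm by presburger
  have hm: "h dvd m" using h3 nm by simp
  have m2: "2 \<le> m" using hm h(2) nm n_ge_2 zdvd_imp_le[of h m] by simp
  \<comment> \<open>If \<open>3\<close> were close, \<open>close_index_prime\<close> applied to
    \<open>3\<close> itself would make \<open>9\<close> divide \<open>n\<close>.\<close>
  have D3: "D w 3 = D w 1" if w: "w \<in> V" for w
  proof (rule ccontr)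
    assume "D w 3 \<noteq> D w 1"
    moreover have "gcd 3 n = 3" using nm by simp
    ultimately have c3: "close w 3" using close_gcd[OF w] by metis
    have "3 dvd n" "3 < n" using nm m2 by auto
    then obtain q where l: "prime q" "3 * q dvd n" using factor[of 3] by auto
    have "q = 3" using close_index_prime[OF w c3 l(2) _ l(1)] by simp
    then show False using n9 l(2) by simp
  qed
  \<comment> \<open>The neighbours of \<open>m\<close> are prime to \<open>m\<close>, so their gcd
    with \<open>n = m * 3\<close> is \<open>1\<close> or \<open>3\<close>, and \<open>D\<close>
    agrees on both.\<close>
  have "D w (m + 1) = D w 1 \<and> D w (m - 1) = D w 1" if w: "w \<in> V" for w
  proof -
    have "D w (m + e) = D w 1" if e: "e = 1 \<or> e = - 1" for e
    proof -
      have cop: "coprime (m + e) m"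
        using e gcd_add_mult[of m 1 e] by (auto simp: coprime_iff_gcd_eq_1 gcd.commute add.commute)
      then have "gcd (m + e) n = gcd (m + e) 3"
        unfolding nm by (simp add: gcd_mult_left_right_cancel gcd_mult_right_left_cancel)
      moreover have "gcd (m + e) 3 = 1 \<or> gcd (m + e) 3 = 3"
        using l(1) \<open>q = 3\<close> unfolding prime_int_iff by (metis gcd_dvd2 gcd_ge_0_int)
      moreover have "gcd 3 n = 3" "gcd 1 n = 1" using nm by simp_all
      ultimately have "D w (m + e) = D w 1 \<or> D w (m + e) = D w 3"
        using D_gcd_cong[OF w] by metis
      then show ?thesis using D3[OF w] by auto
    qed
    from this[of 1] this[of "- 1"] show ?thesis by simp
  qed
  moreover have "close v m" using close_mult[OF v h(1)] hm by (metis dvd_def)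
  moreover have "\<not> n dvd m" using nm m2 zdvd_imp_le[of n m] by auto
  ultimately show False
    using close_neighbours_differ[OF v, of m] nm m2 by auto
qed

lemma cycle_equidistant: "v \<in> V \<Longrightarrow> p i \<noteq> p j \<Longrightarrow> \<delta> v (p i) (p j) = D v 1"
  using dist_eq_D[of v i j] D_constant[of v "j - i"] p_eq_iff[of j i] by metis

end

text \<open>The rho shape of a finite orbit: \<open>m\<close> is the first index whose point recurs,
  \<open>n\<close> its least return time.\<close>

lemma finite_orbit_rho:
  assumes "finite (orbit h P)"
  obtains m n where "0 < n" "orbit h P = (\<lambda>i. (h ^^ i) P) ` {..<m + n}"
    "\<And>i j. i < j \<Longrightarrow> (h ^^ i) P = (h ^^ j) P \<longleftrightarrow> m \<le> i \<and> n dvd j - i"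
proof -
  define s where "s i = (h ^^ i) P" for i
  have s_add: "s (i + k) = (h ^^ k) (s i)" for i k
    unfolding s_def add.commute[of i k] by (simp add: funpow_add)
  have s_cong: "s (i + k) = s (j + k)" if "s i = s j" for i j k
    using that by (simp add: s_add)
  have orb: "orbit h P = range s"
    by (auto simp: orbit_def s_def)
  have "\<not> inj s"
    using assms unfolding orb using infinite_iff_countable_subset finite_imageD by blast
  then have "\<exists>i k. 0 < k \<and> s (i + k) = s i"
    unfolding inj_def by (metis less_imp_add_positive nat_neq_iff)
  then have ex: "\<exists>k. 0 < k \<and> s ((LEAST i. \<exists>k. 0 < k \<and> s (i + k) = s i) + k) = s (LEAST i. \<exists>k. 0 < k \<and> s (i + k) = s i)"
    by (rule LeastI_ex)
  define m where "m = (LEAST i. \<exists>k. 0 < k \<and> s (i + k) = s i)"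
  define n where "n = (LEAST k. 0 < k \<and> s (m + k) = s m)"
  have m_le: "m \<le> i" if "s (i + k) = s i" "0 < k" for i k
    unfolding m_def using that by (intro Least_le) blast
  have n: "0 < n" "s (m + n) = s m"
    using LeastI_ex[OF ex] unfolding m_def n_def by simp_all
  have n_le: "n \<le> k" if "s (m + k) = s m" "0 < k" for k
    unfolding n_def using that by (intro Least_le) blast
  have per: "s (i + n * c) = s i" if "m \<le> i" for i c
  proof (induction c)
    case (Suc c)
    have "s (m + n + (i - m + n * c)) = s (m + (i - m + n * c))"
      by (rule s_cong[OF n(2)])
    then show ?case using Suc that by (simp add: algebra_simps)
  qed simp
  have eq: "s i = s j \<longleftrightarrow> m \<le> i \<and> n dvd j - i" if "i < j" for i j
  proof
    assume "m \<le> i \<and> n dvd j - i"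
    then show "s i = s j"
      using per[of i "(j - i) div n"] that by simp
  next
    assume e: "s i = s j"
    then have mi: "m \<le> i" using m_le[of i "j - i"] that by simp
    \<comment> \<open>Pushes the coincidence forward until index \<open>i\<close> becomes
      \<open>m\<close> plus a multiple of \<open>n\<close>; then periodicity and minimality of
      \<open>n\<close> apply.\<close>
    define k where "k = m + n * i - i"
    have k: "i + k = m + n * i"
      using n(1) by (simp add: k_def trans_le_add2)
    have "s (m + n * i) = s (m + n * i + (j - i))"
    proof -
      have "j + k = m + n * i + (j - i)" using k that by linarith
      then show ?thesis using s_cong[OF e, of k] k by metis
    qed
    also have "\<dots> = s (m + (j - i))"
      using per[of "m + (j - i)" i] by (simp add: algebra_simps)
    also have "\<dots> = s (m + (j - i) mod n)"
      using per[of "m + (j - i) mod n" "(j - i) div n"] by (simp add: algebra_simps)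
    finally have "s (m + (j - i) mod n) = s m"
      using per[of m i] by simp
    then have "(j - i) mod n = 0"
      using n_le[of "(j - i) mod n"] n(1) by (metis linorder_not_le mod_less_divisor neq0_conv)
    then show "m \<le> i \<and> n dvd j - i" using mi by auto
  qed
  have "s i \<in> s ` {..<m + n}" for i
  proof (cases "i < m + n")
    case False
    have "s i = s (m + (i - m) mod n)"
      using per[of "m + (i - m) mod n" "(i - m) div n"] False by (simp add: algebra_simps)
    then show ?thesis using n(1) by auto
  qed auto
  then have "orbit h P = s ` {..<m + n}"
    unfolding orb by auto
  with n(1) eq show ?thesis
    by (intro that[of n m]) (simp_all add: s_def)
qed

section \<open>Tails, and the bound for the whole orbit\<close>

context contracting_family
begin

text \<open>Contraction and the ultrametric inequality make \<open>T3\<close> equally far from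
  \<open>T2\<close>, \<open>T1\<close>, \<open>A\<close>, and \<open>T2\<close> equally far from
  \<open>T1\<close>, \<open>A\<close>. A cross ratio of the four points supplies the second
  equality.\<close>

lemma fixed_tail_dist:
  assumes mono: "\<And>v P Q. v \<in> V \<Longrightarrow> \<delta> v P Q \<le> \<delta> v (\<psi> P) (\<psi> Q)"
    and dist: "distinct [T3, T1, A, T2]"
    and maps: "\<psi> T3 = T2" "\<psi> T2 = T1" "\<psi> T1 = A" "\<psi> A = A"
    and v: "v \<in> V"
  shows "\<delta> v T2 T1 = \<delta> v T2 A" "\<delta> v T1 A = \<delta> v T2 A"
proof -
  have *: "\<delta> w T2 T1 = \<delta> w T2 A \<and> \<delta> w T3 T1 = \<delta> w T3 A \<and> \<delta> w T3 T2 = \<delta> w T3 A" if w: "w \<in> V" for w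
  proof -
    have x: "\<delta> w T2 A \<le> \<delta> w T1 A" "\<delta> w T3 A \<le> \<delta> w T2 A"
      using mono[OF w, of T2 A] mono[OF w, of T3 A] maps by simp_all
    have "\<delta> w T2 T1 \<le> \<delta> w T1 A" "\<delta> w T3 T1 \<le> \<delta> w T2 A" "\<delta> w T3 T2 \<le> \<delta> w T2 T1"
      using mono[OF w, of T2 T1] mono[OF w, of T3 T1] mono[OF w, of T3 T2] maps by simp_all
    with x show ?thesis
      using ultra[OF w, of T2 A T1] ultra[OF w, of T2 T1 A] ultra[OF w, of T3 A T1] ultra[OF w, of T3 T1 A]
        ultra[OF w, of T3 A T2] ultra[OF w, of T3 T2 A] commute[OF w]
      by (auto simp: min_def intro: antisym split: if_splits)
  qed
  show "\<delta> v T2 T1 = \<delta> v T2 A" using * v by blast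
  \<comment> \<open>The cross ratio is a unit everywhere. In the relation for its complement the
    distance from \<open>T3\<close> to \<open>A\<close> cancels, being finite.\<close>
  have "\<delta> w T3 T1 + \<delta> w A T2 = \<delta> w T3 A + \<delta> w T1 T2" if "w \<in> V" for w
    using *[OF that] commute[OF that] by metis
  from cross[OF dist this v] *[OF v]
  have "\<delta> v T3 A + \<delta> v T1 A = \<delta> v T3 A + \<delta> v T2 A"
    using commute[OF v] by metis
  moreover have "\<delta> v T3 A \<noteq> \<infinity>" using infinity_iff[OF v] dist by simp
  ultimately show "\<delta> v T1 A = \<delta> v T2 A"
    by (simp add: enat_add_left_cancel)
qed

text \<open>The residue field enters only through \<open>equidist\<close>, applied once to the cycle
  and once to a long tail. A tail with \<open>m \<le> 2 * n\<close> is paid for by the cycle, since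
  then \<open>m + n \<le> 3 * n\<close>.\<close>

lemma card_orbit_le:
  assumes v: "v \<in> V" and fin: "finite (orbit \<phi> P)"
    and equidist: "\<And>X e. finite X \<Longrightarrow> (\<And>P Q. P \<in> X \<Longrightarrow> Q \<in> X \<Longrightarrow> P \<noteq> Q \<Longrightarrow> \<delta> v P Q = e) \<Longrightarrow> card X \<le> q + 1"
  shows "card (orbit \<phi> P) \<le> 3 * q + 3"
proof -
  obtain m n where n: "0 < n" and orb: "orbit \<phi> P = (\<lambda>i. (\<phi> ^^ i) P) ` {..<m + n}"
    and eq: "\<And>i j. i < j \<Longrightarrow> (\<phi> ^^ i) P = (\<phi> ^^ j) P \<longleftrightarrow> m \<le> i \<and> n dvd j - i"
    using finite_orbit_rho[OF fin] by metis
  define s where "s i = (\<phi> ^^ i) P" for i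
  have s_eq: "s i = s j \<longleftrightarrow> m \<le> i \<and> n dvd j - i" if "i < j" for i j
    using eq[OF that] by (simp add: s_def)
  have step: "\<phi> (s i) = s (i + 1)" for i
    by (simp add: s_def)
  have steps: "(\<phi> ^^ k) (s i) = s (i + k)" for i k
    unfolding s_def add.commute[of i k] by (simp add: funpow_add)
  have per: "s (i + n * c) = s i" if "m \<le> i" for i c
    using s_eq[of i "i + n * c"] that n by (cases "c = 0") auto
  have card_orb: "card (orbit \<phi> P) \<le> m + n"
    unfolding orb using card_image_le[of "{..<m + n}"] by simp
  have n_le: "n \<le> q + 1"
  proof (cases "n = 1")
    case False
    \<comment> \<open>Extends the cycle periodically to all integers.\<close>
    define p where "p i = s (m + nat (i mod int n))" for i
    have p_eq: "p i = p j \<longleftrightarrow> int n dvd i - j" for i j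
    proof -
      have "s (m + a) = s (m + b) \<longleftrightarrow> a = b" if "a < n" "b < n" for a b
      proof -
        have "s (m + a) \<noteq> s (m + b)" if "a < b" "b < n" for a b
          using that s_eq[of "m + a" "m + b"] by (auto dest: dvd_imp_le)
        from this[of a b] this[of b a] that show ?thesis by (metis linorder_neqE_nat)
      qed
      from this[of "nat (i mod int n)" "nat (j mod int n)"] n show ?thesis
        by (simp add: p_def nat_less_iff eq_nat_nat_iff mod_eq_dvd_iff)
    qed
    interpret contracting_cycle V \<delta> \<phi> p "int n"
    proof
      show "2 \<le> int n" using False n by simp
      show "p i = p j \<longleftrightarrow> int n dvd i - j" for i j by (rule p_eq)
      show "\<phi> (p i) = p (i + 1)" for i
      proof -
        have "s (m + nat (i mod int n) + 1) = p (i + 1)"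
        proof (cases "i mod int n + 1 = int n")
          case True
          then have "(i + 1) mod int n = 0" by (metis mod_add_left_eq mod_self)
          moreover have "i mod int n = int (n - 1)" using True n by (simp add: of_nat_diff)
          then have "nat (i mod int n) + 1 = n" using n by simp
          then have "s (m + nat (i mod int n) + 1) = s (m + n)" by (metis add.assoc)
          ultimately show ?thesis using per[of m 1] by (simp add: p_def)
        next
          case False
          then have "i mod int n + 1 < int n" using n pos_mod_bound[of "int n" i] by linarith
          then have "(i + 1) mod int n = i mod int n + 1"
            using n by (metis mod_add_left_eq mod_pos_pos_trivial pos_mod_sign add_nonneg_nonneg of_nat_0_less_iff zero_le_one)
          then show ?thesis using n by (simp add: p_def nat_add_distrib)
        qed
        then show ?thesis by (simp add: p_def step)
      qed
    qed
    have "inj_on p (int ` {..<n})"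
      by (auto simp: inj_on_def p_eq simp flip: mod_eq_dvd_iff zmod_int)
    then have "card (p ` int ` {..<n}) = n"
      by (simp add: card_image)
    moreover have "card (p ` int ` {..<n}) \<le> q + 1"
      by (rule equidist[of _ "D v 1"]) (use cycle_equidistant[OF v] in auto)
    ultimately show ?thesis by simp
  qed simp
  show ?thesis
  proof (cases "m \<le> 2 * n")
    case True
    then show ?thesis using card_orb n_le by linarith
  next
    case False
    then have m: "2 * n < m" by simp
    \<comment> \<open>Going back by \<open>n\<close> from the last tail index stays inside the tail
      twice because \<open>2 * n < m\<close>; going forward by \<open>n\<close> reaches the
      cycle.\<close>
    define A where "A = s (m - 1 + n)"
    define T1 where "T1 = s (m - 1)"
    define T2 where "T2 = s (m - 1 - n)"
    define T3 where "T3 = s (m - 1 - 2 * n)"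
    have maps: "(\<phi> ^^ n) T3 = T2" "(\<phi> ^^ n) T2 = T1" "(\<phi> ^^ n) T1 = A" "(\<phi> ^^ n) A = A"
      using m n per[of "m - 1 + n" 1] by (simp_all add: steps A_def T1_def T2_def T3_def)
    have ne: "s i \<noteq> s j" if "i < j" "i < m" for i j
      using s_eq[OF that(1)] that(2) by simp
    have "T3 \<noteq> T1" "T3 \<noteq> A" "T3 \<noteq> T2" "T2 \<noteq> T1" "T2 \<noteq> A" "T1 \<noteq> A"
      unfolding A_def T1_def T2_def T3_def using m n by (intro ne; linarith)+
    then have "distinct [T3, T1, A, T2]" by auto
    note tail = fixed_tail_dist[where \<psi> = "\<phi> ^^ n", OF mono_funpow this maps v]
    note \<open>T1 \<noteq> A\<close>
    \<comment> \<open>\<open>T1\<close> and \<open>A\<close> are two preimages of the entry point of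
      the cycle, so \<open>double\<close> applies at \<open>T2\<close>; the remaining
      \<open>n - 1\<close> steps carry the images to \<open>T1\<close> and \<open>A\<close>.\<close>
    moreover have "\<phi> T1 = \<phi> A"
      using s_eq[of m "m + n"] m n by (simp add: T1_def A_def step)
    ultimately have "\<delta> v T2 T1 + \<delta> v T2 A \<le> \<delta> v (\<phi> T2) (\<phi> T1)"
      by (rule double[OF v])
    also have "\<dots> \<le> \<delta> v ((\<phi> ^^ (n - 1)) (\<phi> T2)) ((\<phi> ^^ (n - 1)) (\<phi> T1))"
      by (rule mono_funpow[OF v])
    also have "\<dots> = \<delta> v T1 A"
    proof -
      have "m - 1 - n + 1 + (n - 1) = m - 1" "m - 1 + 1 + (n - 1) = m - 1 + n"
        using m n by linarith+
      then show ?thesis by (simp only: step steps T1_def T2_def A_def)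
    qed
    finally have "\<delta> v T1 A + \<delta> v T1 A \<le> \<delta> v T1 A"
      using tail by simp
    then have zero: "\<delta> v T1 A = 0"
      using infinity_iff[OF v] \<open>T1 \<noteq> A\<close> by (cases "\<delta> v T1 A") (auto simp: zero_enat_def)
    have far: "\<delta> v (s i) (s j) = 0" if ij: "i < j" "j \<le> m" for i j
    proof (rule ccontr)
      assume "\<delta> v (s i) (s j) \<noteq> 0"
      then have pos: "0 < \<delta> v (s i) (s j)" by simp
      define t where "t = j - i"
      \<comment> \<open>Closeness with gap \<open>t\<close> propagates by steps of \<open>t\<close>
        to gap \<open>n * t\<close>, a multiple of the period; moving on to index
        \<open>m - 1\<close> would bring \<open>T1\<close> close to \<open>A\<close>.\<close>
      have chain: "0 < \<delta> v (s i) (s (i + k * t))" for k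
      proof (induction k)
        case 0
        show ?case using infinity_iff[OF v, of "s i" "s i"] by simp
      next
        case (Suc k)
        have "\<delta> v (s i) (s j) \<le> \<delta> v (s (i + k * t)) (s (j + k * t))"
          using mono_funpow[OF v, of "s i" "s j" "k * t"] by (simp add: steps)
        moreover have "j + k * t = i + Suc k * t" using ij by (simp add: t_def)
        ultimately have "0 < \<delta> v (s (i + k * t)) (s (i + Suc k * t))"
          using pos by (metis order_less_le_trans)
        then show ?case
          using Suc ultra[OF v, of "s i" "s (i + k * t)" "s (i + Suc k * t)"]
          by (metis min_less_iff_conj order_less_le_trans)
      qed
      have "0 < \<delta> v (s (i + (m - 1 - i))) (s (i + n * t + (m - 1 - i)))"
        using chain[of n] mono_funpow[OF v, of "s i" "s (i + n * t)" "m - 1 - i"]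
        by (metis order_less_le_trans steps)
      moreover have "i + (m - 1 - i) = m - 1" using ij by simp
      moreover have "s (i + n * t + (m - 1 - i)) = A"
      proof -
        have "1 \<le> t" using ij by (simp add: t_def)
        then have "n * t = n + n * (t - 1)" by (metis add.commute distrib_left le_add_diff_inverse mult.right_neutral)
        then have "i + n * t + (m - 1 - i) = m - 1 + n + n * (t - 1)" using ij by simp
        then show ?thesis using per[of "m - 1 + n" "t - 1"] m n by (simp add: A_def)
      qed
      ultimately show False using zero by (simp add: T1_def)
    qed
    \<comment> \<open>The \<open>m\<close> tail points together with the entry point
      \<open>s m\<close> are equidistant, which gives \<open>m \<le> q\<close>.\<close>
    have "inj_on s {..m}"
      by (rule linorder_inj_onI) (use s_eq in auto)
    then have "card (s ` {..m}) = m + 1" by (simp add: card_image)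
    moreover have "card (s ` {..m}) \<le> q + 1"
    proof (rule equidist[of _ 0])
      fix P Q assume "P \<in> s ` {..m}" "Q \<in> s ` {..m}" "P \<noteq> Q"
      then obtain i j where "P = s i" "Q = s j" "i \<le> m" "j \<le> m" "i \<noteq> j" by auto
      then show "\<delta> v P Q = 0"
        using far[of i j] far[of j i] commute[OF v] by (metis linorder_neqE_nat)
    qed simp
    ultimately show ?thesis using card_orb n_le by linarith
  qed
qed

end

section \<open>Finite extensions of a rational function field\<close>

text \<open>Integer polynomials stand for polynomials over the prime field. A nonzero one may reduce
  to zero, hence the recurring conditions on \<open>map_poly of_int\<close>.\<close>

definition ipoly :: "int poly \<Rightarrow> 'k::field \<Rightarrow> 'k" where
  "ipoly f t = poly (map_poly of_int f) t"

lemma ipoly_simps [simp]: "ipoly 0 t = 0" "ipoly 1 t = 1" "ipoly (pCons c f) t = of_int c + t * ipoly f t"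
  by (simp_all add: ipoly_def map_poly_pCons)

lemma ipoly_add [simp]: "ipoly (f + g) t = ipoly f t + ipoly g t"
proof -
  have "map_poly of_int (f + g) = (map_poly of_int f + map_poly of_int g :: 'a poly)"
    by (rule poly_eqI) (simp add: coeff_map_poly)
  then show ?thesis by (simp add: ipoly_def)
qed

lemma ipoly_smult [simp]: "ipoly (smult c f) t = of_int c * ipoly f t"
  by (induction f) (simp_all add: algebra_simps)

lemma ipoly_uminus [simp]: "ipoly (- f) t = - ipoly f t"
  using ipoly_smult[of "- 1" f t] by simp

lemma ipoly_diff [simp]: "ipoly (f - g) t = ipoly f t - ipoly g t"
  using ipoly_add[of f "- g" t] by simp

lemma ipoly_mult [simp]: "ipoly (f * g) t = ipoly f t * ipoly g t"
  by (induction f) (simp_all add: algebra_simps)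

lemma ipoly_sum [simp]: "ipoly (sum f A) t = (\<Sum>i\<in>A. ipoly (f i) t)"
  by (induction A rule: infinite_finite_induct) auto

lemma ipoly_prod [simp]: "ipoly (prod f A) t = (\<Prod>i\<in>A. ipoly (f i) t)"
  by (induction A rule: infinite_finite_induct) auto

lemma ipoly_monom [simp]: "ipoly (monom c n) t = of_int c * t ^ n"
  by (simp add: ipoly_def map_poly_monom poly_monom)

lemma ipoly_altdef: "degree f \<le> d \<Longrightarrow> ipoly f t = (\<Sum>i\<le>d. of_int (coeff f i) * t ^ i)"
proof -
  assume d: "degree f \<le> d"
  have "f = (\<Sum>i\<le>d. monom (coeff f i) i)"
    using poly_as_sum_of_monoms'[OF d] by simp
  then have "ipoly f t = ipoly (\<Sum>i\<le>d. monom (coeff f i) i) t" by simp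
  then show ?thesis by simp
qed

text \<open>Splits off the lowest term that survives reduction; where \<open>t\<close> has positive
  value, the second factor is a unit.\<close>

lemma ipoly_lowest:
  assumes "map_poly of_int f \<noteq> (0 :: 'k::field poly)"
  shows "\<exists>a c h. of_int c \<noteq> (0 :: 'k) \<and> ipoly f (t :: 'k) = t ^ a * (of_int c + t * ipoly h t)"
  using assms
proof (induction f)
  case (pCons c f)
  show ?case
  proof (cases "of_int c = (0 :: 'k)")
    case True
    then have ne: "map_poly of_int f \<noteq> (0 :: 'k poly)"
      using pCons.prems by (auto simp: map_poly_pCons)
    obtain a c' h where "of_int c' \<noteq> (0 :: 'k)" "ipoly f t = t ^ a * (of_int c' + t * ipoly h t)"
      using pCons.IH[OF ne] that by auto
    then show ?thesis using True by (intro exI[of _ "Suc a"] exI[of _ c'] exI[of _ h]) simp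
  next
    case False
    then show ?thesis by (intro exI[of _ 0] exI[of _ c] exI[of _ f]) simp
  qed
qed simp

lemma ipoly_nonzero: "ipoly f (t :: 'k::field) \<noteq> 0 \<Longrightarrow> map_poly of_int f \<noteq> (0 :: 'k::field poly)"
  by (auto simp: ipoly_def)

text \<open>Bezout with the characteristic inverts within the image of the integers.\<close>

lemma of_int_inverse:
  fixes k :: "'k::field itself"
  assumes "prime CHAR('k)" "of_int c \<noteq> (0 :: 'k)"
  obtains d where "of_int c * of_int d = (1 :: 'k)"
proof -
  have "\<not> int CHAR('k) dvd c" using assms(2) by (simp add: of_int_eq_0_iff_char_dvd)
  then have "coprime (int CHAR('k)) c" using assms(1) by (simp add: prime_imp_coprime)
  then obtain x y where "x * int CHAR('k) + y * c = 1"
    using bezout_int by (metis coprime_imp_gcd_eq_1)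
  then have "of_int (x * int CHAR('k) + y * c) = (1 :: 'k)" by simp
  then show ?thesis using that[of y] by (simp add: mult.commute)
qed

section \<open>Subrings, subfields and linear algebra over a subfield\<close>

definition is_subring :: "'k::field set \<Rightarrow> bool" where
  "is_subring A \<longleftrightarrow> 1 \<in> A \<and> (\<forall>x\<in>A. \<forall>y\<in>A. x - y \<in> A \<and> x * y \<in> A)"

definition is_subfield :: "'k::field set \<Rightarrow> bool" where
  "is_subfield L \<longleftrightarrow> is_subring L \<and> (\<forall>x\<in>L. inverse x \<in> L)"

locale subring_set =
  fixes A :: "'k::field set"
  assumes subring: "is_subring A"
begin

lemma one_closed: "1 \<in> A" and diff_closed: "x \<in> A \<Longrightarrow> y \<in> A \<Longrightarrow> x - y \<in> A"
  and mult_closed: "x \<in> A \<Longrightarrow> y \<in> A \<Longrightarrow> x * y \<in> A"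
  using subring by (auto simp: is_subring_def)

lemma zero_closed: "0 \<in> A" using diff_closed[OF one_closed one_closed] by simp

lemma uminus_closed: "x \<in> A \<Longrightarrow> - x \<in> A" using diff_closed[OF zero_closed] by simp

lemma add_closed: "x \<in> A \<Longrightarrow> y \<in> A \<Longrightarrow> x + y \<in> A" using diff_closed[OF _ uminus_closed] by simp

lemma power_closed: "x \<in> A \<Longrightarrow> x ^ n \<in> A"
  by (induction n) (auto intro: one_closed mult_closed)

lemma sum_closed: "(\<And>i. i \<in> I \<Longrightarrow> h i \<in> A) \<Longrightarrow> sum h I \<in> A"
  by (induction I rule: infinite_finite_induct) (auto intro: add_closed zero_closed)

lemma of_int_closed: "of_int c \<in> A"
proof -
  have "of_nat m \<in> A" for m by (induction m) (auto intro: add_closed zero_closed one_closed)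
  then show ?thesis by (cases c rule: int_cases2) (auto intro: uminus_closed)
qed

lemma ipoly_closed: "t \<in> A \<Longrightarrow> ipoly f t \<in> A"
  by (induction f) (auto intro: add_closed mult_closed zero_closed of_int_closed)

end

locale subfield_set =
  fixes L :: "'k::field set"
  assumes subfield: "is_subfield L"
begin

sublocale subring_set L
  by unfold_locales (use subfield in \<open>simp add: is_subfield_def\<close>)

lemma inverse_closed: "x \<in> L \<Longrightarrow> inverse x \<in> L"
  using subfield by (simp add: is_subfield_def)

lemma divide_closed: "x \<in> L \<Longrightarrow> y \<in> L \<Longrightarrow> x / y \<in> L"
  by (simp add: divide_inverse mult_closed inverse_closed)

lemma Fpt_subset: "t \<in> L \<Longrightarrow> Fpt t \<subseteq> L"
  unfolding Fpt_def ipoly_def[symmetric] by (auto intro: divide_closed ipoly_closed)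

text \<open>Gaussian elimination, by induction on the number of equations; all operations stay in
  \<open>L\<close>.\<close>

lemma homogeneous_solution:
  assumes "finite I" "finite J" "card I < card J" "\<And>i j. i \<in> I \<Longrightarrow> j \<in> J \<Longrightarrow> M i j \<in> L"
  shows "\<exists>c. (\<forall>j. c j \<in> L) \<and> (\<exists>j\<in>J. c j \<noteq> 0) \<and> (\<forall>i\<in>I. (\<Sum>j\<in>J. M i j * c j) = 0)"
  using assms
proof (induction I arbitrary: J M rule: finite_induct)
  case empty
  then obtain j where "j \<in> J" by (metis card.empty card_gt_0_iff ex_in_conv)
  then show ?case using one_closed by (intro exI[of _ "\<lambda>_. 1"]) auto
next
  case (insert r I)
  show ?case
  proof (cases "\<forall>j\<in>J. M r j = 0")
    case True
    have "\<exists>c. (\<forall>j. c j \<in> L) \<and> (\<exists>j\<in>J. c j \<noteq> 0) \<and> (\<forall>i\<in>I. (\<Sum>j\<in>J. M i j * c j) = 0)"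
      using insert.prems insert.hyps by (intro insert.IH) auto
    then show ?thesis using True by auto
  next
    case False
    then obtain j0 where j0: "j0 \<in> J" "M r j0 \<noteq> 0" by blast
    define J' where "J' = J - {j0}"
    \<comment> \<open>Equation \<open>r\<close> with pivot \<open>j0\<close> is used to remove the
      unknown \<open>j0\<close> from the others; its value \<open>e\<close> is recovered at the
      end.\<close>
    define M' where "M' i j = M i j - M i j0 * M r j / M r j0" for i j
    have sumJ: "sum h J = h j0 + sum h J'" for h :: "_ \<Rightarrow> 'k"
      using j0(1) insert.prems(1) by (simp add: J'_def sum.remove)
    have "\<exists>c. (\<forall>j. c j \<in> L) \<and> (\<exists>j\<in>J'. c j \<noteq> 0) \<and> (\<forall>i\<in>I. (\<Sum>j\<in>J'. M' i j * c j) = 0)"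
    proof (rule insert.IH)
      show "finite J'" "card I < card J'"
        using insert.prems insert.hyps j0(1) by (auto simp: J'_def)
      show "M' i j \<in> L" if "i \<in> I" "j \<in> J'" for i j
        using that insert.prems(3) j0(1) by (auto simp: M'_def J'_def intro!: diff_closed divide_closed mult_closed)
    qed
    then obtain c where c: "\<And>j. c j \<in> L" "\<exists>j\<in>J'. c j \<noteq> 0" "\<And>i. i \<in> I \<Longrightarrow> (\<Sum>j\<in>J'. M' i j * c j) = 0"
      by blast
    define e where "e = - (\<Sum>j\<in>J'. M r j * c j) / M r j0"
    define c' where "c' = c(j0 := e)"
    have sumc': "(\<Sum>j\<in>J. M i j * c' j) = M i j0 * e + (\<Sum>j\<in>J'. M i j * c j)" for i
      unfolding sumJ by (auto simp: c'_def J'_def intro!: sum.cong)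
    have e: "e \<in> L"
      unfolding e_def using insert.prems(3) j0(1) c(1)
      by (intro divide_closed uminus_closed sum_closed mult_closed) (auto simp: J'_def)
    have "(\<Sum>j\<in>J. M i j * c' j) = 0" if i: "i \<in> insert r I" for i
    proof (cases "i = r")
      case True
      then show ?thesis unfolding sumc' using j0(2) by (simp add: e_def)
    next
      case False
      have "M i j0 * e = - (\<Sum>j\<in>J'. M i j0 * M r j / M r j0 * c j)"
        by (simp add: e_def sum_distrib_left sum_divide_distrib mult_ac)
      then have "(\<Sum>j\<in>J. M i j * c' j) = (\<Sum>j\<in>J'. M' i j * c j)"
        unfolding sumc' M'_def by (simp add: left_diff_distrib sum_subtractf)
      then show ?thesis using c(3) i False by simp
    qed
    moreover have "\<exists>j\<in>J. c' j \<noteq> 0"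
      using c(2) by (auto simp: J'_def c'_def)
    moreover have "\<forall>j. c' j \<in> L" using c(1) e by (simp add: c'_def)
    ultimately show ?thesis by blast
  qed
qed

definition lspan :: "'k set \<Rightarrow> 'k set" where
  "lspan B = {x. \<exists>c. (\<forall>b. c b \<in> L) \<and> x = (\<Sum>b\<in>B. c b * b)}"

lemma lspan_E:
  assumes "x \<in> lspan B"
  obtains c where "\<And>b. c b \<in> L" "x = (\<Sum>b\<in>B. c b * b)"
  using assms unfolding lspan_def by blast

lemma lspan_zero: "0 \<in> lspan B"
  unfolding lspan_def using zero_closed by (auto intro!: exI[of _ "\<lambda>_. 0"])

lemma lspan_scale:
  assumes "x \<in> lspan B" "a \<in> L"
  shows "a * x \<in> lspan B"
proof -
  obtain c where "\<And>b. c b \<in> L" "x = (\<Sum>b\<in>B. c b * b)" using lspan_E[OF assms(1)] by blast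
  then show ?thesis
    unfolding lspan_def using assms(2)
    by (auto intro!: exI[of _ "\<lambda>b. a * c b"] mult_closed simp: sum_distrib_left mult.assoc)
qed

lemma lspan_add:
  assumes "x \<in> lspan B" "y \<in> lspan B"
  shows "x + y \<in> lspan B"
proof -
  obtain c where "\<And>b. c b \<in> L" "x = (\<Sum>b\<in>B. c b * b)"
    using lspan_E[OF assms(1)] by blast
  moreover obtain e where "\<And>b. e b \<in> L" "y = (\<Sum>b\<in>B. e b * b)"
    using lspan_E[OF assms(2)] by blast
  ultimately show ?thesis
    unfolding lspan_def
    by (auto intro!: exI[of _ "\<lambda>b. c b + e b"] add_closed simp: sum.distrib distrib_right)
qed

lemma lspan_base:
  assumes "finite B" "b \<in> B"
  shows "b \<in> lspan B"
proof -
  have "(\<Sum>b'\<in>B. (if b' = b then 1 else 0) * b') = (\<Sum>b'\<in>B. if b' = b then b' else 0)"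
    by (intro sum.cong) auto
  also have "\<dots> = b" using assms by simp
  finally show ?thesis
    unfolding lspan_def using one_closed zero_closed by (auto intro!: exI[of _ "\<lambda>b'. if b' = b then 1 else 0"])
qed

lemma lspan_sum: "(\<And>i. i \<in> A \<Longrightarrow> h i \<in> lspan B) \<Longrightarrow> sum h A \<in> lspan B"
  by (induction A rule: infinite_finite_induct) (auto intro: lspan_add lspan_zero)

lemma lspan_lincomb:
  "(\<And>i. i \<in> A \<Longrightarrow> a i \<in> L) \<Longrightarrow> (\<And>i. i \<in> A \<Longrightarrow> h i \<in> lspan B) \<Longrightarrow> (\<Sum>i\<in>A. a i * h i) \<in> lspan B"
  by (intro lspan_sum lspan_scale)

lemma lspan_uminus: "x \<in> lspan B \<Longrightarrow> - x \<in> lspan B"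
  using lspan_scale[of x B "- 1"] uminus_closed[OF one_closed] by simp

text \<open>The vectors are indexed by \<open>J\<close>, so repetitions are allowed; this matters
  for powers of an element, which may coincide.\<close>

lemma dependent:
  assumes "finite B" "finite J" "card B < card J" "\<And>j. j \<in> J \<Longrightarrow> a j \<in> lspan B"
  shows "\<exists>c. (\<forall>j. c j \<in> L) \<and> (\<exists>j\<in>J. c j \<noteq> 0) \<and> (\<Sum>j\<in>J. c j * a j) = 0"
proof -
  have "\<forall>j\<in>J. \<exists>m. (\<forall>b. m b \<in> L) \<and> a j = (\<Sum>b\<in>B. m b * b)"
    using assms(4) by (auto simp: lspan_def)
  then obtain M where M: "\<And>j b. j \<in> J \<Longrightarrow> M j b \<in> L" "\<And>j. j \<in> J \<Longrightarrow> a j = (\<Sum>b\<in>B. M j b * b)"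
    by metis
  obtain c where c: "\<forall>j. c j \<in> L" "\<exists>j\<in>J. c j \<noteq> 0" "\<forall>b\<in>B. (\<Sum>j\<in>J. M j b * c j) = 0"
    using homogeneous_solution[OF assms(1-3), of "\<lambda>b j. M j b"] M(1) by blast
  have "(\<Sum>j\<in>J. c j * a j) = (\<Sum>j\<in>J. \<Sum>b\<in>B. b * (M j b * c j))"
    by (intro sum.cong refl) (simp add: M(2) sum_distrib_left mult_ac)
  also have "\<dots> = (\<Sum>b\<in>B. b * (\<Sum>j\<in>J. M j b * c j))"
    by (subst sum.swap) (simp add: sum_distrib_left)
  also have "\<dots> = 0" using c(3) by simp
  finally show ?thesis using c by blast
qed

text \<open>Inverses come from a linear dependence between powers.\<close>
lemma adjoin_algebraic:
  assumes \<eta>: "\<And>i. \<eta> i \<in> L" "\<exists>i\<le>m. \<eta> i \<noteq> 0" "(\<Sum>i\<le>m. \<eta> i * z ^ i) = 0"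
  shows "\<exists>B. finite B \<and> is_subfield (lspan B) \<and> z \<in> lspan B"
proof -
  \<comment> \<open>The effective degree of the relation, which expresses \<open>z ^ r\<close> by
    lower powers.\<close>
  define r where "r = Max {i. i \<le> m \<and> \<eta> i \<noteq> 0}"
  have fin: "finite {i. i \<le> m \<and> \<eta> i \<noteq> 0}" by simp
  have r: "r \<le> m" "\<eta> r \<noteq> 0" using Max_in[OF fin] \<eta>(2) by (auto simp: r_def)
  have r_max: "\<eta> i = 0" if "i \<le> m" "r < i" for i
    by (rule ccontr) (use Max_ge[OF fin, of i] that in \<open>simp flip: r_def\<close>)
  define B where "B = (\<lambda>i. z ^ i) ` {..<r}"
  have B: "finite B" by (simp add: B_def)
  have "(\<Sum>i\<le>m. \<eta> i * z ^ i) = (\<Sum>i\<in>insert r {..<r}. \<eta> i * z ^ i)"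
    using r(1) r_max by (intro sum.mono_neutral_right) (auto simp: not_less_iff_gr_or_eq)
  then have "z ^ r = (\<Sum>i<r. (- \<eta> i / \<eta> r) * z ^ i)"
    using \<eta>(3) r(2) by (simp add: sum_divide_distrib[symmetric] sum_negf field_simps eq_neg_iff_add_eq_0)
  moreover have "(\<Sum>i<r. (- \<eta> i / \<eta> r) * z ^ i) \<in> lspan B"
    by (intro lspan_lincomb lspan_base[OF B] divide_closed uminus_closed \<eta>(1)) (auto simp: B_def)
  ultimately have zr: "z ^ r \<in> lspan B" by simp
  have zmult: "z * x \<in> lspan B" if "x \<in> lspan B" for x
  proof -
    obtain c where c: "\<And>b. c b \<in> L" "x = (\<Sum>b\<in>B. c b * b)"
      using lspan_E[OF \<open>x \<in> lspan B\<close>] by blast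
    have "z * b \<in> lspan B" if "b \<in> B" for b
    proof -
      obtain i where "i < r" "b = z ^ i" using \<open>b \<in> B\<close> by (auto simp: B_def)
      have "z ^ Suc i \<in> lspan B"
      proof (cases "Suc i = r")
        case False
        then have "z ^ Suc i \<in> B"
          using \<open>i < r\<close> by (auto simp: B_def simp del: power_Suc)
        then show ?thesis by (rule lspan_base[OF B])
      qed (use zr in simp)
      then show ?thesis using \<open>b = z ^ i\<close> by simp
    qed
    then have "(\<Sum>b\<in>B. c b * (z * b)) \<in> lspan B"
      using c(1) by (intro lspan_lincomb)
    then show ?thesis by (simp add: c(2) sum_distrib_left mult_ac)
  qed
  have one: "1 \<in> lspan B"
  proof (cases "r = 0")
    case False
    then have "z ^ 0 \<in> B" unfolding B_def by blast
    then show ?thesis using lspan_base[OF B] by simp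
  qed (use zr in simp)
  have powmult: "z ^ i * x \<in> lspan B" if "x \<in> lspan B" for i x
    by (induction i) (use that zmult in \<open>auto simp: mult.assoc\<close>)
  have mult: "x * y \<in> lspan B" if "x \<in> lspan B" "y \<in> lspan B" for x y
  proof -
    obtain c where c: "\<And>b. c b \<in> L" "x = (\<Sum>b\<in>B. c b * b)"
      using lspan_E[OF \<open>x \<in> lspan B\<close>] by blast
    have "(\<Sum>b\<in>B. c b * (b * y)) \<in> lspan B"
      using c(1) powmult[OF that(2)] by (intro lspan_lincomb) (auto simp: B_def)
    then show ?thesis by (simp add: c(2) sum_distrib_right mult.assoc)
  qed
  have pow: "y ^ i \<in> lspan B" if "y \<in> lspan B" for y i
    by (induction i) (use that one mult in auto)
  have inv: "inverse y \<in> lspan B" if y: "y \<in> lspan B" for y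
  proof (cases "y = 0")
    case True
    then show ?thesis using lspan_zero by simp
  next
    case False
    have "card B < card {..card B}" by simp
    then have "\<exists>c. (\<forall>i. c i \<in> L) \<and> (\<exists>i\<in>{..card B}. c i \<noteq> 0) \<and> (\<Sum>i\<le>card B. c i * y ^ i) = 0"
      by (intro dependent[OF B finite_atMost] pow[OF y])
    then obtain c where c: "\<forall>i. c i \<in> L" "\<exists>i\<in>{..card B}. c i \<noteq> 0" "(\<Sum>i\<le>card B. c i * y ^ i) = 0"
      by (elim exE conjE)
    \<comment> \<open>Cancelling the lowest occurring power \<open>y ^ l\<close> leaves a relation
      with nonzero constant term, which can be solved for \<open>inverse y\<close>.\<close>
    define l where "l = (LEAST i. c i \<noteq> 0)"
    have l: "c l \<noteq> 0" unfolding l_def using c(2) by (intro LeastI_ex[of "\<lambda>i. c i \<noteq> 0"]) blast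
    have l_min: "c i = 0" if "i < l" for i using not_less_Least that unfolding l_def by blast
    obtain i1 where "i1 \<le> card B" "c i1 \<noteq> 0" using c(2) by blast
    then have lN: "l \<le> card B" using l_min[of i1] by linarith
    have "(\<Sum>i\<le>card B. c i * y ^ i) = (\<Sum>i\<in>insert l {l<..card B}. c i * y ^ i)"
      using lN l_min by (intro sum.mono_neutral_right) auto
    also have "\<dots> = c l * y ^ l + (\<Sum>i\<in>{l<..card B}. c i * y ^ (i - Suc l) * y ^ Suc l)"
    proof -
      have "y ^ i = y ^ (i - Suc l) * y ^ Suc l" if "i \<in> {l<..card B}" for i
        using that by (simp flip: power_add power_Suc)
      then have "c i * y ^ i = c i * y ^ (i - Suc l) * y ^ Suc l" if "i \<in> {l<..card B}" for i
        using that by (metis mult.assoc)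
      then have "(\<Sum>i\<in>{l<..card B}. c i * y ^ i) = (\<Sum>i\<in>{l<..card B}. c i * y ^ (i - Suc l) * y ^ Suc l)"
        by (rule sum.cong[OF refl])
      then show ?thesis by (simp del: power_Suc)
    qed
    finally have "y ^ l * (c l + y * (\<Sum>i\<in>{l<..card B}. c i * y ^ (i - Suc l))) = 0"
      using c(3) by (simp add: sum_distrib_left algebra_simps)
    then have "c l + y * (\<Sum>i\<in>{l<..card B}. c i * y ^ (i - Suc l)) = 0"
      using False by simp
    then have "inverse y = - (1 / c l) * (\<Sum>i\<in>{l<..card B}. c i * y ^ (i - Suc l))"
      using False l by (simp add: field_simps eq_neg_iff_add_eq_0)
    moreover have "- (1 / c l) * (\<Sum>i\<in>{l<..card B}. c i * y ^ (i - Suc l)) \<in> lspan B"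
      using c(1) pow[OF y] by (intro lspan_scale lspan_lincomb uminus_closed divide_closed one_closed) auto
    ultimately show ?thesis by simp
  qed
  have "is_subfield (lspan B)"
    unfolding is_subfield_def is_subring_def using one mult inv lspan_add[OF _ lspan_uminus] by fastforce
  then show ?thesis using B zmult[OF one] by auto
qed

end

section \<open>The rational function field and change of its generator\<close>

lemma is_subfield_Fpt: "is_subfield (Fpt t)"
  unfolding is_subfield_def is_subring_def
proof (intro conjI ballI)
  have Fpt: "Fpt t = {ipoly f t / ipoly g t | f g. ipoly g t \<noteq> 0}"
    by (simp add: Fpt_def ipoly_def)
  \<comment> \<open>Division by zero yields \<open>0\<close>, so membership holds for every
    denominator.\<close>
  have I: "ipoly f t / ipoly g t \<in> Fpt t" for f g
  proof (cases "ipoly g t = 0")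
    case True
    then have "ipoly f t / ipoly g t = ipoly 0 t / ipoly 1 t" "ipoly 1 t \<noteq> 0" by simp_all
    then show ?thesis unfolding Fpt by blast
  qed (auto simp: Fpt)
  show "1 \<in> Fpt t" using I[of 1 1] by simp
  fix x assume "x \<in> Fpt t"
  then obtain f g where x: "ipoly g t \<noteq> 0" "x = ipoly f t / ipoly g t" by (auto simp: Fpt)
  show "inverse x \<in> Fpt t" using I[of g f] x by simp
  fix y assume "y \<in> Fpt t"
  then obtain f' g' where y: "ipoly g' t \<noteq> 0" "y = ipoly f' t / ipoly g' t" by (auto simp: Fpt)
  show "x - y \<in> Fpt t" using I[of "f * g' - f' * g" "g * g'"] x y by (simp add: diff_frac_eq)
  show "x * y \<in> Fpt t" using I[of "f * f'" "g * g'"] x y by simp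
qed

interpretation Fpt: subfield_set "Fpt t" for t
  by unfold_locales (rule is_subfield_Fpt)

lemma Fpt_E:
  assumes "x \<in> Fpt t"
  obtains f g where "ipoly g t \<noteq> 0" "x = ipoly f t / ipoly g t"
  using assms unfolding Fpt_def ipoly_def by blast

lemma ipoly_in_Fpt: "ipoly f t \<in> Fpt t"
  unfolding Fpt_def ipoly_def by (intro CollectI exI[of _ f] exI[of _ 1]) simp

lemma gen_in_Fpt: "t \<in> Fpt t"
  using ipoly_in_Fpt[of "[:0, 1:]" t] by simp

lemma ext_degree_lspan:
  assumes "ext_degree (Fpt t) D"
  obtains B where "finite B" "card B \<le> D" "subfield_set.lspan (Fpt t) B = UNIV"
proof -
  obtain b :: "nat \<Rightarrow> 'a" where b: "\<And>x. \<exists>c. (\<forall>i. i < D \<longrightarrow> c i \<in> Fpt t) \<and> x = (\<Sum>i<D. c i * b i)"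
    using assms unfolding ext_degree_def by metis
  have "x \<in> Fpt.lspan t (b ` {..<D})" for x
  proof -
    obtain c where "\<And>i. i < D \<Longrightarrow> c i \<in> Fpt t" "x = (\<Sum>i<D. c i * b i)" using b[of x] by auto
    then show ?thesis
      by (auto intro!: Fpt.lspan_lincomb intro: Fpt.lspan_base)
  qed
  then show ?thesis
    using that[of "b ` {..<D}"] card_image_le[of "{..<D}" b] by auto
qed

text \<open>A relation between powers of \<open>s\<close> over \<open>Fpt t\<close>, read as a
  polynomial in \<open>t\<close>, shows that \<open>t\<close> is algebraic over
  \<open>Fpt s\<close>; finiteness then passes up the tower.\<close>

lemma lspan_exchange:
  fixes s t :: "'k::field"
  assumes s: "transc_prime s" and B: "finite B" "Fpt.lspan t B = UNIV"
  obtains B' where "finite B'" "Fpt.lspan s B' = UNIV"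
proof -
  define N where "N = card B"
  have "card B < card {..N}" by (simp add: N_def)
  then have "\<exists>c. (\<forall>i. c i \<in> Fpt t) \<and> (\<exists>i\<in>{..N}. c i \<noteq> 0) \<and> (\<Sum>i\<le>N. c i * s ^ i) = 0"
    using B(2) by (intro Fpt.dependent[OF B(1) finite_atMost]) auto
  then obtain \<gamma> where \<gamma>: "\<forall>i. \<gamma> i \<in> Fpt t" "\<exists>i\<in>{..N}. \<gamma> i \<noteq> 0" "(\<Sum>i\<le>N. \<gamma> i * s ^ i) = 0"
    by (elim exE conjE)
  have "\<forall>i. \<exists>f g. ipoly g t \<noteq> 0 \<and> \<gamma> i = ipoly f t / ipoly g t"
    using \<gamma>(1) Fpt_E by metis
  then obtain f g where fg: "\<And>i. ipoly (g i) t \<noteq> 0" "\<And>i. \<gamma> i = ipoly (f i) t / ipoly (g i) t"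
    by metis
  define G where "G = (\<Prod>i\<le>N. ipoly (g i) t)"
  \<comment> \<open>Numerators after multiplication by the common denominator
    \<open>G\<close>.\<close>
  define F where "F i = f i * (\<Prod>j\<in>{..N} - {i}. g j)" for i
  have G: "G \<noteq> 0" using fg(1) by (simp add: G_def)
  have F: "ipoly (F i) t = \<gamma> i * G" if "i \<le> N" for i
  proof -
    have "G = ipoly (g i) t * (\<Prod>j\<in>{..N} - {i}. ipoly (g j) t)"
      unfolding G_def using that by (simp add: prod.remove)
    then show ?thesis using fg(1)[of i] by (simp add: F_def fg(2))
  qed
  have "(\<Sum>i\<le>N. ipoly (F i) t * s ^ i) = G * (\<Sum>i\<le>N. \<gamma> i * s ^ i)"
    unfolding sum_distrib_left by (intro sum.cong refl) (simp add: F mult_ac)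
  then have rel: "(\<Sum>i\<le>N. ipoly (F i) t * s ^ i) = 0" using \<gamma>(3) by simp
  define m where "m = Max ((\<lambda>i. degree (F i)) ` {..N})"
  have deg: "degree (F i) \<le> m" if "i \<le> N" for i
    unfolding m_def using that by (intro Max_ge) auto
  \<comment> \<open>Regroups the relation by powers of \<open>t\<close>, with coefficients
    polynomial in \<open>s\<close>.\<close>
  define h where "h j = (\<Sum>i\<le>N. monom (coeff (F i) j) i)" for j
  have "(\<Sum>i\<le>N. ipoly (F i) t * s ^ i) = (\<Sum>i\<le>N. \<Sum>j\<le>m. of_int (coeff (F i) j) * s ^ i * t ^ j)"
  proof (intro sum.cong refl)
    fix i assume "i \<in> {..N}"
    then have "ipoly (F i) t * s ^ i = (\<Sum>j\<le>m. of_int (coeff (F i) j) * t ^ j * s ^ i)"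
      by (simp add: ipoly_altdef[OF deg] sum_distrib_right)
    then show "ipoly (F i) t * s ^ i = (\<Sum>j\<le>m. of_int (coeff (F i) j) * s ^ i * t ^ j)"
      by (simp add: mult_ac)
  qed
  also have "\<dots> = (\<Sum>j\<le>m. ipoly (h j) s * t ^ j)"
    by (subst sum.swap) (simp add: h_def sum_distrib_right)
  finally have rel': "(\<Sum>j\<le>m. ipoly (h j) s * t ^ j) = 0" using rel by simp
  obtain i0 where i0: "i0 \<le> N" "ipoly (F i0) t \<noteq> 0"
    using \<gamma>(2) F G by auto
  then obtain j0 where j0: "j0 \<le> m" "of_int (coeff (F i0) j0) \<noteq> (0 :: 'k)"
    unfolding ipoly_altdef[OF deg[OF i0(1)]] by (metis (no_types, lifting) atMost_iff mult_zero_left sum.neutral)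
  \<comment> \<open>A coefficient that survives reduction shows, by transcendence of
    \<open>s\<close>, that the regrouped relation is nontrivial.\<close>
  have "coeff (h j0) i0 = coeff (F i0) j0"
    using i0(1) by (simp add: h_def coeff_sum)
  then have "coeff (map_poly of_int (h j0)) i0 \<noteq> (0 :: 'k)"
    using j0(2) by (simp add: coeff_map_poly)
  then have "map_poly of_int (h j0) \<noteq> (0 :: 'k poly)" by auto
  then have "ipoly (h j0) s \<noteq> 0"
    using s unfolding transc_prime_def ipoly_def by blast
  then have "\<exists>Bz. finite Bz \<and> is_subfield (Fpt.lspan s Bz) \<and> t \<in> Fpt.lspan s Bz"
    using j0(1) by (intro Fpt.adjoin_algebraic[OF ipoly_in_Fpt _ rel']) auto
  then obtain Bz where Bz: "finite Bz" "is_subfield (Fpt.lspan s Bz)" "t \<in> Fpt.lspan s Bz"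
    by blast
  have sub: "Fpt t \<subseteq> Fpt.lspan s Bz"
    using subfield_set.Fpt_subset[of "Fpt.lspan s Bz" t] Bz by (simp add: subfield_set_def)
  \<comment> \<open>Products of the two spanning sets, as in the tower law.\<close>
  define B' where "B' = (\<lambda>(e, b). e * b) ` (Bz \<times> B)"
  have B': "finite B'" using Bz(1) B(1) by (simp add: B'_def)
  have "x \<in> Fpt.lspan s B'" for x
  proof -
    have "x \<in> Fpt.lspan t B" using B(2) by simp
    from Fpt.lspan_E[OF this] obtain c where c: "\<And>b. c b \<in> Fpt t" "x = (\<Sum>b\<in>B. c b * b)"
      by blast
    have "c b * b \<in> Fpt.lspan s B'" if b: "b \<in> B" for b
    proof -
      have "c b \<in> Fpt.lspan s Bz" using c(1) sub by blast
      from Fpt.lspan_E[OF this] obtain d where d: "\<And>e. d e \<in> Fpt s" "c b = (\<Sum>e\<in>Bz. d e * e)"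
        by blast
      have "(\<Sum>e\<in>Bz. d e * (e * b)) \<in> Fpt.lspan s B'"
        using b d(1) by (intro Fpt.lspan_lincomb Fpt.lspan_base[OF B']) (auto simp: B'_def)
      then show ?thesis by (simp add: d(2) sum_distrib_right mult.assoc)
    qed
    then show ?thesis unfolding c(2) by (rule Fpt.lspan_sum)
  qed
  then show ?thesis using that[OF B'] by blast
qed

section \<open>Residue fields\<close>

lemma transc_primeD: "transc_prime (t :: 'k::field) \<Longrightarrow> ipoly f t = 0 \<Longrightarrow> map_poly of_int f = (0 :: 'k poly)"
  by (simp add: transc_prime_def ipoly_def)

lemma transc_primeI: "(\<And>f. ipoly f (t :: 'k::field) = 0 \<Longrightarrow> map_poly of_int f = (0 :: 'k poly)) \<Longrightarrow> transc_prime t"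
  by (simp add: transc_prime_def ipoly_def)

lemma transc_prime_inverse:
  fixes x :: "'k::field"
  assumes "transc_prime x"
  shows "transc_prime (inverse x)"
proof (cases "x = 0")
  case False
  show ?thesis
  proof (rule transc_primeI)
    fix f assume f: "ipoly f (inverse x) = 0"
    define n where "n = degree f"
    \<comment> \<open>The reversed polynomial turns a relation for \<open>inverse x\<close> into one
      for \<open>x\<close>.\<close>
    define g where "g = (\<Sum>i\<le>n. monom (coeff f i) (n - i))"
    have "ipoly g x = (\<Sum>i\<le>n. of_int (coeff f i) * x ^ (n - i))"
      by (simp add: g_def)
    also have "\<dots> = (\<Sum>i\<le>n. x ^ n * (of_int (coeff f i) * inverse x ^ i))"
      using False by (intro sum.cong refl) (simp add: power_diff power_inverse field_simps)
    also have "\<dots> = x ^ n * ipoly f (inverse x)"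
      by (simp add: ipoly_altdef[of f n] n_def sum_distrib_left)
    finally have "map_poly of_int g = (0 :: 'k poly)"
      using transc_primeD[OF assms, of g] f by simp
    then have g0: "of_int (coeff g i) = (0 :: 'k)" for i
    proof -
      have "coeff (map_poly of_int g :: 'k poly) i = of_int (coeff g i)"
        by (simp add: coeff_map_poly)
      then show ?thesis using \<open>map_poly of_int g = (0 :: 'k poly)\<close> by simp
    qed
    have "coeff g (n - i) = coeff f i" if "i \<le> n" for i
    proof -
      have "coeff g (n - i) = (\<Sum>j\<le>n. if j = i then coeff f j else 0)"
        unfolding g_def coeff_sum using that by (intro sum.cong refl) (auto simp: coeff_monom)
      then show ?thesis using that by simp
    qed
    then have "of_int (coeff f i) = (0 :: 'k)" for i
      using g0 by (cases "i \<le> n") (auto simp: n_def coeff_eq_0, metis)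
    then show "map_poly of_int f = (0 :: 'k poly)"
      by (intro poly_eqI) (simp add: coeff_map_poly)
  qed
qed (use assms in simp)

lemma map_poly_of_int_add: "map_poly of_int (f + g) = (map_poly of_int f + map_poly of_int g :: 'k::field poly)"
  by (rule poly_eqI) (simp add: coeff_map_poly)

lemma map_poly_of_int_uminus: "map_poly of_int (- f) = (- map_poly of_int f :: 'k::field poly)"
  by (rule poly_eqI) (simp add: coeff_map_poly)

lemma map_poly_of_int_mult: "map_poly of_int (f * g) = (map_poly of_int f * map_poly of_int g :: 'k::field poly)"
  by (rule poly_eqI) (simp add: coeff_map_poly coeff_mult)

text \<open>The substitution of \<open>1 - X\<close> is injective on polynomials, so a relation for
  \<open>u\<close> gives one for \<open>1 - u\<close>.\<close>

lemma transc_prime_one_minus: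
  fixes u :: "'k::field"
  assumes "transc_prime (1 - u)"
  shows "transc_prime u"
proof (rule transc_primeI)
  fix f assume f: "ipoly f u = 0"
  have "ipoly (pcompose f [:1, - 1:]) (1 - u) = ipoly f u"
    by (induction f) (simp_all add: pcompose_pCons algebra_simps)
  then have "map_poly of_int (pcompose f [:1, - 1:]) = (0 :: 'k poly)"
    using transc_primeD[OF assms] f by simp
  moreover have "map_poly of_int (pcompose f [:1, - 1:]) = pcompose (map_poly of_int f) ([:1, - 1:] :: 'k poly)"
    by (induction f) (simp_all add: pcompose_pCons map_poly_of_int_add map_poly_of_int_uminus map_poly_of_int_mult map_poly_pCons)
  ultimately show "map_poly of_int f = (0 :: 'k poly)"
    using pcompose_eq_0[of "map_poly of_int f" "[:1, - 1:] :: 'k poly"] by simp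
qed

lemma of_int_mod_CHAR: "of_int (c mod int CHAR('k::field)) = (of_int c :: 'k::field)"
proof -
  have "(of_int c :: 'k) = of_int (int CHAR('k) * (c div int CHAR('k)) + c mod int CHAR('k))"
    by simp
  also have "\<dots> = of_int (c mod int CHAR('k))"
    unfolding of_int_add of_int_mult by simp
  finally show ?thesis by simp
qed

section \<open>Values and residues at a place where \<open>t\<close> has positive value\<close>

context discrete_valuation
begin

lemma ipoly_integral: "vge v 0 t \<Longrightarrow> vge v 0 (ipoly f t)"
  by (induction f) (auto intro: vge_add vge_of_int vge_mult_left)

text \<open>The element and its inverse are both images of integers, so both values are nonnegative,
  and they sum to \<open>0\<close>.\<close>

lemma v_of_int:
  assumes "prime CHAR('k)" "of_int c \<noteq> (0 :: 'k)"
  shows "v (of_int c) = 0"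
proof -
  obtain d where d: "of_int c * of_int d = (1 :: 'k)"
    using of_int_inverse[OF assms] by blast
  then have "v (of_int c) + v (of_int d) = 0"
    using v_mult[of "of_int c" "of_int d"] by fastforce
  moreover have "0 \<le> v (of_int c)" "0 \<le> v (of_int d)"
    using vge_of_int[of c] vge_of_int[of d] d by (auto simp: vge_def)
  ultimately show ?thesis by simp
qed

lemma v_one_plus_small:
  assumes "prime CHAR('k)" "of_int c \<noteq> (0 :: 'k)" "vge v 1 y"
  shows "of_int c + y \<noteq> 0 \<and> v (of_int c + y) = 0"
proof (rule unitI)
  show "vge v 0 (of_int c + y)"
    using vge_mono[OF assms(3), of 0] by (intro vge_add vge_of_int) simp
  show "\<not> vge v 1 (of_int c + y)"
  proof
    assume "vge v 1 (of_int c + y)"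
    from vge_diff[OF this assms(3)] have "vge v 1 (of_int c)" by simp
    then show False using assms(2) v_of_int[OF assms(1,2)] by (simp add: vge_def)
  qed
qed

text \<open>The lowest surviving term has strictly smallest value, so a polynomial expression in
  \<open>x\<close> cannot vanish.\<close>

lemma transc_prime_of_pos:
  assumes "prime CHAR('k)" "0 < v x"
  shows "transc_prime x"
proof (rule transc_primeI, rule ccontr)
  fix f assume f: "ipoly f x = 0" "map_poly of_int f \<noteq> (0 :: 'k poly)"
  have x: "x \<noteq> 0" "vge v 1 x" "vge v 0 x" using assms(2) by (auto simp: vge_def)
  obtain a c h where c: "of_int c \<noteq> (0 :: 'k)" "ipoly f x = x ^ a * (of_int c + x * ipoly h x)"
    using ipoly_lowest[OF f(2), of x] by (elim exE conjE)
  have "of_int c + x * ipoly h x \<noteq> 0"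
    using v_one_plus_small[OF assms(1) c(1), of "x * ipoly h x"] x ipoly_integral vge_mult_right by blast
  with c(2) f(1) x(1) show False by simp
qed

lemma transc_prime_of_nonzero:
  assumes "prime CHAR('k)" "v x \<noteq> 0"
  shows "transc_prime x"
proof (cases "0 < v x")
  case False
  then have "transc_prime (inverse x)"
    using assms by (intro transc_prime_of_pos) auto
  then show ?thesis using transc_prime_inverse[of "inverse x"] by simp
qed (use assms transc_prime_of_pos in blast)

text \<open>After the lowest terms are split off, \<open>\<rho>\<close> is a power of
  \<open>t\<close> times a quotient of units; integrality makes the exponent nonnegative, so the
  residue lies in the prime field.\<close>

lemma Fpt_residue:
  assumes p: "prime CHAR('k)" and t: "0 < v t" and r: "\<rho> \<in> Fpt t" "vge v 0 \<rho>"
  shows "\<exists>c. vge v 1 (\<rho> - of_int c)"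
proof (cases "\<rho> = 0")
  case True
  then show ?thesis by (intro exI[of _ 0]) simp
next
  case False
  obtain f g where fg: "ipoly g t \<noteq> 0" "\<rho> = ipoly f t / ipoly g t"
    using Fpt_E[OF r(1)] by blast
  have t': "t \<noteq> 0" "vge v 1 t" "vge v 0 t" using t by (auto simp: vge_def)
  have f0: "ipoly f t \<noteq> 0" using False fg by auto
  obtain a c h where c: "of_int c \<noteq> (0 :: 'k)" "ipoly f t = t ^ a * (of_int c + t * ipoly h t)"
    using ipoly_lowest[OF ipoly_nonzero[OF f0], of t] by (elim exE conjE)
  obtain b d k where d: "of_int d \<noteq> (0 :: 'k)" "ipoly g t = t ^ b * (of_int d + t * ipoly k t)"
    using ipoly_lowest[OF ipoly_nonzero[OF fg(1)], of t] by (elim exE conjE)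
  define A where "A = of_int c + t * ipoly h t"
  define B where "B = of_int d + t * ipoly k t"
  have small: "vge v 1 (t * ipoly h t)" "vge v 1 (t * ipoly k t)"
    using t' ipoly_integral by (auto intro: vge_mult_right)
  have A: "A \<noteq> 0" "v A = 0" and B: "B \<noteq> 0" "v B = 0"
    using v_one_plus_small[OF p c(1) small(1)] v_one_plus_small[OF p d(1) small(2)]
    by (simp_all add: A_def B_def)
  have rho: "\<rho> = t ^ a * A / (t ^ b * B)"
    using fg(2) c(2) d(2) by (simp add: A_def B_def)
  then have "v \<rho> = int a * v t - int b * v t"
    using A B t'(1) by (simp add: v_divide v_mult v_power)
  then have "0 \<le> (int a - int b) * v t"
    using r(2) False by (simp add: vge_def left_diff_distrib)
  then have ab: "b \<le> a" using t by (simp add: zero_le_mult_iff)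
  have rho': "\<rho> = t ^ (a - b) * (A / B)"
    using rho t'(1) ab by (simp add: power_diff)
  \<comment> \<open>For \<open>a = b\<close> the residue is \<open>c / d\<close>, represented by
    \<open>c * e\<close>; for \<open>b < a\<close> it is \<open>0\<close>.\<close>
  obtain e where e: "of_int d * of_int e = (1 :: 'k)"
    using of_int_inverse[OF p d(1)] by blast
  show ?thesis
  proof (cases "a = b")
    case True
    have "\<rho> - of_int (c * e) = (A - of_int (c * e) * B) / B"
      using rho' True B(1) by (simp add: field_simps)
    also have "A - of_int (c * e) * B = t * ipoly h t - of_int (c * e) * (t * ipoly k t)"
    proof -
      have "of_int (c * e) * of_int d = (of_int c :: 'k)"
        using e by (simp add: mult_ac)
      then show ?thesis by (simp add: A_def B_def distrib_left mult.assoc)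
    qed
    finally have eq: "\<rho> - of_int (c * e) = inverse B * (t * ipoly h t - of_int (c * e) * (t * ipoly k t))"
      by (simp add: divide_inverse mult.commute)
    have "vge v 1 (\<rho> - of_int (c * e))"
      unfolding eq
    proof (rule vge_mult_left)
      show "vge v 0 (inverse B)" using B by (simp add: vge_def)
    qed (rule vge_diff[OF small(1) vge_mult_left[OF vge_of_int small(2)]])
    then show ?thesis by blast
  next
    case False
    then have "a - b = Suc (a - b - 1)" using ab by simp
    then have "t ^ (a - b) = t * t ^ (a - b - 1)" by (metis power_Suc)
    then have "\<rho> = t * (t ^ (a - b - 1) * (A / B))" using rho' by (simp add: mult.assoc)
    moreover have "vge v 0 (A / B)" using A B by (simp add: vge_def v_divide)
    then have "vge v 1 (t * (t ^ (a - b - 1) * (A / B)))"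
      using t' by (intro vge_mult_right[OF _ vge_mult_left] vge_power)
    ultimately show ?thesis by (intro exI[of _ 0]) simp
  qed
qed

text \<open>A linear relation over \<open>Fpt t\<close> is scaled so that it survives reduction; its
  coefficients then have residues in the prime field.\<close>

lemma residue_dependent:
  assumes p: "prime CHAR('k)" and t: "0 < v t" and B: "finite B" "Fpt.lspan t B = UNIV"
    and S: "finite S" "card B < card S" "\<And>s. s \<in> S \<Longrightarrow> vge v 0 s"
  shows "\<exists>c :: 'k \<Rightarrow> int. (\<exists>s\<in>S. of_int (c s) \<noteq> (0 :: 'k)) \<and> vge v 1 (\<Sum>s\<in>S. of_int (c s) * s)"
proof -
  have "\<exists>c. (\<forall>j. c j \<in> Fpt t) \<and> (\<exists>s\<in>S. c s \<noteq> 0) \<and> (\<Sum>s\<in>S. c s * s) = 0"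
    using B(2) by (intro Fpt.dependent[OF B(1) S(1,2)]) auto
  then obtain \<gamma> where g: "\<And>s. \<gamma> s \<in> Fpt t" "\<exists>s\<in>S. \<gamma> s \<noteq> 0" "(\<Sum>s\<in>S. \<gamma> s * s) = 0"
    by blast
  define N where "N = {s \<in> S. \<gamma> s \<noteq> 0}"
  have N: "finite N" "N \<noteq> {}" using S(1) g(2) by (auto simp: N_def)
  \<comment> \<open>Dividing by a coefficient of least value makes all coefficients integral and
    this one equal to \<open>1\<close>.\<close>
  define s0 where "s0 = arg_min_on (\<lambda>s. v (\<gamma> s)) N"
  have s0: "s0 \<in> N" "\<And>s. s \<in> N \<Longrightarrow> v (\<gamma> s0) \<le> v (\<gamma> s)"
    using arg_min_if_finite[OF N, of "\<lambda>s. v (\<gamma> s)"] unfolding s0_def by (auto simp: not_less)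
  have s0': "s0 \<in> S" "\<gamma> s0 \<noteq> 0" using s0(1) by (auto simp: N_def)
  define \<rho> where "\<rho> s = \<gamma> s / \<gamma> s0" for s
  have "vge v 0 (\<rho> s)" if "s \<in> S" for s
    using s0(2)[of s] s0'(2) that by (cases "\<gamma> s = 0") (auto simp: \<rho>_def vge_def v_divide N_def)
  moreover have "\<rho> s \<in> Fpt t" for s
    unfolding \<rho>_def by (intro Fpt.divide_closed g(1))
  ultimately have "\<forall>s\<in>S. \<exists>c. vge v 1 (\<rho> s - of_int c)"
    using Fpt_residue[OF p t] by blast
  then obtain c where c: "\<And>s. s \<in> S \<Longrightarrow> vge v 1 (\<rho> s - of_int (c s))" by metis
  have "(\<Sum>s\<in>S. \<rho> s * s) = (\<Sum>s\<in>S. \<gamma> s * s) / \<gamma> s0"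
    by (simp add: \<rho>_def sum_divide_distrib)
  then have "(\<Sum>s\<in>S. \<rho> s * s) = 0" using g(3) by simp
  then have "(\<Sum>s\<in>S. of_int (c s) * s) = - (\<Sum>s\<in>S. (\<rho> s - of_int (c s)) * s)"
    by (simp add: left_diff_distrib sum_subtractf)
  moreover have "vge v 1 (\<Sum>s\<in>S. (\<rho> s - of_int (c s)) * s)"
    using c S(3) by (intro vge_sum vge_mult_right)
  ultimately have "vge v 1 (\<Sum>s\<in>S. of_int (c s) * s)" by simp
  moreover have "of_int (c s0) \<noteq> (0 :: 'k)"
    using c[OF s0'(1)] s0'(2) by (auto simp: \<rho>_def)
  ultimately show ?thesis using s0'(1) by (intro exI[of _ c] conjI bexI[of _ s0])
qed

text \<open>Residues independent over the prime field number at most \<open>card B\<close>; a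
  largest such family spans the residue field.\<close>

lemma residue_field_bound:
  assumes p: "prime CHAR('k)" and t: "0 < v t" and B: "finite B" "Fpt.lspan t B = UNIV"
  shows "finite (val_ring v // {(x, y). x \<in> val_ring v \<and> y \<in> val_ring v \<and> x - y \<in> max_ideal v})"
    and "residue_card v \<le> CHAR('k) ^ card B"
proof -
  define r where "r = {(x, y). x \<in> val_ring v \<and> y \<in> val_ring v \<and> x - y \<in> max_ideal v}"
  define indep where "indep S \<longleftrightarrow> finite S \<and> (\<forall>s\<in>S. vge v 0 s) \<and>
    (\<forall>c :: 'k \<Rightarrow> int. vge v 1 (\<Sum>s\<in>S. of_int (c s) * s) \<longrightarrow> (\<forall>s\<in>S. of_int (c s) = (0 :: 'k)))" for S
  have card_indep: "card S \<le> card B" if "indep S" for S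
    using residue_dependent[OF p t B, of S] that by (auto simp: indep_def not_less[symmetric])
  \<comment> \<open>Independent sets have bounded size, so one of maximal size exists.\<close>
  have "indep {}" by (simp add: indep_def)
  then have "\<exists>S. indep S \<and> (\<forall>S'. indep S' \<longrightarrow> card S' \<le> card S)"
    using card_indep ex_has_greatest_nat[of indep "{}" card "Suc (card B)"] by (meson less_Suc_eq_le)
  then obtain S where S: "indep S" "\<And>S'. indep S' \<Longrightarrow> card S' \<le> card S" by blast
  have fin: "finite S" and int: "\<And>s. s \<in> S \<Longrightarrow> vge v 0 s" using S(1) by (auto simp: indep_def)
  have rep: "\<exists>c :: 'k \<Rightarrow> int. vge v 1 (x - (\<Sum>s\<in>S. of_int (c s) * s))" if x: "vge v 0 x" for x
  proof (cases "x \<in> S")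
    case True
    have "(\<Sum>s\<in>S. of_int (if s = x then 1 else 0) * s) = (\<Sum>s\<in>S. if s = x then s else 0)"
      by (intro sum.cong) auto
    then show ?thesis using True fin by (intro exI[of _ "\<lambda>s. if s = x then 1 else 0"]) simp
  next
    case False
    then have "\<not> indep (insert x S)" using S(2)[of "insert x S"] fin by auto
    moreover have "indep (insert x S)"
      if "\<forall>c :: 'k \<Rightarrow> int. vge v 1 (\<Sum>s\<in>insert x S. of_int (c s) * s) \<longrightarrow>
        (\<forall>s\<in>insert x S. of_int (c s) = (0 :: 'k))"
      unfolding indep_def
    proof (intro conjI)
      show "finite (insert x S)" "\<forall>s\<in>insert x S. vge v 0 s" using fin int x by auto
    qed (rule that)
    ultimately have "\<exists>c :: 'k \<Rightarrow> int. vge v 1 (\<Sum>s\<in>insert x S. of_int (c s) * s) \<and>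
      \<not> (\<forall>s\<in>insert x S. of_int (c s) = (0 :: 'k))"
      by (metis (mono_tags))
    then obtain c :: "'k \<Rightarrow> int" where c: "vge v 1 (\<Sum>s\<in>insert x S. of_int (c s) * s)"
      "\<not> (\<forall>s\<in>insert x S. of_int (c s) = (0 :: 'k))"
      by (elim exE conjE)
    have sum: "(\<Sum>s\<in>insert x S. of_int (c s) * s) = of_int (c x) * x + (\<Sum>s\<in>S. of_int (c s) * s)"
      using False fin by simp
    have cx: "of_int (c x) \<noteq> (0 :: 'k)"
    proof
      assume 0: "of_int (c x) = (0 :: 'k)"
      then have "vge v 1 (\<Sum>s\<in>S. of_int (c s) * s)" using c(1) sum by simp
      then have "\<forall>s\<in>S. of_int (c s) = (0 :: 'k)" using S(1) by (auto simp: indep_def)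
      then show False using 0 c(2) by auto
    qed
    obtain d where d: "of_int (c x) * of_int d = (1 :: 'k)"
      using of_int_inverse[OF p cx] by blast
    have "x - (\<Sum>s\<in>S. of_int (- d * c s) * s) = of_int d * (\<Sum>s\<in>insert x S. of_int (c s) * s)"
      using d unfolding sum distrib_left sum_distrib_left
      by (simp add: sum_negf mult.assoc[symmetric] mult.commute[of "of_int d"])
    moreover have "vge v 1 (of_int d * (\<Sum>s\<in>insert x S. of_int (c s) * s))"
      using c(1) by (intro vge_mult_left vge_of_int)
    ultimately show ?thesis by (intro exI[of _ "\<lambda>s. - d * c s"]) simp
  qed
  \<comment> \<open>Coefficients count only modulo the characteristic; extensional functions make
    the vectors of reduced coefficients a finite set.\<close>
  define P where "P = S \<rightarrow>\<^sub>E {0..<int CHAR('k)}"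
  define cls where "cls c = r `` {\<Sum>s\<in>S. of_int (c s) * s}" for c :: "'k \<Rightarrow> int"
  have p0: "0 < CHAR('k)" using p prime_gt_0_nat by blast
  have "val_ring v // r \<subseteq> cls ` P"
  proof
    fix X assume "X \<in> val_ring v // r"
    then obtain x where x: "vge v 0 x" "X = r `` {x}" by (auto simp: quotient_def val_ring_iff)
    obtain c :: "'k \<Rightarrow> int" where c: "vge v 1 (x - (\<Sum>s\<in>S. of_int (c s) * s))" using rep[OF x(1)] by blast
    define c' where "c' = restrict (\<lambda>s. c s mod int CHAR('k)) S"
    define y where "y = (\<Sum>s\<in>S. of_int (c' s) * s)"
    have "y = (\<Sum>s\<in>S. of_int (c s) * s)"
      unfolding y_def c'_def by (intro sum.cong) (auto simp: of_int_mod_CHAR)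
    then have xy: "vge v 1 (x - y)" using c by simp
    have y: "vge v 0 y" unfolding y_def by (intro vge_sum vge_mult_left vge_of_int int)
    have "vge v 1 (x - z) \<longleftrightarrow> vge v 1 (y - z)" for z
      using vge_diff[of 1 "x - z" "x - y"] vge_add[of 1 "x - y" "y - z"] xy by auto
    then have "r `` {x} = r `` {y}"
      using x(1) y by (auto simp: r_def val_ring_iff max_ideal_iff)
    then have "X = cls c'" using x(2) by (simp add: cls_def y_def)
    moreover have "c' \<in> P" using p0 by (auto simp: P_def c'_def)
    ultimately show "X \<in> cls ` P" by blast
  qed
  moreover have finP: "finite P" unfolding P_def using fin by (intro finite_PiE) auto
  moreover have "card P = CHAR('k) ^ card S" unfolding P_def using fin by (simp add: card_PiE)
  ultimately have "finite (val_ring v // r)" "card (val_ring v // r) \<le> CHAR('k) ^ card S"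
    using finite_subset[of "val_ring v // r" "cls ` P"] card_mono[of "cls ` P" "val_ring v // r"]
      card_image_le[OF finP, of cls] by auto
  moreover have "CHAR('k) ^ card S \<le> CHAR('k) ^ card B"
    using card_indep[OF S(1)] p0 by (intro power_increasing) auto
  ultimately show "finite (val_ring v // {(x, y). x \<in> val_ring v \<and> y \<in> val_ring v \<and> x - y \<in> max_ideal v})"
    and "residue_card v \<le> CHAR('k) ^ card B"
    unfolding residue_card_def r_def by auto
qed

end

section \<open>Existence of places\<close>

locale valuation_subring = subring_set A for A :: "'k::field set" +
  assumes total: "y \<in> A \<or> inverse y \<in> A"
begin

definition unit :: "'k \<Rightarrow> bool" where
  "unit y \<longleftrightarrow> y \<noteq> 0 \<and> y \<in> A \<and> inverse y \<in> A"

definition M :: "'k set" where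
  "M = {y \<in> A. \<not> unit y}"

lemma unit_1: "unit 1" by (simp add: unit_def one_closed)

lemma unit_mult: "unit y \<Longrightarrow> unit z \<Longrightarrow> unit (y * z)"
  by (simp add: unit_def mult_closed)

lemma unit_inverse: "unit y \<Longrightarrow> unit (inverse y)"
  by (simp add: unit_def)

lemma unit_divide: "unit y \<Longrightarrow> unit z \<Longrightarrow> unit (y / z)"
  by (simp add: divide_inverse unit_mult unit_inverse)

lemma M_zero: "0 \<in> M" by (simp add: M_def unit_def zero_closed)

lemma M_mult:
  assumes "y \<in> M" "a \<in> A"
  shows "a * y \<in> M"
proof -
  have "\<not> unit (a * y)"
  proof
    assume u: "unit (a * y)"
    then have "a * inverse (a * y) = inverse y" by (auto simp: unit_def field_simps)
    moreover have "a * inverse (a * y) \<in> A" using u assms(2) unfolding unit_def by (blast intro: mult_closed)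
    ultimately have "inverse y \<in> A" by metis
    then show False using u assms(1) by (auto simp: M_def unit_def)
  qed
  then show ?thesis using assms by (simp add: M_def mult_closed)
qed

lemma M_add_aux:
  assumes "y \<in> M" "z \<in> M" "z \<noteq> 0" "y / z \<in> A"
  shows "y + z \<in> M"
  using M_mult[OF assms(2), of "y / z + 1"] assms(3,4)
  by (simp add: add_closed one_closed distrib_right)

lemma M_add:
  assumes "y \<in> M" "z \<in> M"
  shows "y + z \<in> M"
proof (cases "y = 0 \<or> z = 0")
  case False
  have "y / z \<in> A \<or> z / y \<in> A"
    using total[of "y / z"] by simp
  then show ?thesis
    using M_add_aux[of y z] M_add_aux[of z y] assms False by (auto simp: add.commute)
qed (use assms in auto)

lemma M_sum: "(\<And>i. i \<in> I \<Longrightarrow> h i \<in> M) \<Longrightarrow> sum h I \<in> M"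
  by (induction I rule: infinite_finite_induct) (auto intro: M_add M_zero)

lemma M_not_unit: "y \<in> M \<Longrightarrow> \<not> unit y" by (simp add: M_def)

lemma unit_plus_M:
  assumes "unit u" "y \<in> M"
  shows "unit (u + y)"
proof (rule ccontr)
  assume "\<not> unit (u + y)"
  moreover have "u + y \<in> A" using assms by (auto simp: unit_def M_def intro: add_closed)
  ultimately have "u + y \<in> M" by (simp add: M_def)
  moreover have "- y \<in> M" using M_mult[OF assms(2), of "- 1"] uminus_closed[OF one_closed] by simp
  ultimately have "u + y + - y \<in> M" by (rule M_add)
  then show False using assms(1) M_not_unit by auto
qed

lemma dominant_term:
  assumes "finite I" "I \<noteq> {}" "\<And>i. i \<in> I \<Longrightarrow> h i \<noteq> 0"
  shows "\<exists>i0\<in>I. \<forall>i\<in>I. h i / h i0 \<in> A"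
  using assms
proof (induction I rule: finite_ne_induct)
  case (singleton i)
  then show ?case by (simp add: one_closed)
next
  case (insert j I)
  then obtain i0 where i0: "i0 \<in> I" "\<And>i. i \<in> I \<Longrightarrow> h i / h i0 \<in> A" by blast
  have nz: "h i0 \<noteq> 0" "h j \<noteq> 0" using insert.prems i0(1) by auto
  from total[of "h j / h i0"] show ?case
  proof
    assume "h j / h i0 \<in> A"
    then show ?thesis using i0 by auto
  next
    assume "inverse (h j / h i0) \<in> A"
    then have j: "h i0 / h j \<in> A" by simp
    have "h i / h j \<in> A" if "i \<in> I" for i
      using mult_closed[OF i0(2)[OF that] j] nz by simp
    then show ?thesis using nz one_closed by auto
  qed
qed

text \<open>If no other term were a unit multiple of the dominant one, dividing by it would give
  \<open>1\<close> plus non-units, which is a unit and not \<open>0\<close>.\<close>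

lemma vanishing_sum:
  assumes "finite I" "(\<Sum>i\<in>I. h i) = 0" "\<exists>i\<in>I. h i \<noteq> 0"
  shows "\<exists>i\<in>I. \<exists>j\<in>I. i \<noteq> j \<and> h i \<noteq> 0 \<and> h j \<noteq> 0 \<and> unit (h i / h j)"
proof -
  define J where "J = {i \<in> I. h i \<noteq> 0}"
  have J: "finite J" "J \<noteq> {}" "\<And>i. i \<in> J \<Longrightarrow> h i \<noteq> 0" using assms by (auto simp: J_def)
  have "\<exists>j\<in>J. \<forall>i\<in>J. h i / h j \<in> A"
    by (rule dominant_term[OF J])
  then obtain j where j: "j \<in> J" "\<forall>i\<in>J. h i / h j \<in> A"
    by (elim bexE)
  have "sum h J = sum h I"
    unfolding J_def using assms(1) by (intro sum.mono_neutral_left) auto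
  then have "h j + sum h (J - {j}) = 0"
    using assms(2) sum.remove[OF J(1) j(1), of h] by simp
  then have "1 + (\<Sum>i\<in>J - {j}. h i / h j) = 0"
    using J(3)[OF j(1)] by (simp add: sum_divide_distrib[symmetric] field_simps)
  moreover have "unit (1 + (\<Sum>i\<in>J - {j}. h i / h j))" if "\<And>i. i \<in> J - {j} \<Longrightarrow> \<not> unit (h i / h j)"
    using that j(2) by (intro unit_plus_M unit_1 M_sum) (simp add: M_def)
  ultimately obtain i where "i \<in> J - {j}" "unit (h i / h j)" by (auto simp: unit_def)
  then show ?thesis using j(1) by (auto simp: J_def)
qed

end

text \<open>Chevalley's argument: a subring that is maximal among those avoiding \<open>1 / x\<close> is a valuation ring.\<close>
lemma valuation_subring_exists:
  fixes x :: "'k::field"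
  assumes R: "is_subring R" "x \<in> R" "inverse x \<notin> R"
  shows "\<exists>A. valuation_subring A \<and> x \<in> A \<and> inverse x \<notin> A"
proof -
  define \<A> where "\<A> = {A. is_subring A \<and> x \<in> A \<and> inverse x \<notin> A}"
  have "\<exists>A\<in>\<A>. \<forall>B\<in>\<A>. A \<subseteq> B \<longrightarrow> B = A"
  proof (rule subset_Zorn_nonempty)
    show "\<A> \<noteq> {}" using R by (auto simp: \<A>_def)
    fix \<C> assume C: "\<C> \<noteq> {}" "subset.chain \<A> \<C>"
    then have C': "\<And>A. A \<in> \<C> \<Longrightarrow> is_subring A \<and> x \<in> A \<and> inverse x \<notin> A"
      by (auto simp: subset.chain_def \<A>_def)
    have "x' - y \<in> \<Union>\<C> \<and> x' * y \<in> \<Union>\<C>" if xy: "x' \<in> \<Union>\<C>" "y \<in> \<Union>\<C>" for x' y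
    proof -
      obtain A B where AB: "A \<in> \<C>" "x' \<in> A" "B \<in> \<C>" "y \<in> B" using xy by blast
      moreover have "A \<subseteq> B \<or> B \<subseteq> A" using C(2) AB by (auto simp: subset.chain_def)
      ultimately obtain E where E: "E \<in> \<C>" "x' \<in> E" "y \<in> E" by blast
      then interpret subring_set E by unfold_locales (use C' in blast)
      show ?thesis using E by (blast intro: diff_closed mult_closed)
    qed
    moreover have "1 \<in> \<Union>\<C>" "x \<in> \<Union>\<C>" "inverse x \<notin> \<Union>\<C>"
      using C(1) C' by (auto simp: is_subring_def)
    ultimately show "\<Union>\<C> \<in> \<A>" by (auto simp: \<A>_def is_subring_def)
  qed
  then obtain A where A: "is_subring A" "x \<in> A" "inverse x \<notin> A"
    and max: "\<And>B. is_subring B \<Longrightarrow> A \<subseteq> B \<Longrightarrow> inverse x \<notin> B \<Longrightarrow> B = A"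
    unfolding \<A>_def by blast
  interpret subring_set A by unfold_locales (rule A(1))
  have x0: "x \<noteq> 0" using A(3) zero_closed by auto
  \<comment> \<open>\<open>P y n\<close> places \<open>inverse x\<close> in \<open>A[y]\<close> with
    degree at most \<open>n\<close>. By maximality of \<open>A\<close> this happens for every
    \<open>y\<close> outside \<open>A\<close>.\<close>
  define P where "P y n \<longleftrightarrow> (\<exists>a. (\<forall>i. a i \<in> A) \<and> 1 = x * (\<Sum>i\<le>n. a i * y ^ i))" for y :: 'k and n :: nat
  have ex_P: "\<exists>n. P y n" if y: "y \<notin> A" for y
  proof -
    define B where "B = {poly q y | q. \<forall>i. coeff q i \<in> A}"
    have "poly [:0, 1:] y \<in> B"
      unfolding B_def by (intro CollectI exI[of _ "[:0, 1:]"]) (auto simp: coeff_pCons zero_closed one_closed split: nat.splits)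
    then have yB: "y \<in> B" by simp
    have AB: "A \<subseteq> B"
    proof
      fix a assume "a \<in> A"
      then have "poly [:a:] y \<in> B"
        unfolding B_def by (intro CollectI exI[of _ "[:a:]"]) (auto simp: coeff_pCons zero_closed split: nat.splits)
      then show "a \<in> B" by simp
    qed
    have "is_subring B"
      unfolding is_subring_def
    proof (intro conjI ballI)
      show "1 \<in> B" using AB one_closed by blast
      fix b c assume "b \<in> B" "c \<in> B"
      then obtain q r where q: "b = poly q y" "\<forall>i. coeff q i \<in> A" and r: "c = poly r y" "\<forall>i. coeff r i \<in> A"
        by (auto simp: B_def)
      show "b - c \<in> B"
        unfolding B_def using q r by (intro CollectI exI[of _ "q - r"]) (auto intro: diff_closed)
      show "b * c \<in> B"
        unfolding B_def using q r
        by (intro CollectI exI[of _ "q * r"]) (auto simp: coeff_mult intro!: sum_closed mult_closed)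
    qed
    moreover have "B \<noteq> A" using yB y by blast
    ultimately have "inverse x \<in> B" using max AB by blast
    then obtain q where q: "inverse x = poly q y" "\<forall>i. coeff q i \<in> A" by (auto simp: B_def)
    have "1 = x * (\<Sum>i\<le>degree q. coeff q i * y ^ i)"
      using q(1) x0 unfolding poly_altdef[symmetric] by (metis right_inverse)
    then show ?thesis using q(2) unfolding P_def by blast
  qed
  \<comment> \<open>Powers of \<open>u = 1 - x * b\<close> are \<open>1\<close> modulo
    \<open>x\<close>, so clearing denominators in a relation for \<open>inverse u\<close> would put
    \<open>inverse x\<close> into \<open>A\<close>.\<close>
  have one_minus: "inverse (1 - x * b) \<in> A \<and> 1 - x * b \<noteq> 0" if b: "b \<in> A" for b
  proof -
    define u where "u = 1 - x * b"
    have u0: "u \<noteq> 0"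
    proof
      assume "u = 0"
      then have "inverse x = b" using x0 by (simp add: u_def field_simps)
      then show False using A(3) b by simp
    qed
    have pow: "\<exists>c\<in>A. u ^ n = 1 - x * c" for n
    proof (induction n)
      case (Suc n)
      then obtain c where c: "c \<in> A" "u ^ n = 1 - x * c" by blast
      have "u ^ Suc n = u * (1 - x * c)"
        using c(2) by simp
      also have "\<dots> = 1 - x * (b + c - x * b * c)"
        unfolding u_def by (simp add: algebra_simps)
      finally show ?case using b c A(2) by (intro bexI[of _ "b + c - x * b * c"]) (auto intro!: add_closed diff_closed mult_closed)
    qed (auto intro: bexI[of _ 0] zero_closed)
    have "inverse u \<in> A"
    proof (rule ccontr)
      assume "inverse u \<notin> A"
      then obtain n a where a: "\<And>i. a i \<in> A" "1 = x * (\<Sum>i\<le>n. a i * inverse u ^ i)"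
        using ex_P unfolding P_def by metis
      obtain c where c: "c \<in> A" "u ^ n = 1 - x * c" using pow by blast
      have "u ^ n = x * (u ^ n * (\<Sum>i\<le>n. a i * inverse u ^ i))"
        using a(2) by (metis mult.left_commute mult_1_right)
      also have "u ^ n * (\<Sum>i\<le>n. a i * inverse u ^ i) = (\<Sum>i\<le>n. a i * u ^ (n - i))"
        unfolding sum_distrib_left using u0
        by (intro sum.cong refl) (simp add: power_diff power_inverse field_simps)
      finally have "1 - x * c = x * (\<Sum>i\<le>n. a i * u ^ (n - i))"
        unfolding c(2) .
      then have "1 = x * ((\<Sum>i\<le>n. a i * u ^ (n - i)) + c)"
        by (simp add: distrib_left diff_eq_eq)
      then have "inverse x = (\<Sum>i\<le>n. a i * u ^ (n - i)) + c"
        using x0 by (metis inverse_unique)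
      moreover have "u \<in> A" unfolding u_def using b A(2) by (intro diff_closed one_closed mult_closed)
      then have "(\<Sum>i\<le>n. a i * u ^ (n - i)) + c \<in> A"
        using a(1) c(1) by (intro add_closed sum_closed mult_closed power_closed)
      ultimately show False using A(3) by simp
    qed
    then show ?thesis using u0 by (simp add: u_def)
  qed
  \<comment> \<open>As \<open>1 - x * b 0\<close> is invertible, the relation for
    \<open>inverse y\<close>, multiplied by \<open>y ^ n\<close>, expresses \<open>y ^ n\<close> by
    lower powers.\<close>
  have reduce: "P y (n - 1)" if P: "P y n" "P (inverse y) m" and mn: "m \<le> n" "0 < n" and y0: "y \<noteq> 0" for y m n
  proof -
    obtain a where a: "\<And>i. a i \<in> A" "1 = x * (\<Sum>i\<le>n. a i * y ^ i)" using P(1) unfolding P_def by blast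
    obtain b where b: "\<And>i. b i \<in> A" "1 = x * (\<Sum>i\<le>m. b i * inverse y ^ i)" using P(2) unfolding P_def by blast
    define u where "u = 1 - x * b 0"
    have u: "inverse u \<in> A" "u \<noteq> 0" using one_minus[OF b(1)] by (simp_all add: u_def)
    define c where "c i = (if n - i \<le> m then x * b (n - i) * inverse u else 0)" for i
    have c: "c i \<in> A" for i
      using A(2) b(1) u(1) by (auto simp: c_def intro!: mult_closed zero_closed)
    have "(\<Sum>i\<le>m. b i * inverse y ^ i) = b 0 + (\<Sum>j\<in>{1..m}. b j * inverse y ^ j)"
      by (simp add: sum.atLeast1_atMost_eq atMost_atLeast0 sum.atLeast_Suc_atMost)
    then have "u = x * (\<Sum>j\<in>{1..m}. b j * inverse y ^ j)"
      using b(2) by (simp add: u_def algebra_simps)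
    then have "u * y ^ n = (\<Sum>j\<in>{1..m}. x * b j * (y ^ n * inverse y ^ j))"
      by (simp add: sum_distrib_left sum_distrib_right mult_ac)
    also have "\<dots> = (\<Sum>j\<in>{1..m}. x * b j * y ^ (n - j))"
      using mn(1) y0 by (intro sum.cong refl) (simp add: power_diff power_inverse field_simps)
    finally have "inverse u * (u * y ^ n) = (\<Sum>j\<in>{1..m}. x * b j * inverse u * y ^ (n - j))"
      by (simp only: sum_distrib_left mult_ac)
    then have "y ^ n = (\<Sum>j\<in>{1..m}. x * b j * inverse u * y ^ (n - j))"
      using u(2) by (simp only: mult.assoc[symmetric] left_inverse mult_1_left simp_thms)
    also have "\<dots> = (\<Sum>i<n. c i * y ^ i)"
    proof -
      have "(\<Sum>i<n. c i * y ^ i) = (\<Sum>i\<in>{n - m..<n}. x * b (n - i) * inverse u * y ^ i)"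
        by (intro sum.mono_neutral_cong_right) (auto simp: c_def)
      also have "\<dots> = (\<Sum>j\<in>{1..m}. x * b j * inverse u * y ^ (n - j))"
        by (rule sum.reindex_bij_witness[of _ "\<lambda>j. n - j" "\<lambda>i. n - i"]) (use mn in auto)
      finally show ?thesis by simp
    qed
    finally have yn: "y ^ n = (\<Sum>i<n. c i * y ^ i)" .
    have set: "{..n} = insert n {..<n}" "{..n - 1} = {..<n}" using mn(2) by auto
    have "(\<Sum>i\<le>n. a i * y ^ i) = (\<Sum>i<n. a i * y ^ i) + a n * y ^ n"
      unfolding set(1) by simp
    also have "\<dots> = (\<Sum>i\<le>n - 1. (a i + a n * c i) * y ^ i)"
      unfolding yn set(2) by (simp add: sum_distrib_left distrib_right sum.distrib mult.assoc)
    finally have "1 = x * (\<Sum>i\<le>n - 1. (a i + a n * c i) * y ^ i)" using a(2) by simp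
    moreover have "a i + a n * c i \<in> A" for i
      using a(1) c by (intro add_closed mult_closed)
    ultimately show ?thesis unfolding P_def by (intro exI[of _ "\<lambda>i. a i + a n * c i"]) auto
  qed
  have not_P0: "\<not> P y 0" for y
  proof
    assume "P y 0"
    then obtain a where "a \<in> A" "1 = x * a" unfolding P_def by auto
    then show False using A(3) by (metis inverse_unique)
  qed
  have "y \<in> A \<or> inverse y \<in> A" for y
  proof (rule ccontr)
    assume y: "\<not> (y \<in> A \<or> inverse y \<in> A)"
    then have y0: "y \<noteq> 0" using zero_closed by auto
    \<comment> \<open>Of the two relations of least degree, the longer one can be shortened by
      \<open>reduce\<close>.\<close>
    define n where "n = (LEAST n. P y n)"
    define m where "m = (LEAST n. P (inverse y) n)"
    have n: "P y n" "\<And>k. k < n \<Longrightarrow> \<not> P y k" and m: "P (inverse y) m" "\<And>k. k < m \<Longrightarrow> \<not> P (inverse y) k"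
      using ex_P y LeastI_ex[of "P y"] LeastI_ex[of "P (inverse y)"] not_less_Least unfolding n_def m_def by blast+
    have "0 < n" "0 < m" using n(1) m(1) not_P0 by (metis gr0I)+
    show False
    proof (cases "m \<le> n")
      case True
      then show False using reduce[OF n(1) m(1) True \<open>0 < n\<close> y0] n(2)[of "n - 1"] \<open>0 < n\<close> by simp
    next
      case False
      then show False using reduce[of "inverse y" m n] n(1) m y0 \<open>0 < m\<close> by simp
    qed
  qed
  then have "valuation_subring A" by unfold_locales
  then show ?thesis using A by blast
qed

text \<open>In a linear relation between \<open>1, y, ..., y ^ N\<close> over \<open>F\<^sub>p(x)\<close> two terms have the same value, so some
  \<open>y ^ e\<close> with \<open>1 \<le> e \<le> N\<close> is a unit times a power of \<open>x\<close>. Hence \<open>y ^ (N!)\<close> is one for all \<open>y\<close>, and the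
  value group is infinite cyclic.\<close>
lemma exists_prime_val:
  fixes x :: "'k::field"
  assumes p: "prime CHAR('k)" and x: "transc_prime x" and B: "finite B" "Fpt.lspan x B = UNIV"
  shows "\<exists>v. prime_val v \<and> 0 < v x"
proof -
  define R where "R = range (\<lambda>f. ipoly f x)"
  have "is_subring R"
    unfolding is_subring_def
  proof (intro conjI ballI)
    have "ipoly 1 x \<in> R" unfolding R_def by blast
    then show "1 \<in> R" by simp
    fix y z assume "y \<in> R" "z \<in> R"
    then obtain f g where fg: "y = ipoly f x" "z = ipoly g x" by (auto simp: R_def)
    have "ipoly (f - g) x \<in> R" "ipoly (f * g) x \<in> R" unfolding R_def by blast+
    then show "y - z \<in> R" "y * z \<in> R" unfolding fg by simp_all
  qed
  moreover have "ipoly [:0, 1:] x \<in> R" unfolding R_def by blast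
  then have "x \<in> R" by simp
  moreover have "inverse x \<notin> R"
  proof
    assume "inverse x \<in> R"
    then obtain f where f: "inverse x = ipoly f x" by (auto simp: R_def)
    have "x \<noteq> 0" using transc_primeD[OF x, of "[:0, 1:]"] by (auto simp: map_poly_pCons)
    then have "ipoly (pCons (- 1) f) x = 0" using f[symmetric] by simp
    from transc_primeD[OF x this] show False by (simp add: map_poly_pCons)
  qed
  ultimately obtain A where "valuation_subring A" and xA: "x \<in> A" "inverse x \<notin> A"
    using valuation_subring_exists by blast
  then interpret valuation_subring A by simp
  have x0: "x \<noteq> 0" using xA(2) zero_closed by auto
  have xM: "x \<in> M" using xA by (simp add: M_def unit_def)
  \<comment> \<open>\<open>sim y k\<close> means that \<open>y\<close> has the same value as
    \<open>x powi k\<close>, before any value function exists.\<close>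
  define sim where "sim y k \<longleftrightarrow> unit (y / x powi k)" for y k
  have sim_mult: "sim (y * z) (k + l)" if "sim y k" "sim z l" for y z k l
    using unit_mult[OF that[unfolded sim_def]] x0 by (simp add: sim_def power_int_add)
  have sim_divide: "sim (y / z) (k - l)" if "sim y k" "sim z l" for y z k l
  proof -
    have "(y / x powi k) / (z / x powi l) = (y / z) / x powi (k - l)"
      using x0 by (simp add: power_int_diff)
    then show ?thesis using unit_divide[OF that[unfolded sim_def]] by (simp add: sim_def)
  qed
  have sim_power: "sim (y ^ n) (int n * k)" if "sim y k" for y k n
  proof (induction n)
    case 0
    show ?case using unit_1 by (simp add: sim_def)
  next
    case (Suc n)
    then show ?case using sim_mult[OF that, of "y ^ n"] by (simp add: distrib_right)
  qed
  have pow_not_unit: "\<not> unit (x ^ n)" if "0 < n" for n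
  proof -
    have "x ^ n = x ^ (n - 1) * x" using that by (cases n) (auto simp: mult.commute)
    then have "x ^ n \<in> M" using M_mult[OF xM power_closed[OF xA(1)], of "n - 1"] by simp
    then show ?thesis by (rule M_not_unit)
  qed
  have powi_unit: "k = 0" if "unit (x powi k)" for k
  proof (rule ccontr)
    assume "k \<noteq> 0"
    then have "unit (x ^ nat \<bar>k\<bar>)"
      using that unit_inverse[OF that] by (auto simp: power_int_def power_inverse abs_if split: if_splits)
    then show False using pow_not_unit[of "nat \<bar>k\<bar>"] \<open>k \<noteq> 0\<close> by simp
  qed
  have sim_unique: "k = l" if "sim y k" "sim y l" for y k l
  proof -
    have "y \<noteq> 0" using that(1) by (auto simp: sim_def unit_def)
    then show ?thesis
      using sim_divide[OF that] powi_unit[of "l - k"] by (simp add: sim_def power_int_minus[symmetric] divide_inverse)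
  qed
  have of_int_unit: "unit (of_int c)" if c: "of_int c \<noteq> (0 :: 'k)" for c
  proof -
    obtain d where "of_int c * of_int d = (1 :: 'k)" using of_int_inverse[OF p c] by blast
    then have "inverse (of_int c) = (of_int d :: 'k)" by (rule inverse_unique)
    then show ?thesis using c of_int_closed[of c] of_int_closed[of d] by (simp add: unit_def)
  qed
  have sim_ipoly: "\<exists>k. sim (ipoly f x) k" if f: "ipoly f x \<noteq> 0" for f
  proof -
    obtain a c h where c: "of_int c \<noteq> (0 :: 'k)" "ipoly f x = x ^ a * (of_int c + x * ipoly h x)"
      using ipoly_lowest[OF ipoly_nonzero[OF f], of x] by (elim exE conjE)
    have "unit (of_int c + ipoly h x * x)"
      by (intro unit_plus_M of_int_unit c(1) M_mult xM ipoly_closed xA(1))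
    then have "sim (ipoly f x) (int a)" using c(2) x0 by (simp add: sim_def mult.commute)
    then show ?thesis by blast
  qed
  have sim_Fpt: "\<exists>k. sim \<gamma> k" if \<gamma>: "\<gamma> \<in> Fpt x" "\<gamma> \<noteq> 0" for \<gamma>
  proof -
    obtain f g where "ipoly g x \<noteq> 0" "\<gamma> = ipoly f x / ipoly g x" using Fpt_E[OF \<gamma>(1)] by blast
    moreover from this have "ipoly f x \<noteq> 0" using \<gamma>(2) by auto
    ultimately show ?thesis using sim_ipoly sim_divide by metis
  qed
  define N where "N = card B"
  define F where "F = (fact N :: nat)"
  have F: "0 < F" by (simp add: F_def)
  have sim_pow: "\<exists>k. sim (y ^ F) k" if y: "y \<noteq> 0" for y
  proof -
    have "card B < card {..N}" by (simp add: N_def)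
    then have "\<exists>c. (\<forall>i. c i \<in> Fpt x) \<and> (\<exists>i\<in>{..N}. c i \<noteq> 0) \<and> (\<Sum>i\<le>N. c i * y ^ i) = 0"
      using B(2) by (intro Fpt.dependent[OF B(1) finite_atMost]) auto
    then obtain \<gamma> where g: "\<forall>i. \<gamma> i \<in> Fpt x" "\<exists>i\<in>{..N}. \<gamma> i \<noteq> 0" "(\<Sum>i\<le>N. \<gamma> i * y ^ i) = 0"
      by (elim exE conjE)
    have "\<exists>i\<in>{..N}. \<exists>j\<in>{..N}. i \<noteq> j \<and> \<gamma> i * y ^ i \<noteq> 0 \<and> \<gamma> j * y ^ j \<noteq> 0 \<and> unit ((\<gamma> i * y ^ i) / (\<gamma> j * y ^ j))"
      using g(2) y by (intro vanishing_sum g(3)) auto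
    then obtain i j where ij: "i \<le> N" "j \<le> N" "i \<noteq> j" "\<gamma> i \<noteq> 0" "\<gamma> j \<noteq> 0"
      "unit ((\<gamma> i * y ^ i) / (\<gamma> j * y ^ j))" by auto
    have "\<exists>i j. i < j \<and> j \<le> N \<and> \<gamma> i \<noteq> 0 \<and> \<gamma> j \<noteq> 0 \<and> unit ((\<gamma> i * y ^ i) / (\<gamma> j * y ^ j))"
    proof (cases "i < j")
      case False
      then show ?thesis using ij unit_inverse[OF ij(6)] by (intro exI[of _ j] exI[of _ i]) auto
    qed (use ij in blast)
    then obtain i j where ij: "i < j" "j \<le> N" "\<gamma> i \<noteq> 0" "\<gamma> j \<noteq> 0"
      "unit ((\<gamma> i * y ^ i) / (\<gamma> j * y ^ j))" by blast
    obtain k l where kl: "sim (\<gamma> i) k" "sim (\<gamma> j) l" using sim_Fpt g(1) ij by blast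
    define e where "e = j - i"
    have "y ^ j = y ^ i * y ^ e" using ij(1) by (simp add: e_def flip: power_add)
    then have "(\<gamma> i / \<gamma> j) / ((\<gamma> i * y ^ i) / (\<gamma> j * y ^ j)) = y ^ e"
      using ij y by (simp add: field_simps)
    moreover have "sim ((\<gamma> i / \<gamma> j) / ((\<gamma> i * y ^ i) / (\<gamma> j * y ^ j))) ((k - l) - 0)"
      using ij(5) by (intro sim_divide kl) (simp add: sim_def)
    ultimately have "sim (y ^ e) (k - l)" by simp
    moreover have "e dvd F" using ij by (auto simp: F_def e_def intro!: dvd_fact)
    then have "y ^ F = (y ^ e) ^ (F div e)" by (simp flip: power_mult)
    ultimately show ?thesis using sim_power[of "y ^ e" "k - l" "F div e"] by auto
  qed
  \<comment> \<open>The value of \<open>y\<close> on the scale where \<open>x\<close> has value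
    \<open>F\<close>; it is not yet normalised.\<close>
  define V where "V y = (THE k. sim (y ^ F) k)" for y
  have V: "V y = k" if "sim (y ^ F) k" for y k
    unfolding V_def using that sim_unique by blast
  have simV: "sim (y ^ F) (V y)" if "y \<noteq> 0" for y
    using sim_pow[OF that] V by blast
  have V_mult: "V (y * z) = V y + V z" if "y \<noteq> 0" "z \<noteq> 0" for y z
    using sim_mult[OF simV[OF that(1)] simV[OF that(2)]] by (intro V) (simp add: power_mult_distrib)
  have V_divide: "V (y / z) = V y - V z" if "y \<noteq> 0" "z \<noteq> 0" for y z
    using sim_divide[OF simV[OF that(1)] simV[OF that(2)]] by (intro V) (simp add: power_divide)
  have V_x: "V x = int F"
    using unit_1 x0 by (intro V) (simp add: sim_def)
  have V_power: "V (y ^ n) = int n * V y" if "y \<noteq> 0" for y n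
    using sim_power[OF simV[OF that], of n] by (intro V) (simp flip: power_mult add: mult.commute)
  have V_powi: "V (y powi k) = k * V y" if "y \<noteq> 0" for y k
  proof (cases "0 \<le> k")
    case True
    then show ?thesis using V_power[OF that] by (simp add: power_int_nonneg_exp)
  next
    case False
    then have "y powi k = 1 / y ^ nat (- k)" by (simp add: power_int_def power_inverse divide_inverse)
    moreover have "V 1 = 0" using unit_1 by (intro V) (simp add: sim_def)
    ultimately show ?thesis using V_divide[of 1 "y ^ nat (- k)"] V_power[OF that] that False by simp
  qed
  have V_nonneg: "0 \<le> V y" if "y \<in> A" "y \<noteq> 0" for y
  proof (rule ccontr)
    assume "\<not> 0 \<le> V y"
    then have "y ^ F / x powi V y = y ^ F * x ^ (nat (- V y) - 1) * x"
      by (simp add: power_int_def power_inverse divide_inverse mult.assoc flip: power_Suc2)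
    moreover have "\<dots> \<in> M"
      using that xA by (intro M_mult xM mult_closed power_closed)
    ultimately show False using simV[OF that(2)] M_not_unit by (simp add: sim_def)
  qed
  have V_mem: "y \<in> A" if "0 \<le> V y" "y \<noteq> 0" for y
  proof (rule ccontr)
    assume y: "y \<notin> A"
    then have iy: "inverse y \<in> A" using total[of y] by simp
    \<comment> \<open>Then \<open>y ^ F\<close> is a unit, and multiplying it by powers of
      \<open>inverse y\<close> recovers \<open>y\<close> inside \<open>A\<close>.\<close>
    have "V y = 0"
      using V_nonneg[OF iy] V_powi[OF that(2), of "- 1"] that by simp
    then have "y ^ F \<in> A" using simV[OF that(2)] by (simp add: sim_def unit_def)
    then have "y ^ F * inverse y ^ (F - 1) \<in> A" by (rule mult_closed[OF _ power_closed[OF iy]])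
    moreover have "y ^ F * inverse y ^ (F - 1) = y"
      using F that(2) by (cases F) (simp_all add: power_inverse)
    ultimately show False using y by simp
  qed
  have V_add_aux: "V z \<le> V (y + z)" if "y \<noteq> 0" "z \<noteq> 0" "y + z \<noteq> 0" "V z \<le> V y" for y z
  proof -
    have "y / z \<in> A" using V_mem[of "y / z"] V_divide that by simp
    then have "(y + z) / z \<in> A" using add_closed[OF _ one_closed] that by (simp add: add_divide_distrib)
    then show ?thesis using V_nonneg[of "(y + z) / z"] V_divide[of "y + z" z] that by simp
  qed
  have V_add: "min (V y) (V z) \<le> V (y + z)" if "y \<noteq> 0" "z \<noteq> 0" "y + z \<noteq> 0" for y z
    using V_add_aux[of y z] V_add_aux[of z y] that by (auto simp: min_def add.commute)
  \<comment> \<open>The least positive value generates the value group, so division by it makes the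
    valuation onto.\<close>
  define G where "G = (LEAST m. 0 < m \<and> (\<exists>y. y \<noteq> 0 \<and> V y = int m))"
  have exG: "\<exists>m. 0 < m \<and> (\<exists>y. y \<noteq> 0 \<and> V y = int m)" using F x0 V_x by blast
  from LeastI_ex[OF exG] obtain \<pi> where G: "0 < G" "\<pi> \<noteq> 0" "V \<pi> = int G" unfolding G_def by auto
  have G_dvd: "int G dvd V y" if y: "y \<noteq> 0" for y
  proof -
    define q where "q = V y div int G"
    have "V (y / \<pi> powi q) = V y - q * int G"
      using V_divide[OF y] V_powi[OF G(2)] G by simp
    then have r: "V (y / \<pi> powi q) = V y mod int G"
      by (simp add: q_def minus_div_mult_eq_mod)
    show ?thesis
    proof (rule ccontr)
      assume "\<not> int G dvd V y"
      then have "V y mod int G \<noteq> 0" by (simp add: dvd_eq_mod_eq_0)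
      moreover have "0 \<le> V y mod int G" using G(1) by simp
      ultimately have pos: "0 < V y mod int G" by linarith
      have "nat (V y mod int G) < G" using G(1) by (simp add: nat_less_iff)
      then have "\<not> (0 < nat (V y mod int G) \<and> (\<exists>z. z \<noteq> 0 \<and> V z = int (nat (V y mod int G))))"
        unfolding G_def by (rule not_less_Least)
      moreover have "\<exists>z. z \<noteq> 0 \<and> V z = int (nat (V y mod int G))"
        using r y G pos by (intro exI[of _ "y / \<pi> powi q"]) simp
      ultimately show False using pos by auto
    qed
  qed
  define v where "v y = (if y = 0 then 0 else V y div int G)" for y
  have v: "V y = v y * int G" if "y \<noteq> 0" for y
    using G_dvd[OF that] that by (simp add: v_def)
  have "prime_val v"
    unfolding prime_val_def
  proof (intro conjI allI impI)
    show "v 0 = 0" by (simp add: v_def)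
    show "v (y * z) = v y + v z" if "y \<noteq> 0" "z \<noteq> 0" for y z
    proof -
      have "v (y * z) * int G = (v y + v z) * int G"
        using V_mult[OF that] that by (simp add: v[symmetric] distrib_right)
      then show ?thesis using G(1) by simp
    qed
    show "min (v y) (v z) \<le> v (y + z)" if "y \<noteq> 0" "z \<noteq> 0" "y + z \<noteq> 0" for y z
    proof -
      have "v y * int G \<le> v (y + z) * int G \<or> v z * int G \<le> v (y + z) * int G"
        using V_add[OF that] that by (simp add: v[symmetric] min_le_iff_disj)
      then show ?thesis using G(1) by auto
    qed
    show "\<exists>y. y \<noteq> 0 \<and> v y = 1" using G by (intro exI[of _ \<pi>]) (simp add: v_def)
  qed
  moreover have "0 < v x" using v[OF x0] V_x F G(1) by (metis mult_le_0_iff not_le of_nat_0_less_iff of_nat_0_le_iff)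
  ultimately show ?thesis by blast
qed

section \<open>Orbits\<close>

lemma lspan_mono:
  assumes "Fpt t \<subseteq> Fpt s"
  shows "Fpt.lspan t B \<subseteq> Fpt.lspan s B"
proof
  fix x assume "x \<in> Fpt.lspan t B"
  from Fpt.lspan_E[OF this] obtain c where "\<And>b. c b \<in> Fpt t" "x = (\<Sum>b\<in>B. c b * b)"
    by blast
  then show "x \<in> Fpt.lspan s B"
    unfolding Fpt.lspan_def using assms by (intro CollectI exI[of _ c]) auto
qed

text \<open>An element of value \<open>0\<close> at all places but one is algebraic over the prime field, because a
  transcendental element has both a zero and a pole; being algebraic passes from \<open>u\<close> to \<open>1 - u\<close>.\<close>
lemma unit_outside_one_place:
  fixes u :: "'k::field"
  assumes p: "prime CHAR('k)"
    and places: "\<And>x :: 'k. transc_prime x \<Longrightarrow> \<exists>v. prime_val v \<and> 0 < v x"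
    and u: "\<And>v. prime_val v \<Longrightarrow> v \<noteq> v0 \<Longrightarrow> v u = 0"
    and v: "prime_val v"
  shows "v (1 - u) = 0"
proof (rule ccontr)
  interpret discrete_valuation v by unfold_locales (rule v)
  assume "v (1 - u) \<noteq> 0"
  then have tr: "transc_prime u"
    using transc_prime_of_nonzero[OF p] transc_prime_one_minus by blast
  obtain w where w: "prime_val w" "0 < w u" using places[OF tr] by blast
  obtain w' where w': "prime_val w'" "0 < w' (inverse u)"
    using places[OF transc_prime_inverse[OF tr]] by blast
  interpret w': discrete_valuation w' by unfold_locales (rule w'(1))
  have "w = v0" "w' = v0" using u[OF w(1)] u[OF w'(1)] w(2) w'(2) by auto
  then show False using w(2) w'(2) w'.v_inverse[of u] by simp
qed

theorem theorem6p6: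
  fixes f g :: "'k::field poly" and d :: nat and P :: "'k option"
  assumes "global_function_field TYPE('k)"
    and "hom_coprime f g d"
    and "card {v::'k \<Rightarrow> int. prime_val v \<and> \<not> good_reduction v f g d} = 1"
    and "finite (orbit (rat_map f g d) P)"
  shows "(\<forall>v. prime_val v \<and> good_reduction v f g d \<longrightarrow>
            card (orbit (rat_map f g d) P) \<le> 3 * residue_card v + 6)
       \<and> (\<forall>(t::'k) D. transc_prime t \<and> ext_degree (Fpt t) D \<longrightarrow>
            card (orbit (rat_map f g d) P) \<le> 3 * CHAR('k) ^ D + 6)"
proof -
  obtain t0 :: 'k and D0 where p: "prime CHAR('k)" and t0: "transc_prime t0" "ext_degree (Fpt t0) D0"
    using assms(1) unfolding global_function_field_def by blast
  obtain B0 where B0: "finite B0" "Fpt.lspan t0 B0 = UNIV"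
    using ext_degree_lspan[OF t0(2)] by metis
  have span: "\<exists>B. finite B \<and> Fpt.lspan x B = UNIV" if "transc_prime x" for x :: 'k
    using lspan_exchange[OF that B0] by metis
  have places: "\<exists>v. prime_val v \<and> 0 < v x" if "transc_prime x" for x :: 'k
    using span[OF that] exists_prime_val[OF p that] by blast
  obtain v0 where bad: "{v :: 'k \<Rightarrow> int. prime_val v \<and> \<not> good_reduction v f g d} = {v0}"
    using assms(3) by (rule card_1_singletonE)
  define V where "V = {v :: 'k \<Rightarrow> int. prime_val v \<and> good_reduction v f g d}"
  have V: "discrete_valuation v" "good_reduction v f g d" if "v \<in> V" for v
    using that by (auto simp: V_def discrete_valuation_def)
  have V_or: "v \<in> V" if "prime_val v" "v \<noteq> v0" for v
    using that bad by (auto simp: V_def)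
  interpret contracting_family V ldist "rat_map f g d"
  proof
    fix v :: "'k \<Rightarrow> int" and Q R T :: "'k option" assume v: "v \<in> V"
    interpret discrete_valuation v by (rule V(1)[OF v])
    note gr = V(2)[OF v] assms(2)
    show "ldist v Q R = ldist v R Q" by (rule ldist_commute)
    show "(ldist v Q R = \<infinity>) = (Q = R)" by simp
    show "min (ldist v Q R) (ldist v R T) \<le> ldist v Q T" by (rule ldist_ultra)
    show "ldist v Q R \<le> ldist v (rat_map f g d Q) (rat_map f g d R)"
      by (rule ldist_rat_map_mono[OF gr])
    show "ldist v T Q + ldist v T R \<le> ldist v (rat_map f g d T) (rat_map f g d Q)"
      if "Q \<noteq> R" "rat_map f g d Q = rat_map f g d R"
      by (rule ldist_rat_map_double[OF gr that])
  next
    fix a b c e :: "'k option" and v assume dist: "distinct [a, b, c, e]"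
      and eq: "\<And>v. v \<in> V \<Longrightarrow> ldist v a b + ldist v c e = ldist v a c + ldist v b e" and v: "v \<in> V"
    \<comment> \<open>Although written with brackets at \<open>v\<close>, this element does not
      depend on the place, so its value at any \<open>w\<close> is read off from distances at
      \<open>w\<close>.\<close>
    define u where "u = bracket v a b * bracket v c e / (bracket v a c * bracket v b e)"
    have unit: "w u = 0" if w: "w \<in> V" for w
    proof -
      interpret discrete_valuation w by (rule V(1)[OF w])
      note l = ldist_unequal[of a b] ldist_unequal[of c e] ldist_unequal[of a c] ldist_unequal[of b e]
      have "w (bracket w a b) + w (bracket w c e) = w (bracket w a c) + w (bracket w b e)"
        using eq[OF w] l dist by simp
      then show ?thesis
        unfolding u_def cross_ratio_indep[of v _ _ _ _ w] using l dist by (simp add: v_divide v_mult)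
    qed
    interpret discrete_valuation v by (rule V(1)[OF v])
    note l = ldist_unequal[of a b] ldist_unequal[of c e] ldist_unequal[of a c] ldist_unequal[of b e]
      ldist_unequal[of a e] ldist_unequal[of b c]
    have "1 - u = bracket v a e * bracket v b c / (bracket v a c * bracket v b e)"
      using bracket_pluecker[of v a b c e] l dist by (simp add: u_def field_simps)
    moreover have "v (1 - u) = 0"
    proof (rule unit_outside_one_place[OF p])
      show "\<exists>v. prime_val v \<and> 0 < v x" if "transc_prime x" for x :: 'k by (rule places[OF that])
      show "w u = 0" if "prime_val w" "w \<noteq> v0" for w by (rule unit[OF V_or[OF that]])
      show "prime_val v" by (rule prime_val)
    qed
    ultimately have "v (bracket v a e) + v (bracket v b c) = v (bracket v a c) + v (bracket v b e)"
      using l dist by (simp add: v_divide v_mult)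
    then show "ldist v a e + ldist v b c = ldist v a c + ldist v b e"
      using l dist by simp
  qed
  have bound: "card (orbit (rat_map f g d) P) \<le> 3 * residue_card v + 6" if v: "v \<in> V" for v
  proof -
    interpret discrete_valuation v by (rule V(1)[OF v])
    \<comment> \<open>A uniformiser is transcendental, so the whole field is finite over
      \<open>Fpt s\<close> and the residue field at \<open>v\<close> is finite.\<close>
    obtain s where "v s = 1" using prime_val unfolding prime_val_def by blast
    then have s: "0 < v s" by simp
    then obtain B where B: "finite B" "Fpt.lspan s B = UNIV"
      using span transc_prime_of_pos[OF p] by blast
    have "card (orbit (rat_map f g d) P) \<le> 3 * residue_card v + 3"
      by (rule card_orbit_le[OF v assms(4)])
        (rule card_equidistant_le[OF residue_field_bound(1)[OF p s B]])
    then show ?thesis by simp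
  qed
  have "card (orbit (rat_map f g d) P) \<le> 3 * CHAR('k) ^ D + 6"
    if t: "transc_prime t" and D: "ext_degree (Fpt t) D" for t :: 'k and D
  proof -
    obtain B where B: "finite B" "card B \<le> D" "Fpt.lspan t B = UNIV"
      using ext_degree_lspan[OF D] by metis
    obtain v where v: "prime_val v" "0 < v t" using places[OF t] by blast
    obtain v' where v': "prime_val v'" "0 < v' (inverse t)"
      using places[OF transc_prime_inverse[OF t]] by blast
    interpret v: discrete_valuation v by unfold_locales (rule v(1))
    interpret v': discrete_valuation v' by unfold_locales (rule v'(1))
    \<comment> \<open>\<open>t\<close> and \<open>inverse t\<close> generate the same field, so
      \<open>B\<close> also serves at the pole of \<open>t\<close>.\<close>
    have "t \<in> Fpt (inverse t)"
      using Fpt.inverse_closed[OF gen_in_Fpt, of "inverse t"] by simp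
    then have B': "Fpt.lspan (inverse t) B = UNIV"
      using lspan_mono[OF Fpt.Fpt_subset, of t "inverse t" B] B(3) by auto
    have le: "CHAR('k) ^ card B \<le> CHAR('k) ^ D"
      using B(2) p prime_gt_0_nat by (intro power_increasing) (auto simp: Suc_le_eq)
    \<comment> \<open>A zero of \<open>t\<close> is not a pole, so at most one of the two places is
      the bad one.\<close>
    have "v \<noteq> v'" using v(2) v'(2) by auto
    then consider "v \<in> V" | "v' \<in> V" using V_or v(1) v'(1) by blast
    then show ?thesis
    proof cases
      case 1
      then show ?thesis
        using bound[OF 1] v.residue_field_bound(2)[OF p v(2) B(1,3)] le by linarith
    next
      case 2
      then show ?thesis
        using bound[OF 2] v'.residue_field_bound(2)[OF p v'(2) B(1) B'] le by linarith
    qed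
  qed
  then show ?thesis using bound by (auto simp: V_def)
qed

end
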